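(* Let $n\ge 3$ be an integer, let $Q_{2^n}$ be the generalized quaternion group of order $2^n$, and let $k$ be a field containing the Galois field $\mathbb{F}_{2^{n-2}}$ of $2^{n-2}$ elements. Then the group algebra $kQ_{2^n}$ admits a deformation $[kQ_{2^n}]_t$ which is a separable $k((t))$-algebra and which satisfies $$\overline{k((t))}\otimes_{k((t))}[kQ_{2^{n}}]_t \;\simeq\;\bigoplus_{i=1}^{2^{n-2}-1}M_2\big(\overline{k((t))}\big)\;\oplus\;\bigoplus_{i=1}^4\overline{k((t))}$$ as $\overline{k((t))}$-algebras. In particular, the dimensions (with multiplicity) of the simple components of $\overline{k((t))}\otimes_{k((t))}[kQ_{2^n}]_t$ over $\overline{k((t))}$ are the same as the dimensions of the simple components of $\mathbb{C}Q_{2^n}$ over $\mathbb{C}$.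
   Context: All algebras are associative. $k[[t]]$ is the ring of formal power series over $k$, $k((t))$ is its field of fractions, and $\overline{k((t))}$ is an algebraic closure of $k((t))$. Deformation: Let $A$ be a $k$-algebra. Suppose the free $k[[t]]$-module $\Lambda_t:=k[[t]]\otimes_k A$ admits a multiplication (making it a $k[[t]]$-algebra) such that there is an isomorphism of $k$-algebras $A\simeq \Lambda_t/\langle t\Lambda_t\rangle$. Then the $k((t))$-algebra $A_t:=k((t))\otimes_{k[[t]]}\Lambda_t$ is called a deformation of $A$. The generalized quaternion group is $Q_{2^n}=\langle \sigma,\tau \mid \sigma^{2^{n-1}}=1,\ \tau^2=\sigma^{2^{n-2}},\ \tau\sigma\tau^{-1}=\sigma^{-1}\rangle$. *)

theory Defs
  imports
    Complex_Main
    "HOL-Library.FuncSet"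
    "HOL-Library.Poly_Mapping"
    "HOL-Computational_Algebra.Formal_Laurent_Series"
    "HOL-Algebra.Module"
    "HOL-Algebra.QuotRing"
    "HOL-Algebra.Embedded_Algebras"
    "HOL-Algebra.Free_Abelian_Groups"
    "HOL-Algebra.Algebraic_Closure_Type"
    "Jordan_Normal_Form.Matrix"
begin

section \<open>Associative algebras\<close>

text \<open>
  Algebras are represented by the record type \<^typ>\<open>('r, 'a) module\<close>, which carries both a ring
  structure and a scalar multiplication. The locale \<^locale>\<open>algebra\<close> of the library only covers
  commutative algebras. Base rings that are given as types are turned into ring records by
  \<^const>\<open>ring_of_type_algebra\<close>.
\<close>

definition assoc_algebra :: "('r, 'm) ring_scheme \<Rightarrow> ('r, 'a) module \<Rightarrow> bool" where
  "assoc_algebra R A \<longleftrightarrow> Module.module R A \<and> Ring.ring A \<and>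
     (\<forall>r\<in>carrier R. \<forall>x\<in>carrier A. \<forall>y\<in>carrier A.
        (r \<odot>\<^bsub>A\<^esub> x) \<otimes>\<^bsub>A\<^esub> y = r \<odot>\<^bsub>A\<^esub> (x \<otimes>\<^bsub>A\<^esub> y) \<and>
        x \<otimes>\<^bsub>A\<^esub> (r \<odot>\<^bsub>A\<^esub> y) = r \<odot>\<^bsub>A\<^esub> (x \<otimes>\<^bsub>A\<^esub> y))"

definition algebra_isomorphic ::
  "('r, 'm) ring_scheme \<Rightarrow> ('r, 'a) module \<Rightarrow> ('r, 'b) module \<Rightarrow> bool" where
  "algebra_isomorphic R A B \<longleftrightarrow>
     (\<exists>h\<in>ring_iso A B. \<forall>r\<in>carrier R. \<forall>x\<in>carrier A. h (r \<odot>\<^bsub>A\<^esub> x) = r \<odot>\<^bsub>B\<^esub> h x)"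

definition opposite_algebra :: "('r, 'a) module \<Rightarrow> ('r, 'a) module" where
  "opposite_algebra A = A\<lparr>mult := \<lambda>x y. y \<otimes>\<^bsub>A\<^esub> x\<rparr>"

text \<open>A commutative ring (given as a type) as an algebra along a ring homomorphism into it.\<close>

definition algebra_along :: "('r \<Rightarrow> 's::comm_ring_1) \<Rightarrow> ('r, 's) module" where
  "algebra_along \<phi> = \<lparr>carrier = UNIV, monoid.mult = (*), one = 1, ring.zero = 0, add = (+),
     module.smult = (\<lambda>r x. \<phi> r * x)\<rparr>"

definition restrict_scalars :: "('r \<Rightarrow> 's) \<Rightarrow> ('s, 'a) module \<Rightarrow> ('r, 'a) module" where
  "restrict_scalars \<phi> A =
     \<lparr>carrier = carrier A, monoid.mult = monoid.mult A, one = \<one>\<^bsub>A\<^esub>, ring.zero = \<zero>\<^bsub>A\<^esub>, add = add A,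
      module.smult = (\<lambda>r x. \<phi> r \<odot>\<^bsub>A\<^esub> x)\<rparr>"

definition quotient_algebra :: "('r, 'a) module \<Rightarrow> 'a set \<Rightarrow> ('r, 'a set) module" where
  "quotient_algebra A I =
     \<lparr>carrier = carrier (A Quot I), monoid.mult = monoid.mult (A Quot I), one = \<one>\<^bsub>A Quot I\<^esub>,
      ring.zero = \<zero>\<^bsub>A Quot I\<^esub>, add = add (A Quot I),
      module.smult = (\<lambda>r C. \<Union>x\<in>C. I +>\<^bsub>A\<^esub> (r \<odot>\<^bsub>A\<^esub> x))\<rparr>"

definition product_algebra :: "'i set \<Rightarrow> ('i \<Rightarrow> ('r, 'a) module) \<Rightarrow> ('r, 'i \<Rightarrow> 'a) module" where
  "product_algebra I A =
     \<lparr>carrier = (\<Pi>\<^sub>E i\<in>I. carrier (A i)),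
      monoid.mult = (\<lambda>f g. \<lambda>i\<in>I. f i \<otimes>\<^bsub>A i\<^esub> g i),
      one = (\<lambda>i\<in>I. \<one>\<^bsub>A i\<^esub>),
      ring.zero = (\<lambda>i\<in>I. \<zero>\<^bsub>A i\<^esub>),
      add = (\<lambda>f g. \<lambda>i\<in>I. f i \<oplus>\<^bsub>A i\<^esub> g i),
      module.smult = (\<lambda>r f. \<lambda>i\<in>I. r \<odot>\<^bsub>A i\<^esub> f i)\<rparr>"

definition direct_sum_algebra ::
  "('r, 'a) module \<Rightarrow> ('r, 'b) module \<Rightarrow> ('r, 'a \<times> 'b) module" where
  "direct_sum_algebra A B =
     \<lparr>carrier = carrier A \<times> carrier B,
      monoid.mult = (\<lambda>(a, b) (a', b'). (a \<otimes>\<^bsub>A\<^esub> a', b \<otimes>\<^bsub>B\<^esub> b')),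
      one = (\<one>\<^bsub>A\<^esub>, \<one>\<^bsub>B\<^esub>),
      ring.zero = (\<zero>\<^bsub>A\<^esub>, \<zero>\<^bsub>B\<^esub>),
      add = (\<lambda>(a, b) (a', b'). (a \<oplus>\<^bsub>A\<^esub> a', b \<oplus>\<^bsub>B\<^esub> b')),
      module.smult = (\<lambda>r (a, b). (r \<odot>\<^bsub>A\<^esub> a, r \<odot>\<^bsub>B\<^esub> b))\<rparr>"


section \<open>Tensor products\<close>

text \<open>
  \<open>M \<otimes>\<^sub>R N\<close> for a commutative ring \<open>R\<close> is the free abelian group on
  \<open>carrier M \<times> carrier N\<close> modulo the subgroup generated by the bilinearity relations;
  its elements are cosets. For algebras, multiplication is induced by
  \<open>(a \<otimes> b)(c \<otimes> d) = ac \<otimes> bd\<close>.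
\<close>

type_synonym ('m, 'n) tensor = "(('m \<times> 'n) \<Rightarrow>\<^sub>0 int) set"

definition tensor_free :: "('r, 'm) module \<Rightarrow> ('r, 'n) module \<Rightarrow> (('m \<times> 'n) \<Rightarrow>\<^sub>0 int) monoid" where
  "tensor_free M N = free_Abelian_group (carrier M \<times> carrier N)"

definition tensor_relations ::
  "('r, 'c) ring_scheme \<Rightarrow> ('r, 'm) module \<Rightarrow> ('r, 'n) module \<Rightarrow> (('m \<times> 'n) \<Rightarrow>\<^sub>0 int) set" where
  "tensor_relations R M N =
     {frag_of (x \<oplus>\<^bsub>M\<^esub> x', y) - frag_of (x, y) - frag_of (x', y) | x x' y.
        x \<in> carrier M \<and> x' \<in> carrier M \<and> y \<in> carrier N} \<union>
     {frag_of (x, y \<oplus>\<^bsub>N\<^esub> y') - frag_of (x, y) - frag_of (x, y') | x y y'.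
        x \<in> carrier M \<and> y \<in> carrier N \<and> y' \<in> carrier N} \<union>
     {frag_of (r \<odot>\<^bsub>M\<^esub> x, y) - frag_of (x, r \<odot>\<^bsub>N\<^esub> y) | r x y.
        r \<in> carrier R \<and> x \<in> carrier M \<and> y \<in> carrier N}"

definition tensor_kernel ::
  "('r, 'c) ring_scheme \<Rightarrow> ('r, 'm) module \<Rightarrow> ('r, 'n) module \<Rightarrow> (('m \<times> 'n) \<Rightarrow>\<^sub>0 int) set" where
  "tensor_kernel R M N = generate (tensor_free M N) (tensor_relations R M N)"

definition tensor_class ::
  "('r, 'c) ring_scheme \<Rightarrow> ('r, 'm) module \<Rightarrow> ('r, 'n) module \<Rightarrow> (('m \<times> 'n) \<Rightarrow>\<^sub>0 int) \<Rightarrow>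
   ('m, 'n) tensor" where
  "tensor_class R M N f = tensor_kernel R M N #>\<^bsub>tensor_free M N\<^esub> f"

definition pure_tensor ::
  "('r, 'c) ring_scheme \<Rightarrow> ('r, 'm) module \<Rightarrow> ('r, 'n) module \<Rightarrow> 'm \<Rightarrow> 'n \<Rightarrow> ('m, 'n) tensor" where
  "pure_tensor R M N x y = tensor_class R M N (frag_of (x, y))"

definition frag_mult ::
  "('r, 'm) module \<Rightarrow> ('r, 'n) module \<Rightarrow>
   (('m \<times> 'n) \<Rightarrow>\<^sub>0 int) \<Rightarrow> (('m \<times> 'n) \<Rightarrow>\<^sub>0 int) \<Rightarrow> (('m \<times> 'n) \<Rightarrow>\<^sub>0 int)" where
  "frag_mult M N f g =
     frag_extend (\<lambda>(a, b). frag_extend (\<lambda>(c, d). frag_of (a \<otimes>\<^bsub>M\<^esub> c, b \<otimes>\<^bsub>N\<^esub> d)) g) f"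

definition tensor_ring ::
  "('r, 'c) ring_scheme \<Rightarrow> ('r, 'm) module \<Rightarrow> ('r, 'n) module \<Rightarrow> ('m, 'n) tensor ring" where
  "tensor_ring R M N =
     \<lparr>carrier = carrier (tensor_free M N Mod tensor_kernel R M N),
      monoid.mult = (\<lambda>C D. \<Union>f\<in>C. \<Union>g\<in>D. tensor_class R M N (frag_mult M N f g)),
      one = pure_tensor R M N \<one>\<^bsub>M\<^esub> \<one>\<^bsub>N\<^esub>,
      ring.zero = \<one>\<^bsub>tensor_free M N Mod tensor_kernel R M N\<^esub>,
      add = monoid.mult (tensor_free M N Mod tensor_kernel R M N)\<rparr>"

text \<open>
  Base change \<open>S \<otimes>\<^sub>R N\<close> along a commutative \<open>R\<close>-algebra \<open>S\<close>, as an algebra over \<open>S\<close>;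
  scalars act by \<open>s (a \<otimes> b) = sa \<otimes> b\<close>.
\<close>

definition base_change ::
  "('r, 'c) ring_scheme \<Rightarrow> ('r, 's) module \<Rightarrow> ('r, 'n) module \<Rightarrow> ('s, ('s, 'n) tensor) module" where
  "base_change R S N =
     \<lparr>carrier = carrier (tensor_ring R S N), monoid.mult = monoid.mult (tensor_ring R S N),
      one = \<one>\<^bsub>tensor_ring R S N\<^esub>, ring.zero = \<zero>\<^bsub>tensor_ring R S N\<^esub>, add = add (tensor_ring R S N),
      module.smult = (\<lambda>s C. \<Union>f\<in>C.
        tensor_class R S N (frag_extend (\<lambda>(a, b). frag_of (s \<otimes>\<^bsub>S\<^esub> a, b)) f))\<rparr>"


section \<open>Separable algebras\<close>

text \<open>
  An \<open>R\<close>-algebra \<open>A\<close> is separable if the multiplication map \<open>\<mu> : A \<otimes>\<^sub>R A\<^sup>o\<^sup>p \<rightarrow> A\<close>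
  splits as a map of \<open>A\<close>-bimodules (equivalently, of left \<open>A \<otimes>\<^sub>R A\<^sup>o\<^sup>p\<close>-modules), that is, if
  \<open>A\<close> is projective over its enveloping algebra. The map \<open>\<mu>\<close> is uniquely determined by the two
  conditions below.
\<close>

definition separable_algebra :: "('r, 'c) ring_scheme \<Rightarrow> ('r, 'a) module \<Rightarrow> bool" where
  "separable_algebra R A \<longleftrightarrow> assoc_algebra R A \<and>
     (let Ae = tensor_ring R A (opposite_algebra A);
          tens = pure_tensor R A (opposite_algebra A)
      in \<exists>\<mu>\<in>hom (add_monoid Ae) (add_monoid A). \<exists>s\<in>hom (add_monoid A) (add_monoid Ae).
           (\<forall>a\<in>carrier A. \<forall>b\<in>carrier A. \<mu> (tens a b) = a \<otimes>\<^bsub>A\<^esub> b) \<and>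
           (\<forall>a\<in>carrier A. \<forall>b\<in>carrier A. \<forall>x\<in>carrier A.
              s (a \<otimes>\<^bsub>A\<^esub> x \<otimes>\<^bsub>A\<^esub> b) = tens a b \<otimes>\<^bsub>Ae\<^esub> s x) \<and>
           (\<forall>x\<in>carrier A. \<mu> (s x) = x))"


section \<open>Deformations\<close>

text \<open>
  \<open>k[[t]]\<close> is the type \<^typ>\<open>'k fps\<close> with \<open>t =\<close> \<^const>\<open>fps_X\<close>, and \<open>k((t))\<close> is \<^typ>\<open>'k fls\<close>.
  The free \<open>k[[t]]\<close>-module \<open>k[[t]] \<otimes>\<^sub>k A\<close> keeps its carrier, addition and scalar
  multiplication, while its multiplication and unit are replaced by arbitrary \<open>m\<close> and \<open>u\<close>.
\<close>

definition is_deformation ::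
  "('k::field, 'a) module \<Rightarrow> ('k fls, ('k fls, ('k fps, 'a) tensor) tensor) module \<Rightarrow> bool" where
  "is_deformation A At \<longleftrightarrow> assoc_algebra ring_of_type_algebra A \<and>
     (\<exists>m u. let \<Lambda> = (base_change ring_of_type_algebra (algebra_along fps_const) A)
                     \<lparr>monoid.mult := m, one := u\<rparr>
        in assoc_algebra (ring_of_type_algebra :: 'k fps ring) \<Lambda> \<and>
           algebra_isomorphic ring_of_type_algebra A
             (restrict_scalars fps_const
               (quotient_algebra \<Lambda> (Idl\<^bsub>\<Lambda>\<^esub> {fps_X \<odot>\<^bsub>\<Lambda>\<^esub> x | x. x \<in> carrier \<Lambda>}))) \<and>
           At = base_change ring_of_type_algebra (algebra_along fps_to_fls) \<Lambda>)"


section \<open>Simple components\<close>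

text \<open>
  The simple components of a semisimple algebra are its minimal nonzero two-sided ideals.
  Dimensions over the base field are taken with respect to its image \<open>{c \<cdot> 1}\<close> in the algebra.
\<close>

definition simple_components :: "('r, 'a) module \<Rightarrow> 'a set set" where
  "simple_components A =
     {I. ideal I A \<and> I \<noteq> {\<zero>\<^bsub>A\<^esub>} \<and> (\<forall>J. ideal J A \<and> J \<subseteq> I \<longrightarrow> J = {\<zero>\<^bsub>A\<^esub>} \<or> J = I)}"

definition subspace_dimension ::
  "('r, 'c) ring_scheme \<Rightarrow> ('r, 'a) module \<Rightarrow> 'a set \<Rightarrow> nat \<Rightarrow> bool" where
  "subspace_dimension K A I d \<longleftrightarrow> ring.dimension A d ((\<lambda>c. c \<odot>\<^bsub>A\<^esub> \<one>\<^bsub>A\<^esub>) ` carrier K) I"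

definition same_component_dimensions ::
  "('r, 'c) ring_scheme \<Rightarrow> ('r, 'a) module \<Rightarrow> ('s, 'd) ring_scheme \<Rightarrow> ('s, 'b) module \<Rightarrow> bool" where
  "same_component_dimensions K A L B \<longleftrightarrow>
     (\<exists>f. bij_betw f (simple_components A) (simple_components B) \<and>
        (\<forall>I\<in>simple_components A. \<exists>d.
           subspace_dimension K A I d \<and> subspace_dimension L B (f I) d))"


section \<open>Groups given by presentations, and group algebras\<close>

text \<open>In a word, \<open>(x, True)\<close> stands for the generator \<open>x\<close> and \<open>(x, False)\<close> for its inverse.\<close>

type_synonym 'x word = "('x \<times> bool) list"

inductive presentation_eq :: "('x word \<times> 'x word) set \<Rightarrow> 'x word \<Rightarrow> 'x word \<Rightarrow> bool"
  for rels where
    relation: "(u, v) \<in> rels \<Longrightarrow> presentation_eq rels u v"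
  | cancel: "presentation_eq rels [(x, b), (x, \<not> b)] []"
  | append: "presentation_eq rels u u' \<Longrightarrow> presentation_eq rels v v' \<Longrightarrow>
      presentation_eq rels (u @ v) (u' @ v')"
  | refl: "presentation_eq rels u u"
  | sym: "presentation_eq rels u v \<Longrightarrow> presentation_eq rels v u"
  | trans: "presentation_eq rels u v \<Longrightarrow> presentation_eq rels v w \<Longrightarrow> presentation_eq rels u w"

definition presented_group :: "('x word \<times> 'x word) set \<Rightarrow> 'x word set monoid" where
  "presented_group rels =
     (let E = {(u, v). presentation_eq rels u v}
      in \<lparr>carrier = UNIV // E,
          monoid.mult = (\<lambda>C D. \<Union>u\<in>C. \<Union>v\<in>D. E `` {u @ v}),
          one = E `` {[]}\<rparr>)"

datatype quaternion_gen = Sigma_gen | Tau_gen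

definition generalized_quaternion :: "nat \<Rightarrow> quaternion_gen word set monoid" where
  "generalized_quaternion n =
     (let \<sigma> = (Sigma_gen, True); \<sigma>' = (Sigma_gen, False);
          \<tau> = (Tau_gen, True); \<tau>' = (Tau_gen, False)
      in presented_group
           {(replicate (2 ^ (n - 1)) \<sigma>, []),
            ([\<tau>, \<tau>], replicate (2 ^ (n - 2)) \<sigma>),
            ([\<tau>, \<sigma>, \<tau>'], [\<sigma>'])})"

definition group_algebra :: "('g, 'm) monoid_scheme \<Rightarrow> ('k::comm_ring_1, 'g \<Rightarrow>\<^sub>0 'k) module" where
  "group_algebra G =
     \<lparr>carrier = {f. Poly_Mapping.keys f \<subseteq> carrier G},
      monoid.mult = (\<lambda>f g. \<Sum>x\<in>Poly_Mapping.keys f. \<Sum>y\<in>Poly_Mapping.keys g.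
        Poly_Mapping.single (x \<otimes>\<^bsub>G\<^esub> y) (Poly_Mapping.lookup f x * Poly_Mapping.lookup g y)),
      one = Poly_Mapping.single \<one>\<^bsub>G\<^esub> 1,
      ring.zero = 0,
      add = (+),
      module.smult = (\<lambda>c. Poly_Mapping.map ((*) c))\<rparr>"

end

theory Submission
  imports Defs "HOL-Library.Function_Algebras"
begin

text \<open>
  Put \<open>M = 2\<^sup>n\<^sup>-\<^sup>2\<close> and write \<open>v = x\<^sup>-\<^sup>1\<close>, \<open>w = x + v\<close>. The relations of the quaternion group are
  deformed to \<open>(w + s) (w\<^bsup>M-1\<^esup> + u) = 0\<close>, \<open>y x = (v + z) y\<close> and \<open>y\<^sup>2 = z y + x\<^sup>M + u x\<close>, where
  \<open>z = c (w\<^bsup>M-1\<^esup> + u)\<close> and \<open>c\<close>, \<open>s = t\<^sup>M\<close>, \<open>u = t\<^bsup>M-1\<^esup>\<close> are multiples of \<open>t\<close>. In characteristic two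
  the first relation becomes \<open>w\<^sup>M = 0\<close> modulo \<open>t\<close>, which is equivalent to \<open>x\<^bsup>2M\<^esup> = 1\<close>. As
  \<open>w\<^bsup>M-1\<^esup> + u\<close> is the product of the \<open>w - t \<alpha>\<close> over the nonzero elements \<open>\<alpha>\<close> of the finite field,
  the central element \<open>w\<close> has the \<open>M\<close> distinct eigenvalues \<open>t \<alpha>\<close> and \<open>s\<close>. Over the algebraic closure each
  \<open>t \<alpha>\<close> gives a matrix block, on which \<open>z = 0\<close> and \<open>y\<close> swaps the eigenvectors of \<open>x\<close>, while \<open>z = s\<close>
  for the eigenvalue \<open>s\<close>, where \<open>x\<close> and \<open>y\<close> commute and four scalar blocks arise.

  All algebras of the theorem are realised by explicit bases \<open>x\<^sup>i y\<^sup>j\<close> inside one ring of sequences of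
  matrices, so that iterated tensor products need only be compared with spans over smaller scalars.
\<close>

section \<open>Linear embeddings into a ring\<close>

text \<open>On a scalar block the relation y x = x^-1 y would force x = x^-1 as soon as y is
  nonzero, and in characteristic two a constant value of y^2 would give y only one root. The
  correction z removes both obstacles: it vanishes where y swaps the eigenvectors of x and equals x
  + x^-1 = s on the scalar blocks, so that v + z = x there and the two roots of Y^2 = s Y + const
  differ by s. The summand u x repairs y^2 on a matrix block: if x has eigenvalues a, b with a + b =
  w, Frobenius gives a^M + b^M = w^M = u w, so x^M alone is not scalar there, while x^M + u x is. An
  algebra defined by these relations would leave its freeness to be shown. The order is therefore
  reversed: the matrices are built first over the algebraic closure, where independence of the x^i
  y^j is proved and from where all smaller coefficient rings inherit it. The relations then show
  that the k[[t]]-span is closed under multiplication and reduces to the group algebra modulo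
  t.\<close>

lemma ring_of_type_simps [simp]:
  "carrier (ring_of_type_algebra :: 'a::ring_1 ring) = UNIV"
  "monoid.mult (ring_of_type_algebra :: 'a ring) = (*)"
  "one (ring_of_type_algebra :: 'a ring) = 1"
  "ring.zero (ring_of_type_algebra :: 'a ring) = 0"
  "add (ring_of_type_algebra :: 'a ring) = (+)"
  by (simp_all add: ring_of_type_algebra_def)

text \<open>All coefficient rings act through such maps: k, k[[t]], k((t)) and its closure embed one
  after the other as scalar matrices in one ring, so that one family \<open>\<beta>\<close> can be a
  basis over each of them.\<close>

locale central_hom =
  fixes \<iota> :: "'r::comm_ring_1 \<Rightarrow> 'd::ring_1"
  assumes map_add: "\<iota> (r + s) = \<iota> r + \<iota> s"
    and map_mult: "\<iota> (r * s) = \<iota> r * \<iota> s"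
    and map_one [simp]: "\<iota> 1 = 1"
    and central: "\<iota> r * x = x * \<iota> r"
begin

lemma map_zero [simp]: "\<iota> 0 = 0"
  using map_add[of 0 0] by simp

lemma map_minus: "\<iota> (- r) = - \<iota> r"
  by (metis add_eq_0_iff map_add map_zero)

lemma map_sum: "\<iota> (sum f A) = (\<Sum>a\<in>A. \<iota> (f a))"
  by (induction A rule: infinite_finite_induct) (simp_all add: map_add)

definition lspan :: "'i set \<Rightarrow> ('i \<Rightarrow> 'd) \<Rightarrow> 'd set" where
  "lspan I \<beta> = range (\<lambda>c. \<Sum>i\<in>I. \<iota> (c i) * \<beta> i)"

lemma lspanI: "(\<Sum>i\<in>I. \<iota> (c i) * \<beta> i) \<in> lspan I \<beta>"
  by (auto simp: lspan_def)

lemma lspanE: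
  assumes "x \<in> lspan I \<beta>" obtains c where "x = (\<Sum>i\<in>I. \<iota> (c i) * \<beta> i)"
  using assms by (auto simp: lspan_def)

lemma lspan_zero: "0 \<in> lspan I \<beta>"
  using lspanI[of "\<lambda>_. 0" \<beta> I] by simp

lemma lspan_add: "x \<in> lspan I \<beta> \<Longrightarrow> y \<in> lspan I \<beta> \<Longrightarrow> x + y \<in> lspan I \<beta>"
proof (elim lspanE)
  fix c d assume "x = (\<Sum>i\<in>I. \<iota> (c i) * \<beta> i)" "y = (\<Sum>i\<in>I. \<iota> (d i) * \<beta> i)"
  then have "x + y = (\<Sum>i\<in>I. \<iota> (c i + d i) * \<beta> i)"
    by (simp add: map_add ring_distribs sum.distrib)
  then show ?thesis by (simp only: lspanI)
qed

lemma lspan_scale: "x \<in> lspan I \<beta> \<Longrightarrow> \<iota> r * x \<in> lspan I \<beta>"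
proof (elim lspanE)
  fix c assume "x = (\<Sum>i\<in>I. \<iota> (c i) * \<beta> i)"
  then have "\<iota> r * x = (\<Sum>i\<in>I. \<iota> (r * c i) * \<beta> i)"
    by (simp add: map_mult sum_distrib_left mult.assoc)
  then show ?thesis by (simp only: lspanI)
qed

lemma lspan_minus: "x \<in> lspan I \<beta> \<Longrightarrow> - x \<in> lspan I \<beta>"
  using lspan_scale[of x I \<beta> "-1"] by (simp add: map_minus)

lemma lspan_sum: "(\<And>a. a \<in> A \<Longrightarrow> f a \<in> lspan I \<beta>) \<Longrightarrow> sum f A \<in> lspan I \<beta>"
  by (induction A rule: infinite_finite_induct) (auto simp: lspan_zero lspan_add)

lemma lspan_base:
  assumes "finite I" "i \<in> I" shows "\<beta> i \<in> lspan I \<beta>"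
proof -
  have "(\<Sum>j\<in>I. \<iota> (if j = i then 1 else 0) * \<beta> j) = (\<Sum>j\<in>I. if j = i then \<beta> j else 0)"
    by (rule sum.cong) auto
  also have "\<dots> = \<beta> i" using assms by simp
  finally show ?thesis by (metis lspanI)
qed

lemma lspan_subset:
  assumes "\<And>i. i \<in> I \<Longrightarrow> \<beta> i \<in> lspan J \<gamma>" shows "lspan I \<beta> \<subseteq> lspan J \<gamma>"
  using assms by (auto elim!: lspanE intro!: lspan_sum lspan_scale)

definition indep :: "'i set \<Rightarrow> ('i \<Rightarrow> 'd) \<Rightarrow> bool" where
  "indep I \<beta> \<longleftrightarrow> (\<forall>c. (\<Sum>i\<in>I. \<iota> (c i) * \<beta> i) = 0 \<longrightarrow> (\<forall>i\<in>I. c i = 0))"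

lemma indep_eq:
  assumes "indep I \<beta>" "(\<Sum>i\<in>I. \<iota> (c i) * \<beta> i) = (\<Sum>i\<in>I. \<iota> (d i) * \<beta> i)" "i \<in> I"
  shows "c i = d i"
proof -
  have "(\<Sum>i\<in>I. \<iota> (c i - d i) * \<beta> i) = 0"
    using assms(2) map_add[of "c _" "- d _"] by (simp add: map_minus ring_distribs sum_subtractf)
  then show ?thesis using assms(1,3) unfolding indep_def by (meson eq_iff_diff_eq_0)
qed

end

text \<open>Module axioms of \<open>N\<close> are not assumed: they are pulled back along the injection \<open>\<Phi>\<close>.\<close>

locale lin_emb = central_hom \<iota>
  for \<iota> :: "'r::comm_ring_1 \<Rightarrow> 'd::ring_1" +
  fixes N :: "('r, 'n) module" and \<Phi> :: "'n \<Rightarrow> 'd" and I :: "'i set" and \<beta> :: "'i \<Rightarrow> 'd"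
  assumes finite_index: "finite I"
    and zero_mem: "\<zero>\<^bsub>N\<^esub> \<in> carrier N"
    and add_mem: "x \<in> carrier N \<Longrightarrow> y \<in> carrier N \<Longrightarrow> x \<oplus>\<^bsub>N\<^esub> y \<in> carrier N"
    and smult_mem: "x \<in> carrier N \<Longrightarrow> r \<odot>\<^bsub>N\<^esub> x \<in> carrier N"
    and emb_zero: "\<Phi> \<zero>\<^bsub>N\<^esub> = 0"
    and emb_add: "x \<in> carrier N \<Longrightarrow> y \<in> carrier N \<Longrightarrow> \<Phi> (x \<oplus>\<^bsub>N\<^esub> y) = \<Phi> x + \<Phi> y"
    and emb_smult: "x \<in> carrier N \<Longrightarrow> \<Phi> (r \<odot>\<^bsub>N\<^esub> x) = \<iota> r * \<Phi> x"
    and emb_inj: "inj_on \<Phi> (carrier N)"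
    and emb_image: "\<Phi> ` carrier N = lspan I \<beta>"
begin

lemma emb_eqI: "x \<in> carrier N \<Longrightarrow> y \<in> carrier N \<Longrightarrow> \<Phi> x = \<Phi> y \<Longrightarrow> x = y"
  using emb_inj by (auto simp: inj_on_def)

lemma emb_mem: "x \<in> carrier N \<Longrightarrow> \<Phi> x \<in> lspan I \<beta>"
  using emb_image by auto

lemma emb_surj:
  assumes "d \<in> lspan I \<beta>" obtains x where "x \<in> carrier N" "\<Phi> x = d"
  using assms emb_image by (metis imageE)

lemma abelian_group: "abelian_group N"
proof (rule abelian_groupI)
  fix x assume x: "x \<in> carrier N"
  obtain y where "y \<in> carrier N" "\<Phi> y = - \<Phi> x"
    using emb_surj[OF lspan_minus[OF emb_mem[OF x]]] .
  then show "\<exists>y\<in>carrier N. y \<oplus>\<^bsub>N\<^esub> x = \<zero>\<^bsub>N\<^esub>"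
    using x by (intro bexI[of _ y] emb_eqI) (auto simp: add_mem zero_mem emb_add emb_zero)
qed (auto intro!: emb_eqI simp: add_mem zero_mem emb_add emb_zero algebra_simps)

lemma module: "Module.module ring_of_type_algebra N"
  by (intro module.intro module_axioms.intro abelian_group)
    (auto intro!: emb_eqI simp: add_mem zero_mem smult_mem emb_add emb_zero emb_smult map_add map_mult
      algebra_simps cring_from_type_algebra)

definition base :: "'i \<Rightarrow> 'n" where
  "base i = the_inv_into (carrier N) \<Phi> (\<beta> i)"

lemma base: "i \<in> I \<Longrightarrow> base i \<in> carrier N" "i \<in> I \<Longrightarrow> \<Phi> (base i) = \<beta> i"
  using lspan_base[OF finite_index, of i \<beta>] emb_image emb_inj
  by (auto simp: base_def the_inv_into_into f_the_inv_into_f)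

text \<open>An induction rule rather than a sum formula, because \<open>tensor_pair\<close> asks for
  generators in this shape. \<open>P\<close> is proved along partial sums over growing subsets of
  \<open>I\<close>; the last one has the same image as \<open>x\<close>.\<close>

lemma span_induct [consumes 1, case_names zero add smult]:
  assumes "x \<in> carrier N"
    and zero: "P \<zero>\<^bsub>N\<^esub>"
    and add: "\<And>x y. x \<in> carrier N \<Longrightarrow> y \<in> carrier N \<Longrightarrow> P x \<Longrightarrow> P y \<Longrightarrow> P (x \<oplus>\<^bsub>N\<^esub> y)"
    and smult: "\<And>r i. i \<in> I \<Longrightarrow> P (r \<odot>\<^bsub>N\<^esub> base i)"
  shows "P x"
proof -
  have partial: "\<exists>y\<in>carrier N. \<Phi> y = (\<Sum>i\<in>T. \<iota> (c i) * \<beta> i) \<and> P y" if "T \<subseteq> I" for T c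
    using finite_subset[OF that finite_index] that
  proof (induction T)
    case empty
    show ?case using zero zero_mem emb_zero by auto
  next
    case (insert j T)
    then obtain y where "y \<in> carrier N" "\<Phi> y = (\<Sum>i\<in>T. \<iota> (c i) * \<beta> i)" "P y" by auto
    with insert show ?case
      by (intro bexI[of _ "c j \<odot>\<^bsub>N\<^esub> base j \<oplus>\<^bsub>N\<^esub> y"])
        (auto simp: add_mem smult_mem base emb_add emb_smult intro!: add smult)
  qed
  obtain c where "\<Phi> x = (\<Sum>i\<in>I. \<iota> (c i) * \<beta> i)" using emb_mem[OF assms(1)] by (elim lspanE)
  with partial[OF subset_refl, of c] show ?thesis by (metis assms(1) emb_eqI)
qed

end

locale alg_emb = lin_emb \<iota> N \<Phi> I \<beta>
  for \<iota> :: "'r::comm_ring_1 \<Rightarrow> 'd::ring_1" and N :: "('r, 'n) module" and \<Phi> I and \<beta> :: "'i \<Rightarrow> 'd" +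
  assumes one_mem: "\<one>\<^bsub>N\<^esub> \<in> carrier N"
    and mult_mem: "x \<in> carrier N \<Longrightarrow> y \<in> carrier N \<Longrightarrow> x \<otimes>\<^bsub>N\<^esub> y \<in> carrier N"
    and emb_one: "\<Phi> \<one>\<^bsub>N\<^esub> = 1"
    and emb_mult: "x \<in> carrier N \<Longrightarrow> y \<in> carrier N \<Longrightarrow> \<Phi> (x \<otimes>\<^bsub>N\<^esub> y) = \<Phi> x * \<Phi> y"
begin

lemma ring: "ring N"
  by (intro ringI abelian_group monoidI)
    (auto intro!: emb_eqI simp: one_mem mult_mem add_mem emb_one emb_mult emb_add algebra_simps)

lemma assoc_algebra: "assoc_algebra ring_of_type_algebra N"
  unfolding assoc_algebra_def
proof (intro conjI module ring ballI)
  fix r x y assume xy: "x \<in> carrier N" "y \<in> carrier N"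
  then show "(r \<odot>\<^bsub>N\<^esub> x) \<otimes>\<^bsub>N\<^esub> y = r \<odot>\<^bsub>N\<^esub> (x \<otimes>\<^bsub>N\<^esub> y)"
    by (intro emb_eqI) (simp_all add: smult_mem mult_mem emb_smult emb_mult mult.assoc)
  have "\<Phi> x * (\<iota> r * \<Phi> y) = \<iota> r * (\<Phi> x * \<Phi> y)"
    by (metis central mult.assoc)
  with xy show "x \<otimes>\<^bsub>N\<^esub> (r \<odot>\<^bsub>N\<^esub> y) = r \<odot>\<^bsub>N\<^esub> (x \<otimes>\<^bsub>N\<^esub> y)"
    by (intro emb_eqI) (simp_all add: smult_mem mult_mem emb_smult emb_mult)
qed

end

section \<open>Tensor products detected by a bilinear map\<close>

text \<open>The homomorphism on the free abelian group that extends \<open>h\<close>; for balanced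
  bilinear \<open>h\<close> it factors through the tensor product.\<close>

definition fsum :: "('x \<Rightarrow> 'z::ring_1) \<Rightarrow> ('x \<Rightarrow>\<^sub>0 int) \<Rightarrow> 'z" where
  "fsum h f = (\<Sum>x\<in>Poly_Mapping.keys f. of_int (Poly_Mapping.lookup f x) * h x)"

lemma fsum_superset:
  assumes "finite S" "Poly_Mapping.keys f \<subseteq> S"
  shows "fsum h f = (\<Sum>x\<in>S. of_int (Poly_Mapping.lookup f x) * h x)"
  unfolding fsum_def by (rule sum.mono_neutral_left) (use assms in \<open>auto simp: in_keys_iff\<close>)

lemma fsum_0 [simp]: "fsum h 0 = 0"
  by (simp add: fsum_def)

lemma fsum_of [simp]: "fsum h (frag_of x) = h x"
  by (simp add: fsum_def)

lemma fsum_diff: "fsum h (f - g) = fsum h f - fsum h g"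
proof -
  let ?S = "Poly_Mapping.keys f \<union> Poly_Mapping.keys g"
  have "Poly_Mapping.keys (f - g) \<subseteq> ?S" by (rule keys_diff)
  then show ?thesis
    by (simp add: fsum_superset[of ?S] lookup_minus left_diff_distrib sum_subtractf)
qed

lemma fsum_uminus: "fsum h (- f) = - fsum h f"
  using fsum_diff[of h 0 f] by simp

lemma fsum_add: "fsum h (f + g) = fsum h f + fsum h g"
  using fsum_diff[of h f "- g"] by (simp add: fsum_uminus)

lemma fsum_sum: "fsum h (\<Sum>a\<in>A. F a) = (\<Sum>a\<in>A. fsum h (F a))"
  by (induction A rule: infinite_finite_induct) (auto simp: fsum_add)

lemma fsum_cong: "(\<And>x. x \<in> Poly_Mapping.keys f \<Longrightarrow> h x = h' x) \<Longrightarrow> fsum h f = fsum h' f"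
  by (simp add: fsum_def)

lemma fsum_mult_left: "fsum (\<lambda>x. c * h x) f = c * fsum h f"
  unfolding fsum_def sum_distrib_left by (rule sum.cong) (auto simp: mult.assoc[symmetric] mult_of_int_commute[symmetric])

lemma fsum_mult_right: "fsum (\<lambda>x. h x * c) f = fsum h f * c"
  by (simp add: fsum_def sum_distrib_right mult.assoc)

lemma fsum_frag_extend: "fsum h (frag_extend u f) = fsum (\<lambda>x. fsum h (u x)) f"
proof -
  have "Poly_Mapping.keys f \<subseteq> UNIV" by simp
  then show ?thesis
    by (induction f rule: frag_induction) (auto simp: frag_extend_diff fsum_diff)
qed

text \<open>A criterion for computing in a tensor product by means of a balanced bilinear
  \<open>h\<close>: the \<open>b j\<close> generate \<open>N\<close>, and \<open>indep_base\<close>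
  makes them independent over \<open>M\<close> under \<open>h\<close>. Together this makes the map
  induced by \<open>h\<close> on the tensor product injective.\<close>

locale tensor_pair =
  fixes M :: "('r::comm_ring_1, 'm) module" and N :: "('r, 'n) module"
    and h :: "'m \<times> 'n \<Rightarrow> 'z::ring_1" and J :: "'j set" and b :: "'j \<Rightarrow> 'n"
  assumes module_left: "Module.module ring_of_type_algebra M"
    and module_right: "Module.module ring_of_type_algebra N"
    and finite_base: "finite J"
    and base_mem: "j \<in> J \<Longrightarrow> b j \<in> carrier N"
    and base_span: "\<And>P y. \<lbrakk>y \<in> carrier N; P \<zero>\<^bsub>N\<^esub>;
          \<And>x y. x \<in> carrier N \<Longrightarrow> y \<in> carrier N \<Longrightarrow> P x \<Longrightarrow> P y \<Longrightarrow> P (x \<oplus>\<^bsub>N\<^esub> y);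
          \<And>r j. j \<in> J \<Longrightarrow> P (r \<odot>\<^bsub>N\<^esub> b j)\<rbrakk> \<Longrightarrow> P y"
    and add_left: "x \<in> carrier M \<Longrightarrow> x' \<in> carrier M \<Longrightarrow> y \<in> carrier N \<Longrightarrow>
          h (x \<oplus>\<^bsub>M\<^esub> x', y) = h (x, y) + h (x', y)"
    and add_right: "x \<in> carrier M \<Longrightarrow> y \<in> carrier N \<Longrightarrow> y' \<in> carrier N \<Longrightarrow>
          h (x, y \<oplus>\<^bsub>N\<^esub> y') = h (x, y) + h (x, y')"
    and balanced: "x \<in> carrier M \<Longrightarrow> y \<in> carrier N \<Longrightarrow> h (r \<odot>\<^bsub>M\<^esub> x, y) = h (x, r \<odot>\<^bsub>N\<^esub> y)"
    and indep_base: "\<And>x j. \<lbrakk>\<And>j. j \<in> J \<Longrightarrow> x j \<in> carrier M; (\<Sum>j\<in>J. h (x j, b j)) = 0; j \<in> J\<rbrakk> \<Longrightarrow> x j = \<zero>\<^bsub>M\<^esub>"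
begin

interpretation M: Module.module ring_of_type_algebra M by (rule module_left)
interpretation N: Module.module ring_of_type_algebra N by (rule module_right)

abbreviation "free \<equiv> {f. Poly_Mapping.keys f \<subseteq> carrier M \<times> carrier N}"
abbreviation "ker \<equiv> tensor_kernel ring_of_type_algebra M N"
abbreviation "cls \<equiv> tensor_class ring_of_type_algebra M N"
abbreviation "tens \<equiv> tensor_ring ring_of_type_algebra M N"

section \<open>The subgroup of bilinearity relations\<close>

lemma carrier_free: "carrier (tensor_free M N) = free"
  by (auto simp: tensor_free_def)

lemma group_free: "group (tensor_free M N)"
  by (simp add: tensor_free_def)

lemma relations_free: "tensor_relations ring_of_type_algebra M N \<subseteq> free"
  by (auto simp: tensor_relations_def dest!: subsetD[OF keys_diff] split: if_splits)

lemma ker_subgroup: "subgroup ker (tensor_free M N)"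
  unfolding tensor_kernel_def
  by (rule group.generate_is_subgroup[OF group_free]) (use relations_free carrier_free in auto)

lemma ker_zero: "0 \<in> ker"
  using subgroup.one_closed[OF ker_subgroup] by (simp add: tensor_free_def)

lemma ker_add: "f \<in> ker \<Longrightarrow> g \<in> ker \<Longrightarrow> f + g \<in> ker"
  using subgroup.m_closed[OF ker_subgroup] by (simp add: tensor_free_def)

lemma ker_free: "ker \<subseteq> free"
  using subgroup.subset[OF ker_subgroup] carrier_free by auto

lemma ker_uminus: "f \<in> ker \<Longrightarrow> - f \<in> ker"
  using subgroup.m_inv_closed[OF ker_subgroup, of f] ker_free by (auto simp: tensor_free_def)

lemma ker_diff: "f \<in> ker \<Longrightarrow> g \<in> ker \<Longrightarrow> f - g \<in> ker"
  using ker_add[of f "- g"] ker_uminus by simp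

lemma ker_sum: "(\<And>a. a \<in> A \<Longrightarrow> F a \<in> ker) \<Longrightarrow> sum F A \<in> ker"
  by (induction A rule: infinite_finite_induct) (auto simp: ker_zero ker_add)

lemma ker_relation: "f \<in> tensor_relations ring_of_type_algebra M N \<Longrightarrow> f \<in> ker"
  unfolding tensor_kernel_def by (rule generate.incl)

lemma ker_left: "x \<in> carrier M \<Longrightarrow> x' \<in> carrier M \<Longrightarrow> y \<in> carrier N \<Longrightarrow>
    frag_of (x \<oplus>\<^bsub>M\<^esub> x', y) - frag_of (x, y) - frag_of (x', y) \<in> ker"
  by (rule ker_relation) (auto simp: tensor_relations_def)

lemma ker_right: "x \<in> carrier M \<Longrightarrow> y \<in> carrier N \<Longrightarrow> y' \<in> carrier N \<Longrightarrow>
    frag_of (x, y \<oplus>\<^bsub>N\<^esub> y') - frag_of (x, y) - frag_of (x, y') \<in> ker"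
  by (rule ker_relation) (auto simp: tensor_relations_def)

lemma ker_balanced: "x \<in> carrier M \<Longrightarrow> y \<in> carrier N \<Longrightarrow>
    frag_of (r \<odot>\<^bsub>M\<^esub> x, y) - frag_of (x, r \<odot>\<^bsub>N\<^esub> y) \<in> ker"
  by (rule ker_relation) (auto simp: tensor_relations_def)

lemma ker_zero_left: "y \<in> carrier N \<Longrightarrow> frag_of (\<zero>\<^bsub>M\<^esub>, y) \<in> ker"
  using ker_uminus[OF ker_left[of "\<zero>\<^bsub>M\<^esub>" "\<zero>\<^bsub>M\<^esub>" y]] by simp

lemma ker_zero_right: "x \<in> carrier M \<Longrightarrow> frag_of (x, \<zero>\<^bsub>N\<^esub>) \<in> ker"
  using ker_uminus[OF ker_right[of x "\<zero>\<^bsub>N\<^esub>" "\<zero>\<^bsub>N\<^esub>"]] by simp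

lemma fsum_ker: "f \<in> ker \<Longrightarrow> fsum h f = 0"
  unfolding tensor_kernel_def
proof (induction rule: generate.induct)
  case one
  then show ?case by (simp add: tensor_free_def)
next
  case (incl f)
  then show ?case
    by (auto simp: tensor_relations_def fsum_diff add_left add_right balanced)
next
  case (inv f)
  then have "f \<in> free" using relations_free by auto
  with inv show ?case
    by (auto simp: tensor_free_def tensor_relations_def fsum_diff fsum_uminus add_left add_right balanced)
next
  case (eng f g)
  then show ?case by (simp add: tensor_free_def fsum_add)
qed

text \<open>Bilinearity pushes second components onto the generators \<open>b j\<close> and moves
  their scalars to the left, so one summand for each \<open>j\<close> remains. Such forms are stable
  under differences, which reduces the claim to a single pair, treated by
  \<open>base_span\<close>.\<close>

lemma normal_form:
  assumes "f \<in> free"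
  shows "\<exists>x. (\<forall>j\<in>J. x j \<in> carrier M) \<and> f - (\<Sum>j\<in>J. frag_of (x j, b j)) \<in> ker"
proof -
  define nf where "nf f x \<longleftrightarrow> (\<forall>j\<in>J. x j \<in> carrier M) \<and> f - (\<Sum>j\<in>J. frag_of (x j, b j)) \<in> ker" for f x
  have nf0: "nf 0 (\<lambda>_. \<zero>\<^bsub>M\<^esub>)"
    unfolding nf_def by (auto intro!: ker_uminus ker_sum ker_zero_left base_mem)
  have add: "nf (f + g) (\<lambda>j. x j \<oplus>\<^bsub>M\<^esub> y j)" if "nf f x" "nf g y" for f g x y
  proof -
    have *: "(\<Sum>j\<in>J. frag_of (x j \<oplus>\<^bsub>M\<^esub> y j, b j) - frag_of (x j, b j) - frag_of (y j, b j)) \<in> ker"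
      using that by (intro ker_sum ker_left) (auto simp: nf_def base_mem)
    have "(f - (\<Sum>j\<in>J. frag_of (x j, b j))) + (g - (\<Sum>j\<in>J. frag_of (y j, b j)))
        - (\<Sum>j\<in>J. frag_of (x j \<oplus>\<^bsub>M\<^esub> y j, b j) - frag_of (x j, b j) - frag_of (y j, b j)) \<in> ker"
      using that by (intro ker_diff[OF ker_add *]) (auto simp: nf_def)
    then show ?thesis using that by (auto simp: nf_def sum_subtractf sum.distrib algebra_simps)
  qed
  have minus: "nf (- f) (\<lambda>j. if j \<in> J then \<ominus>\<^bsub>M\<^esub> x j else x j)" if "nf f x" for f x
  proof -
    have *: "frag_of (\<ominus>\<^bsub>M\<^esub> y, b j) + frag_of (y, b j) \<in> ker" if "y \<in> carrier M" "j \<in> J" for y j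
      using ker_diff[OF ker_zero_left ker_left[of y "\<ominus>\<^bsub>M\<^esub> y" "b j"], of "b j"] that
      by (simp add: base_mem M.r_neg add.commute)
    have "- (f - (\<Sum>j\<in>J. frag_of (x j, b j)))
        - (\<Sum>j\<in>J. frag_of (\<ominus>\<^bsub>M\<^esub> x j, b j) + frag_of (x j, b j)) \<in> ker"
      by (rule ker_diff[OF ker_uminus ker_sum]) (use that * in \<open>auto simp: nf_def\<close>)
    then show ?thesis using that by (auto simp: nf_def sum.distrib algebra_simps)
  qed
  have cong: "nf g x" if "nf f x" "f - g \<in> ker" for f g x
    using that ker_diff[of "f - (\<Sum>j\<in>J. frag_of (x j, b j))" "f - g"] by (simp add: nf_def)
  have single: "\<exists>z. nf (frag_of (x, y)) z" if x: "x \<in> carrier M" and y: "y \<in> carrier N" for x y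
    using y
  proof (rule base_span)
    show "\<exists>z. nf (frag_of (x, \<zero>\<^bsub>N\<^esub>)) z"
      using cong[OF nf0, of "frag_of (x, \<zero>\<^bsub>N\<^esub>)"] ker_uminus[OF ker_zero_right[OF x]] by auto
  next
    fix y y' assume "y \<in> carrier N" "y' \<in> carrier N"
      and "\<exists>z. nf (frag_of (x, y)) z" "\<exists>z. nf (frag_of (x, y')) z"
    then show "\<exists>z. nf (frag_of (x, y \<oplus>\<^bsub>N\<^esub> y')) z"
      using add cong ker_uminus[OF ker_right[OF x, of y y']] by (fastforce simp: algebra_simps)
  next
    fix r j assume j: "j \<in> J"
    let ?z = "\<lambda>i. if i = j then r \<odot>\<^bsub>M\<^esub> x else \<zero>\<^bsub>M\<^esub>"
    have "frag_of (r \<odot>\<^bsub>M\<^esub> x, b j) - (\<Sum>i\<in>J. frag_of (?z i, b i)) = - (\<Sum>i\<in>J - {j}. frag_of (\<zero>\<^bsub>M\<^esub>, b i))"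
      using j finite_base by (simp add: sum.remove)
    also have "\<dots> \<in> ker" by (intro ker_uminus ker_sum ker_zero_left) (auto simp: base_mem)
    finally have "nf (frag_of (r \<odot>\<^bsub>M\<^esub> x, b j)) ?z"
      using x by (auto simp: nf_def)
    then show "\<exists>z. nf (frag_of (x, r \<odot>\<^bsub>N\<^esub> b j)) z"
      using cong ker_balanced[OF x base_mem[OF j]] by blast
  qed
  have "\<exists>x. nf f x"
    using assms[simplified]
  proof (induction f rule: frag_induction)
    case zero show ?case using nf0 by auto
  next
    case (one p) then show ?case using single by (cases p) auto
  next
    case (diff f g) then show ?case using add minus by (metis diff_conv_add_uminus)
  qed
  then show ?thesis by (simp add: nf_def)
qed

text \<open>If \<open>h\<close> kills \<open>f\<close>, it also kills the normal form of
  \<open>f\<close>, whose coefficients are then zero by \<open>indep_base\<close>; summands with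
  zero on the left lie in \<open>ker\<close>.\<close>

lemma ker_eq: "ker = {f \<in> free. fsum h f = 0}"
proof (intro equalityI subsetI)
  fix f assume "f \<in> {f \<in> free. fsum h f = 0}"
  then have f: "f \<in> free" "fsum h f = 0" by auto
  obtain x where x: "\<And>j. j \<in> J \<Longrightarrow> x j \<in> carrier M" "f - (\<Sum>j\<in>J. frag_of (x j, b j)) \<in> ker"
    using normal_form[OF f(1)] by auto
  have "(\<Sum>j\<in>J. h (x j, b j)) = 0"
    using fsum_ker[OF x(2)] f(2) by (simp add: fsum_diff fsum_sum)
  then have "x j = \<zero>\<^bsub>M\<^esub>" if "j \<in> J" for j using indep_base[of x j] x(1) that by blast
  then have "(\<Sum>j\<in>J. frag_of (x j, b j)) \<in> ker"
    by (intro ker_sum) (simp add: ker_zero_left base_mem)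
  from ker_add[OF x(2) this] show "f \<in> ker" by simp
qed (use ker_free fsum_ker in auto)

text \<open>By \<open>ker_eq\<close> the cosets modulo \<open>ker\<close> are the fibres of
  \<open>fsum h\<close>, so a class can be named by its value instead of by a
  representative.\<close>

definition fibre :: "'z \<Rightarrow> ('m, 'n) tensor" where
  "fibre z = {f \<in> free. fsum h f = z}"

lemma free_add: "f \<in> free \<Longrightarrow> g \<in> free \<Longrightarrow> f + g \<in> free"
  using keys_add[of f g] by auto

lemma free_diff: "f \<in> free \<Longrightarrow> g \<in> free \<Longrightarrow> f - g \<in> free"
  using keys_diff[of f g] by auto

lemma free_sum: "(\<And>a. a \<in> A \<Longrightarrow> F a \<in> free) \<Longrightarrow> sum F A \<in> free"
  using keys_sum[of F A] by blast

lemma cls_eq: assumes "f \<in> free" shows "cls f = fibre (fsum h f)"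
proof -
  have "g \<in> cls f" if "g \<in> free" "fsum h g = fsum h f" for g
    using free_diff[OF that(1) assms] that
    by (auto simp: tensor_class_def r_coset_def ker_eq tensor_free_def fsum_diff intro!: exI[of _ "g - f"])
  moreover have "g \<in> free \<and> fsum h g = fsum h f" if "g \<in> cls f" for g
    using that free_add[OF _ assms] by (auto simp: tensor_class_def r_coset_def ker_eq tensor_free_def fsum_add)
  ultimately show ?thesis by (auto simp: fibre_def)
qed

text \<open>The choice of representative is harmless, since \<open>fsum h\<close> is constant on
  each coset.\<close>

definition val :: "('m, 'n) tensor \<Rightarrow> 'z" where
  "val C = fsum h (SOME f. f \<in> C)"

lemma val_fibre: "f \<in> free \<Longrightarrow> val (fibre (fsum h f)) = fsum h f"
  unfolding val_def by (rule someI2[of _ f]) (auto simp: fibre_def)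

section \<open>Elements of the tensor product and their values\<close>

lemma carrier_tens: "carrier tens = (\<lambda>f. fibre (fsum h f)) ` free"
  using cls_eq
  by (auto simp: tensor_ring_def FactGroup_def RCOSETS_def carrier_free tensor_class_def[symmetric])

lemma tensE:
  assumes "C \<in> carrier tens" obtains f where "f \<in> free" "C = fibre (fsum h f)" "val C = fsum h f"
  using assms val_fibre by (auto simp: carrier_tens)

lemma cls_tens: "f \<in> free \<Longrightarrow> cls f \<in> carrier tens"
  by (auto simp: carrier_tens cls_eq)

lemma val_cls: "f \<in> free \<Longrightarrow> val (cls f) = fsum h f"
  by (simp add: cls_eq val_fibre)

lemma val_inj: "inj_on val (carrier tens)"
  by (auto intro!: inj_onI elim!: tensE)

lemma tens_add: assumes "f \<in> free" "g \<in> free" shows "cls f \<oplus>\<^bsub>tens\<^esub> cls g = cls (f + g)"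
proof -
  have "\<exists>u\<in>fibre (fsum h f). \<exists>v\<in>fibre (fsum h g). w = u + v" if "w \<in> fibre (fsum h (f + g))" for w
    using that assms free_diff[of w g]
    by (intro bexI[of _ "w - g"] bexI[of _ g]) (auto simp: fibre_def fsum_add fsum_diff)
  then show ?thesis using assms free_add[of f g]
    by (auto simp: cls_eq[OF free_add[OF assms]] cls_eq tensor_ring_def FactGroup_def set_mult_def tensor_free_def)
      (auto simp: fibre_def fsum_add dest!: subsetD[OF keys_add])
qed

lemma val_add:
  assumes "C \<in> carrier tens" "D \<in> carrier tens"
  shows "C \<oplus>\<^bsub>tens\<^esub> D \<in> carrier tens" "val (C \<oplus>\<^bsub>tens\<^esub> D) = val C + val D"
proof -
  obtain f g where fg: "f \<in> free" "C = cls f" "g \<in> free" "D = cls g"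
    using assms by (auto simp: cls_eq carrier_tens)
  then show "C \<oplus>\<^bsub>tens\<^esub> D \<in> carrier tens" "val (C \<oplus>\<^bsub>tens\<^esub> D) = val C + val D"
    using tens_add[OF fg(1,3)] free_add[OF fg(1,3)] by (auto simp: val_cls cls_tens fsum_add simp del: mem_Collect_eq)
qed

lemma zero_tens: "\<zero>\<^bsub>tens\<^esub> = cls 0"
  by (simp add: tensor_ring_def FactGroup_def cls_eq fibre_def ker_eq)

lemma val_zero: "\<zero>\<^bsub>tens\<^esub> \<in> carrier tens" "val \<zero>\<^bsub>tens\<^esub> = 0"
  by (simp_all add: zero_tens val_cls cls_tens)

lemma val_image: "val ` carrier tens = {\<Sum>j\<in>J. h (x j, b j) | x. \<forall>j\<in>J. x j \<in> carrier M}"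
proof (intro equalityI subsetI)
  fix z assume "z \<in> val ` carrier tens"
  then obtain f where f: "f \<in> free" "z = fsum h f" by (auto elim!: tensE)
  with normal_form[OF f(1)] show "z \<in> {\<Sum>j\<in>J. h (x j, b j) | x. \<forall>j\<in>J. x j \<in> carrier M}"
    by (auto dest!: fsum_ker simp: fsum_diff fsum_sum)
next
  fix z assume "z \<in> {\<Sum>j\<in>J. h (x j, b j) | x. \<forall>j\<in>J. x j \<in> carrier M}"
  then obtain x where x: "\<forall>j\<in>J. x j \<in> carrier M" "z = (\<Sum>j\<in>J. h (x j, b j))" by auto
  let ?f = "\<Sum>j\<in>J. frag_of (x j, b j)"
  have "?f \<in> free" using x by (intro free_sum) (auto simp: base_mem)
  then show "z \<in> val ` carrier tens"
    using x by (intro image_eqI[of _ _ "cls ?f"]) (auto simp: val_cls fsum_sum cls_tens simp del: mem_Collect_eq)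
qed

lemma pure:
  assumes "x \<in> carrier M" "y \<in> carrier N"
  shows "pure_tensor ring_of_type_algebra M N x y \<in> carrier tens"
    "val (pure_tensor ring_of_type_algebra M N x y) = h (x, y)"
  using assms by (auto simp: pure_tensor_def intro!: cls_tens) (subst val_cls, auto)

text \<open>Products and scalar multiples in a tensor product are defined as unions over all
  representatives; such a union collapses once every representative yields the same set.\<close>

lemma union_cls:
  assumes "C \<in> carrier tens" "\<And>f. f \<in> C \<Longrightarrow> f \<in> free \<Longrightarrow> fsum h f = val C \<Longrightarrow> F f = S"
  shows "(\<Union>f\<in>C. F f) = S"
proof -
  obtain f where f: "f \<in> free" "C = fibre (fsum h f)" "val C = fsum h f" using assms(1) by (elim tensE)
  then have "F g = S" if "g \<in> C" for g
    using assms(2)[of g] that by (auto simp: fibre_def)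
  moreover have "f \<in> C" using f by (auto simp: fibre_def)
  ultimately show ?thesis by auto
qed

lemma rep:
  assumes "C \<in> carrier tens" obtains f where "f \<in> free" "C = cls f"
  using assms by (auto simp: cls_eq carrier_tens)

end

locale tensor_alg_pair = tensor_pair M N h J b
  for M :: "('r::comm_ring_1, 'm) module" and N :: "('r, 'n) module"
    and h :: "'m \<times> 'n \<Rightarrow> 'z::ring_1" and J :: "'j set" and b :: "'j \<Rightarrow> 'n" +
  assumes mult_left_mem: "x \<in> carrier M \<Longrightarrow> x' \<in> carrier M \<Longrightarrow> x \<otimes>\<^bsub>M\<^esub> x' \<in> carrier M"
    and mult_right_mem: "y \<in> carrier N \<Longrightarrow> y' \<in> carrier N \<Longrightarrow> y \<otimes>\<^bsub>N\<^esub> y' \<in> carrier N"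
    and h_mult: "x \<in> carrier M \<Longrightarrow> x' \<in> carrier M \<Longrightarrow> y \<in> carrier N \<Longrightarrow> y' \<in> carrier N \<Longrightarrow>
       h (x \<otimes>\<^bsub>M\<^esub> x', y \<otimes>\<^bsub>N\<^esub> y') = h (x, y) * h (x', y')"
begin

lemma frag_mult:
  assumes "f \<in> free" "g \<in> free"
  shows "frag_mult M N f g \<in> free" "fsum h (frag_mult M N f g) = fsum h f * fsum h g"
proof -
  show "frag_mult M N f g \<in> free"
    using assms mult_left_mem mult_right_mem
    by (auto simp: frag_mult_def dest!: subsetD[OF keys_frag_extend] split: if_splits) blast+
  have inner: "fsum (\<lambda>x. fsum h (case x of (c, d) \<Rightarrow> frag_of (a \<otimes>\<^bsub>M\<^esub> c, b \<otimes>\<^bsub>N\<^esub> d))) g = h (a, b) * fsum h g"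
    if "a \<in> carrier M" "b \<in> carrier N" for a b
    unfolding fsum_mult_left[symmetric]
    by (rule fsum_cong) (use assms that in \<open>auto simp: h_mult\<close>)
  have "fsum h (frag_mult M N f g) =
      fsum (\<lambda>x. case x of (a, b) \<Rightarrow> h (a, b) * fsum h g) f"
    unfolding frag_mult_def fsum_frag_extend
    by (rule fsum_cong) (use assms inner in \<open>auto simp: fsum_frag_extend\<close>)
  then show "fsum h (frag_mult M N f g) = fsum h f * fsum h g"
    by (simp add: fsum_mult_right)
qed

lemma tens_mult_fibre:
  assumes "C \<in> carrier tens" "D \<in> carrier tens"
  shows "C \<otimes>\<^bsub>tens\<^esub> D = fibre (val C * val D)"
proof -
  have "(\<Union>f\<in>C. \<Union>g\<in>D. cls (frag_mult M N f g)) = fibre (val C * val D)"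
    by (rule union_cls[OF assms(1)], rule union_cls[OF assms(2)]) (metis cls_eq frag_mult)
  then show ?thesis by (simp add: tensor_ring_def)
qed

lemma val_mult:
  assumes "C \<in> carrier tens" "D \<in> carrier tens"
  shows "C \<otimes>\<^bsub>tens\<^esub> D \<in> carrier tens" "val (C \<otimes>\<^bsub>tens\<^esub> D) = val C * val D"
proof -
  obtain f g where fg: "f \<in> free" "C = cls f" "g \<in> free" "D = cls g"
    using assms by (metis rep)
  then have "C \<otimes>\<^bsub>tens\<^esub> D = cls (frag_mult M N f g)"
    using tens_mult_fibre[OF assms] frag_mult[OF fg(1,3)] by (metis cls_eq val_cls)
  then show "C \<otimes>\<^bsub>tens\<^esub> D \<in> carrier tens" "val (C \<otimes>\<^bsub>tens\<^esub> D) = val C * val D"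
    using fg frag_mult[OF fg(1,3)] by (simp_all add: val_cls cls_tens del: mem_Collect_eq)
qed

end

section \<open>Base change\<close>

lemma algebra_along_simps [simp]:
  "carrier (algebra_along \<phi>) = UNIV" "monoid.mult (algebra_along \<phi>) = (*)" "one (algebra_along \<phi>) = 1"
  "ring.zero (algebra_along \<phi>) = 0" "add (algebra_along \<phi>) = (+)"
  "module.smult (algebra_along \<phi>) = (\<lambda>r x. \<phi> r * x)"
  by (simp_all add: algebra_along_def)

lemma module_algebra_along:
  fixes \<phi> :: "'r::comm_ring_1 \<Rightarrow> 's::comm_ring_1"
  assumes "\<And>r s. \<phi> (r + s) = \<phi> r + \<phi> s" "\<And>r s. \<phi> (r * s) = \<phi> r * \<phi> s" "\<phi> 1 = 1"
  shows "Module.module ring_of_type_algebra (algebra_along \<phi>)"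
proof -
  have "abelian_group (algebra_along \<phi>)"
    by (rule abelian_groupI) (auto simp: algebra_simps intro: exI[of _ "- _"])
  then show ?thesis
    by (intro module.intro module_axioms.intro cring_from_type_algebra) (auto simp: assms algebra_simps)
qed

text \<open>\<open>\<beta>\<close> spans \<open>N\<close> over the small ring and is independent
  even over the large one, so s \<otimes> x can be identified with
  \<open>\<iota> s * \<Phi> x\<close>. Base change then only replaces one span of
  \<open>\<beta>\<close> by another, and iterated base changes keep the same
  \<open>\<beta>\<close>.\<close>

locale base_change_emb = lin_emb \<iota>\<^sub>R N \<Phi> I \<beta> + S: central_hom \<iota>
  for \<iota>\<^sub>R :: "'r::comm_ring_1 \<Rightarrow> 'd::ring_1" and N :: "('r, 'n) module" and \<Phi> and I :: "'i set" and \<beta>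
    and \<iota> :: "'s::comm_ring_1 \<Rightarrow> 'd" +
  fixes \<phi> :: "'r \<Rightarrow> 's"
  assumes hom_add: "\<phi> (r + s) = \<phi> r + \<phi> s"
    and hom_mult: "\<phi> (r * s) = \<phi> r * \<phi> s"
    and hom_one: "\<phi> 1 = 1"
    and compat: "\<iota>\<^sub>R r = \<iota> (\<phi> r)"
    and indep: "S.indep I \<beta>"
begin

sublocale T: tensor_pair "algebra_along \<phi>" N "\<lambda>(s, x). \<iota> s * \<Phi> x" I base
proof (rule tensor_pair.intro)
  show "Module.module ring_of_type_algebra (algebra_along \<phi>)"
    by (rule module_algebra_along) (fact hom_add hom_mult hom_one)+
  show "Module.module ring_of_type_algebra N" by (rule module)
  show "finite I" by (rule finite_index)
  show "\<And>P y. \<lbrakk>y \<in> carrier N; P \<zero>\<^bsub>N\<^esub>;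
      \<And>x y. x \<in> carrier N \<Longrightarrow> y \<in> carrier N \<Longrightarrow> P x \<Longrightarrow> P y \<Longrightarrow> P (x \<oplus>\<^bsub>N\<^esub> y);
      \<And>r j. j \<in> I \<Longrightarrow> P (r \<odot>\<^bsub>N\<^esub> base j)\<rbrakk> \<Longrightarrow> P y"
    by (rule span_induct)
  fix c :: "'i \<Rightarrow> 's" and j
  assume c: "(\<Sum>j\<in>I. (case (c j, base j) of (s, x) \<Rightarrow> \<iota> s * \<Phi> x)) = 0" and j: "j \<in> I"
  have "(\<Sum>j\<in>I. \<iota> (c j) * \<beta> j) = 0" using c by (simp add: base)
  then show "c j = \<zero>\<^bsub>algebra_along \<phi>\<^esub>" using indep j unfolding S.indep_def by (simp del: S.map_zero)
next
  fix s x r assume "x \<in> carrier N"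
  then show "(case (r \<odot>\<^bsub>algebra_along \<phi>\<^esub> s, x) of (s, x) \<Rightarrow> \<iota> s * \<Phi> x) =
      (case (s, r \<odot>\<^bsub>N\<^esub> x) of (s, x) \<Rightarrow> \<iota> s * \<Phi> x)"
    using S.central[of "\<phi> r" "\<iota> s"] by (simp add: emb_smult compat S.map_mult mult.assoc[symmetric])
qed (auto simp: base S.map_add emb_add algebra_simps)

abbreviation ext :: "('s, ('s, 'n) tensor) module" where
  "ext \<equiv> base_change ring_of_type_algebra (algebra_along \<phi>) N"

lemma ext_simps:
  "carrier ext = carrier T.tens" "monoid.mult ext = monoid.mult T.tens" "one ext = one T.tens"
  "ring.zero ext = ring.zero T.tens" "add ext = add T.tens"
  by (simp_all add: base_change_def)

lemma ext_smult:
  assumes "C \<in> carrier ext"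
  shows "s \<odot>\<^bsub>ext\<^esub> C \<in> carrier ext" "T.val (s \<odot>\<^bsub>ext\<^esub> C) = \<iota> s * T.val C"
proof -
  let ?g = "\<lambda>f. frag_extend (\<lambda>(a, b). frag_of (s * a, b)) f"
  let ?h = "\<lambda>(s, x). \<iota> s * \<Phi> x"
  have g: "?g f \<in> T.free" "fsum ?h (?g f) = \<iota> s * fsum ?h f" if "f \<in> T.free" for f
  proof -
    show "?g f \<in> T.free"
      using that by (auto dest!: subsetD[OF keys_frag_extend] split: if_splits)
    show "fsum ?h (?g f) = \<iota> s * fsum ?h f"
      unfolding fsum_frag_extend fsum_mult_left[symmetric]
      by (rule fsum_cong) (auto simp: S.map_mult mult.assoc)
  qed
  have C: "C \<in> carrier T.tens" using assms by (simp add: ext_simps)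
  have "s \<odot>\<^bsub>ext\<^esub> C = (\<Union>f\<in>C. T.cls (?g f))" by (simp add: base_change_def)
  also have "\<dots> = T.fibre (\<iota> s * T.val C)"
    by (rule T.union_cls[OF C]) (metis T.cls_eq g)
  finally have *: "s \<odot>\<^bsub>ext\<^esub> C = T.fibre (\<iota> s * T.val C)" .
  obtain f where f: "f \<in> T.free" "C = T.fibre (fsum ?h f)" "T.val C = fsum ?h f"
    using C by (rule T.tensE)
  then have "s \<odot>\<^bsub>ext\<^esub> C = T.cls (?g f)" using * T.cls_eq g by metis
  with f g[OF f(1)] show "s \<odot>\<^bsub>ext\<^esub> C \<in> carrier ext" "T.val (s \<odot>\<^bsub>ext\<^esub> C) = \<iota> s * T.val C"
    using T.cls_tens[of "?g f"] T.val_cls[of "?g f"] by (simp_all add: ext_simps)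
qed

lemma ext_image: "T.val ` carrier ext = S.lspan I \<beta>"
proof -
  have "T.val ` carrier ext = range (\<lambda>c. \<Sum>j\<in>I. \<iota> (c j) * \<Phi> (base j))"
    unfolding ext_simps T.val_image by auto
  then show ?thesis by (simp add: S.lspan_def base cong: sum.cong)
qed

lemma ext_lin_emb: "lin_emb \<iota> ext T.val I \<beta>"
  by unfold_locales
    (simp_all add: finite_index ext_smult ext_image, simp_all add: ext_simps T.val_zero T.val_add T.val_inj)

end

locale base_change_alg_emb =
  base_change_emb \<iota>\<^sub>R N \<Phi> I \<beta> \<iota> \<phi> + alg_emb \<iota>\<^sub>R N \<Phi> I \<beta>
  for \<iota>\<^sub>R :: "'r::comm_ring_1 \<Rightarrow> 'd::ring_1" and N :: "('r, 'n) module" and \<Phi> and I :: "'i set" and \<beta>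
    and \<iota> :: "'s::comm_ring_1 \<Rightarrow> 'd" and \<phi>
begin

sublocale TA: tensor_alg_pair "algebra_along \<phi>" N "\<lambda>(s, x). \<iota> s * \<Phi> x" I base
proof
  fix s s' :: 's and x x' assume "x \<in> carrier N" "x' \<in> carrier N"
  moreover have "\<iota> s * \<iota> s' * (\<Phi> x * \<Phi> x') = \<iota> s * \<Phi> x * (\<iota> s' * \<Phi> x')"
    by (metis S.central mult.assoc)
  ultimately show "(case (s \<otimes>\<^bsub>algebra_along \<phi>\<^esub> s', x \<otimes>\<^bsub>N\<^esub> x') of (s, x) \<Rightarrow> \<iota> s * \<Phi> x) =
      (case (s, x) of (s, x) \<Rightarrow> \<iota> s * \<Phi> x) * (case (s', x') of (s, x) \<Rightarrow> \<iota> s * \<Phi> x)"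
    by (simp add: emb_mult S.map_mult)
qed (simp_all add: mult_mem)

lemma ext_alg_emb: "alg_emb \<iota> ext T.val I \<beta>"
  using T.pure[of 1 "\<one>\<^bsub>N\<^esub>"]
  by (intro alg_emb.intro ext_lin_emb alg_emb_axioms.intro)
    (simp_all add: ext_simps TA.val_mult emb_one one_mem, simp_all add: tensor_ring_def)

end

section \<open>Two by two matrices as a type\<close>

datatype 'a m2 = M2 (e11: 'a) (e12: 'a) (e21: 'a) (e22: 'a)

lemma m2_eq_iff: "x = y \<longleftrightarrow> e11 x = e11 y \<and> e12 x = e12 y \<and> e21 x = e21 y \<and> e22 x = e22 y"
  by (cases x; cases y) auto

instantiation m2 :: (ring_1) ring_1
begin

definition "0 = M2 0 0 0 0"
definition "1 = M2 1 0 0 1"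
definition "- x = M2 (- e11 x) (- e12 x) (- e21 x) (- e22 x)"
definition "x + y = M2 (e11 x + e11 y) (e12 x + e12 y) (e21 x + e21 y) (e22 x + e22 y)"
definition "x - y = M2 (e11 x - e11 y) (e12 x - e12 y) (e21 x - e21 y) (e22 x - e22 y)"
definition "x * y = M2 (e11 x * e11 y + e12 x * e21 y) (e11 x * e12 y + e12 x * e22 y)
  (e21 x * e11 y + e22 x * e21 y) (e21 x * e12 y + e22 x * e22 y)"

instance
  by standard (simp_all add: zero_m2_def one_m2_def uminus_m2_def plus_m2_def minus_m2_def times_m2_def algebra_simps)

end

lemma m2_sel [simp]:
  "e11 (0::'a::ring_1 m2) = 0" "e12 (0::'a m2) = 0" "e21 (0::'a m2) = 0" "e22 (0::'a m2) = 0"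
  "e11 (1::'a m2) = 1" "e12 (1::'a m2) = 0" "e21 (1::'a m2) = 0" "e22 (1::'a m2) = 1"
  "e11 (x + y) = e11 x + e11 y" "e12 (x + y) = e12 x + e12 y"
  "e21 (x + y) = e21 x + e21 y" "e22 (x + y) = e22 x + (e22 y :: 'a)"
  "e11 (x - y) = e11 x - e11 y" "e12 (x - y) = e12 x - e12 y"
  "e21 (x - y) = e21 x - e21 y" "e22 (x - y) = e22 x - (e22 y :: 'a)"
  "e11 (- x) = - e11 x" "e12 (- x) = - e12 x" "e21 (- x) = - e21 x" "e22 (- x) = - (e22 x :: 'a)"
  "e11 (x * y) = e11 x * e11 y + e12 x * e21 y" "e12 (x * y) = e11 x * e12 y + e12 x * e22 y"
  "e21 (x * y) = e21 x * e11 y + e22 x * e21 y" "e22 (x * y) = e21 x * e12 y + e22 x * (e22 y :: 'a)"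
  by (simp_all add: zero_m2_def one_m2_def uminus_m2_def plus_m2_def minus_m2_def times_m2_def)

lemma m2_sum [simp]:
  "e11 (sum f A) = (\<Sum>a\<in>A. e11 (f a))" "e12 (sum f A) = (\<Sum>a\<in>A. e12 (f a))"
  "e21 (sum f A) = (\<Sum>a\<in>A. e21 (f a))" "e22 (sum f A) = (\<Sum>a\<in>A. e22 (f a :: 'a::ring_1 m2))"
  by (induction A rule: infinite_finite_induct) auto

lemma sum_fun_apply [simp]: "(sum f A) x = (\<Sum>a\<in>A. f a x)"
  for f :: "'a \<Rightarrow> 'b \<Rightarrow> 'c::comm_monoid_add"
  by (induction A rule: infinite_finite_induct) auto

lemma power_fun_apply [simp]: "(f ^ n) x = f x ^ n"
  for f :: "'b \<Rightarrow> 'c::monoid_mult"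
  by (induction n) auto

text \<open>The number of blocks depends on \<open>n\<close>, a term, and cannot enter a type.
  Infinite sequences with pointwise operations avoid this; a constant tail will bound the
  dimension.\<close>

type_synonym 'k blocks = "nat \<Rightarrow> 'k m2"

definition sc :: "'k::comm_ring_1 \<Rightarrow> 'k blocks" where
  "sc c = (\<lambda>_. M2 c 0 0 c)"

lemma sc_sel [simp]: "e11 (sc c l) = c" "e12 (sc c l) = 0" "e21 (sc c l) = 0" "e22 (sc c l) = c"
  by (simp_all add: sc_def)

interpretation sc: central_hom "sc :: 'k::comm_ring_1 \<Rightarrow> 'k blocks"
  by standard (auto simp: fun_eq_iff m2_eq_iff algebra_simps)

section \<open>Separability by descent\<close>

text \<open>The Kronecker product with the transpose of \<open>b\<close>, so that it is multiplicative on
  \<open>A \<otimes> A\<^sup>o\<^sup>p\<close>.\<close>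

definition kron :: "'k::comm_ring_1 blocks \<Rightarrow> 'k blocks \<Rightarrow> nat \<Rightarrow> nat \<Rightarrow> 'k m2 m2" where
  "kron a b = (\<lambda>l l'. M2 (sc (e11 (b l')) l * a l) (sc (e21 (b l')) l * a l)
                          (sc (e12 (b l')) l * a l) (sc (e22 (b l')) l * a l))"

lemmas kron_simps = fun_eq_iff m2_eq_iff kron_def

lemma kron_mult: "kron a b * kron c d = kron (a * c) (d * b)"
  by (simp add: kron_simps algebra_simps)

lemma kron_add: "kron (a + a') b = kron a b + kron a' b" "kron a (b + b') = kron a b + kron a b'"
  by (simp_all add: kron_simps algebra_simps)

lemma kron_zero [simp]: "kron 0 b = 0" "kron a 0 = 0"
  by (simp_all add: kron_simps)

lemma kron_sum: "kron (sum f A) b = (\<Sum>x\<in>A. kron (f x) b)" "kron a (sum f A) = (\<Sum>x\<in>A. kron a (f x))"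
  by (induction A rule: infinite_finite_induct) (auto simp: kron_add)

lemma kron_sc: "kron (sc c * a) b = kron a (sc c * b)" "kron (sc c * a) b = kron (sc c) 1 * kron a b"
  by (simp_all add: kron_simps algebra_simps)

text \<open>Multiplication, a \<otimes> b to a b, in the coordinates of \<open>kron\<close>. Only
  pairs of equal blocks enter, because blocks multiply separately, and the index pattern undoes the
  transposition in \<open>kron\<close>.\<close>

definition contract :: "(nat \<Rightarrow> nat \<Rightarrow> 'k::comm_ring_1 m2 m2) \<Rightarrow> 'k blocks" where
  "contract z = (\<lambda>l. M2 (e11 (e11 (z l l)) + e12 (e12 (z l l))) (e11 (e21 (z l l)) + e12 (e22 (z l l)))
     (e21 (e11 (z l l)) + e22 (e12 (z l l))) (e21 (e21 (z l l)) + e22 (e22 (z l l))))"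

lemma contract_kron: "contract (kron a b) = a * b"
  by (simp add: kron_simps contract_def algebra_simps)

lemma contract_add: "contract (x + y) = contract x + contract y"
  by (simp add: fun_eq_iff m2_eq_iff contract_def algebra_simps)

lemma contract_sum: "contract (sum f A) = (\<Sum>x\<in>A. contract (f x))"
  by (induction A rule: infinite_finite_induct) (auto simp: contract_add, auto simp: fun_eq_iff m2_eq_iff contract_def)

text \<open>For a fixed entry in a fixed block of the first factor, the assumption is a scalar
  relation among the \<open>\<beta> j\<close>.\<close>

lemma kron_indep:
  assumes "sc.indep J \<beta>" "(\<Sum>j\<in>J. kron (x j) (\<beta> j)) = 0" "j \<in> J"
  shows "x j = 0"
proof -
  have *: "(\<Sum>j\<in>J. sc (e11 (x j l)) * \<beta> j) = 0" "(\<Sum>j\<in>J. sc (e12 (x j l)) * \<beta> j) = 0"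
    "(\<Sum>j\<in>J. sc (e21 (x j l)) * \<beta> j) = 0" "(\<Sum>j\<in>J. sc (e22 (x j l)) * \<beta> j) = 0" for l
    using assms(2) by (simp_all add: kron_simps algebra_simps)
  show ?thesis
    using *[THEN assms(1)[unfolded sc.indep_def, rule_format, OF _ assms(3)]]
    by (simp add: fun_eq_iff m2_eq_iff)
qed

text \<open>Through \<open>\<tau>\<close> the large field is a vector space over the small one in
  which 1 is nonzero, so some linear functional has value 1 there. It need not be multiplicative:
  only conditions linear over the small field are pushed through it.\<close>

lemma linear_retraction:
  fixes \<tau> :: "'f::field \<Rightarrow> 'k::field"
  assumes \<tau>: "\<And>a b. \<tau> (a + b) = \<tau> a + \<tau> b" "\<And>a b. \<tau> (a * b) = \<tau> a * \<tau> b" "\<tau> 1 = 1"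
  obtains \<rho> :: "'k \<Rightarrow> 'f" where "\<And>x y. \<rho> (x + y) = \<rho> x + \<rho> y" "\<And>c x. \<rho> (x * \<tau> c) = \<rho> x * c" "\<rho> 1 = 1"
proof -
  interpret V: vector_space_pair "\<lambda>c x. \<tau> c * x" "(*) :: 'f \<Rightarrow> 'f \<Rightarrow> 'f"
    by unfold_locales (simp_all add: \<tau> algebra_simps)
  have "V.vs1.independent {1}" by (simp add: V.vs1.dependent_single)
  then obtain \<rho> where \<rho>: "Vector_Spaces.linear (\<lambda>c x. \<tau> c * x) (*) \<rho>" "\<rho> 1 = (1::'f)"
    using V.linear_independent_extend[of "{1}" "\<lambda>_. 1"] by auto
  interpret \<rho>: Vector_Spaces.linear "\<lambda>c x. \<tau> c * x" "(*)" \<rho> by (fact \<rho>(1))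
  show ?thesis
    by (rule that[of \<rho>]) (use \<rho>(2) \<rho>.add \<rho>.scale in \<open>auto simp: mult.commute\<close>)
qed

text \<open>\<open>A\<close> is a form, over the small field, of the algebra spanned by
  \<open>\<beta>\<close> over the large one; \<open>K_indep\<close> keeps \<open>\<beta>\<close> a
  basis after the extension.\<close>

locale split_emb = alg_emb "\<lambda>c. sc (\<tau> c)" A \<Theta> I \<beta>
  for \<tau> :: "'f::field \<Rightarrow> 'k::field" and A :: "('f, 'a) module" and \<Theta> and I :: "'i set" and \<beta> +
  assumes hom_add: "\<tau> (a + b) = \<tau> a + \<tau> b" and hom_mult: "\<tau> (a * b) = \<tau> a * \<tau> b" and hom_one: "\<tau> 1 = 1"
    and K_indep: "sc.indep I \<beta>"
begin

text \<open>The tensor with coordinate matrix \<open>C\<close> with respect to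
  \<open>\<beta>\<close>. In terms of \<open>C\<close> the conditions on a separability element form
  a linear system.\<close>

definition bil :: "('i \<Rightarrow> 'i \<Rightarrow> 'k) \<Rightarrow> nat \<Rightarrow> nat \<Rightarrow> 'k m2 m2" where
  "bil C = (\<Sum>g\<in>I. \<Sum>h\<in>I. kron (sc (C g h) * \<beta> g) (\<beta> h))"

lemma bil_cong: "(\<And>g h. g \<in> I \<Longrightarrow> h \<in> I \<Longrightarrow> C g h = C' g h) \<Longrightarrow> bil C = bil C'"
  by (simp add: bil_def)

lemma bil_swap: "bil C = (\<Sum>h\<in>I. kron (\<Sum>g\<in>I. sc (C g h) * \<beta> g) (\<beta> h))"
  unfolding bil_def kron_sum by (rule sum.swap)

lemma bil_inj:
  assumes "bil C = bil C'" "g \<in> I" "h \<in> I" shows "C g h = C' g h"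
proof -
  have "(\<Sum>h\<in>I. kron (\<Sum>g\<in>I. sc (C g h - C' g h) * \<beta> g) (\<beta> h)) + bil C' = bil C"
    unfolding bil_swap sum.distrib[symmetric] kron_add[symmetric]
    by (simp flip: distrib_right sc.map_add)
  then have "(\<Sum>h\<in>I. kron (\<Sum>g\<in>I. sc (C g h - C' g h) * \<beta> g) (\<beta> h)) = 0" using assms(1) by simp
  from kron_indep[OF K_indep this assms(3)] show ?thesis
    using K_indep assms(2) unfolding sc.indep_def by auto
qed

lemma bil_left:
  assumes "\<And>g. g \<in> I \<Longrightarrow> a * \<beta> g = (\<Sum>g'\<in>I. sc (m g g') * \<beta> g')"
  shows "kron a 1 * bil C = bil (\<lambda>g' h. \<Sum>g\<in>I. C g h * m g g')"
proof -
  have *: "a * (sc c * \<beta> g) = (\<Sum>g'\<in>I. sc (c * m g g') * \<beta> g')" if "g \<in> I" for c g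
  proof -
    have "a * (sc c * \<beta> g) = sc c * (a * \<beta> g)" by (metis mult.assoc sc.central)
    then show ?thesis by (simp add: assms[OF that] sum_distrib_left sc.map_mult mult.assoc)
  qed
  have "kron a 1 * bil C = (\<Sum>h\<in>I. kron (\<Sum>g\<in>I. \<Sum>g'\<in>I. sc (C g h * m g g') * \<beta> g') (\<beta> h))"
    by (simp add: bil_swap sum_distrib_left kron_mult * cong: sum.cong)
  also have "\<dots> = bil (\<lambda>g' h. \<Sum>g\<in>I. C g h * m g g')"
    unfolding bil_swap sc.map_sum sum_distrib_right
    by (intro sum.cong HOL.refl arg_cong2[where f=kron] sum.swap)
  finally show ?thesis .
qed

lemma bil_right:
  assumes "\<And>h. h \<in> I \<Longrightarrow> \<beta> h * a = (\<Sum>h'\<in>I. sc (n h h') * \<beta> h')"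
  shows "kron 1 a * bil C = bil (\<lambda>g h'. \<Sum>h\<in>I. C g h * n h h')"
proof -
  have *: "kron (sc c * x) (sc d * y) = kron (sc (c * d) * x) y" for c d and x y :: "'k blocks"
    by (metis kron_sc(1) mult.assoc mult.commute sc.map_mult)
  have "kron 1 a * bil C = (\<Sum>g\<in>I. \<Sum>h\<in>I. \<Sum>h'\<in>I. kron (sc (C g h * n h h') * \<beta> g) (\<beta> h'))"
    using assms by (simp add: bil_def sum_distrib_left kron_mult kron_sum *)
  also have "\<dots> = bil (\<lambda>g h'. \<Sum>h\<in>I. C g h * n h h')"
    unfolding bil_def sc.map_sum sum_distrib_right kron_sum
    by (intro sum.cong HOL.refl sum.swap)
  finally show ?thesis .
qed

lemma contract_bil:
  assumes "\<And>g h. g \<in> I \<Longrightarrow> h \<in> I \<Longrightarrow> \<beta> g * \<beta> h = (\<Sum>k\<in>I. sc (m g h k) * \<beta> k)"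
  shows "contract (bil C) = (\<Sum>k\<in>I. sc (\<Sum>g\<in>I. \<Sum>h\<in>I. C g h * m g h k) * \<beta> k)"
proof -
  have "contract (bil C) = (\<Sum>g\<in>I. \<Sum>h\<in>I. \<Sum>k\<in>I. sc (C g h * m g h k) * \<beta> k)"
    using assms by (simp add: bil_def contract_sum contract_kron mult.assoc sum_distrib_left sc.map_mult)
  also have "\<dots> = (\<Sum>k\<in>I. \<Sum>g\<in>I. \<Sum>h\<in>I. sc (C g h * m g h k) * \<beta> k)"
  proof -
    have "(\<Sum>g\<in>I. \<Sum>h\<in>I. \<Sum>k\<in>I. F g h k) = (\<Sum>k\<in>I. \<Sum>g\<in>I. \<Sum>h\<in>I. F g h k)" for F :: "_ \<Rightarrow> _ \<Rightarrow> _ \<Rightarrow> 'k blocks"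
      by (subst sum.swap[of "\<lambda>k g. \<Sum>h\<in>I. F g h k"]) (intro sum.cong HOL.refl sum.swap)
    then show ?thesis .
  qed
  finally show ?thesis by (simp add: sc.map_sum sum_distrib_right)
qed

text \<open>A \<open>k((t))\<close>-linear retraction of the big field onto the small one carries a separability
  element over the big field to one over the small field, because the conditions on its coordinates
  are linear with coefficients in the small field.\<close>

lemma separability_element_descent:
  assumes e: "bil C = e" "contract e = 1" "\<And>a. a \<in> sc.lspan I \<beta> \<Longrightarrow> kron a 1 * e = kron 1 a * e"
  obtains c :: "'i \<Rightarrow> 'i \<Rightarrow> 'f"
  where "contract (bil (\<lambda>g h. \<tau> (c g h))) = 1"
    "\<And>a. a \<in> lspan I \<beta> \<Longrightarrow> kron a 1 * bil (\<lambda>g h. \<tau> (c g h)) = kron 1 a * bil (\<lambda>g h. \<tau> (c g h))"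
proof -
  obtain \<rho> where \<rho>: "\<And>x y. \<rho> (x + y) = \<rho> x + \<rho> y" "\<And>c x. \<rho> (x * \<tau> c) = \<rho> x * c" "\<rho> 1 = 1"
    using linear_retraction[of \<tau>] hom_add hom_mult hom_one by blast
  have \<tau>0: "\<tau> 0 = 0" by (metis add_cancel_right_left hom_add add_0)
  have \<rho>0: "\<rho> 0 = 0" by (metis add_cancel_right_left \<rho>(1) add_0)
  have \<rho>_sum: "\<rho> (sum f S) = (\<Sum>x\<in>S. \<rho> (f x))" for f :: "'i \<Rightarrow> 'k" and S
    by (induction S rule: infinite_finite_induct) (auto simp: \<rho> \<rho>0)
  have \<tau>_sum: "\<tau> (sum f S) = (\<Sum>x\<in>S. \<tau> (f x))" for f :: "'i \<Rightarrow> 'f" and S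
    by (induction S rule: infinite_finite_induct) (auto simp: hom_add \<tau>0)
  have \<rho>\<tau>: "\<rho> (\<tau> x) = x" for x using \<rho>(2)[of 1 x] \<rho>(3) by simp
  define c where "c g h = \<rho> (C g h)" for g h
  have closed: "x * y \<in> lspan I \<beta>" if "x \<in> lspan I \<beta>" "y \<in> lspan I \<beta>" for x y
    using that by (metis emb_surj emb_mult emb_mem mult_mem)
  have coords: "\<exists>m. \<forall>g\<in>I. F g = (\<Sum>k\<in>I. sc (\<tau> (m g k)) * \<beta> k)" if "\<And>g. g \<in> I \<Longrightarrow> F g \<in> lspan I \<beta>" for F
  proof (rule bchoice, intro ballI)
    fix g assume "g \<in> I"
    then show "\<exists>m. F g = (\<Sum>k\<in>I. sc (\<tau> (m k)) * \<beta> k)"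
      using that lspanE by metis
  qed
  show thesis
  proof
    have "\<exists>m. \<forall>g\<in>I. \<forall>h\<in>I. \<beta> g * \<beta> h = (\<Sum>k\<in>I. sc (\<tau> (m g h k)) * \<beta> k)"
      by (rule bchoice, intro ballI coords closed lspan_base[OF finite_index])
    then obtain m where m: "\<And>g h. g \<in> I \<Longrightarrow> h \<in> I \<Longrightarrow> \<beta> g * \<beta> h = (\<Sum>k\<in>I. sc (\<tau> (m g h k)) * \<beta> k)"
      by auto
    have "1 \<in> lspan I \<beta>" using emb_mem[OF one_mem] by (simp add: emb_one)
    then obtain u where u: "1 = (\<Sum>k\<in>I. sc (\<tau> (u k)) * \<beta> k)" by (elim lspanE)
    have "(\<Sum>k\<in>I. sc (\<Sum>g\<in>I. \<Sum>h\<in>I. C g h * \<tau> (m g h k)) * \<beta> k) = (\<Sum>k\<in>I. sc (\<tau> (u k)) * \<beta> k)"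
      by (simp only: contract_bil[OF m, of C, symmetric] e(1,2) u[symmetric])
    then have Cm: "(\<Sum>g\<in>I. \<Sum>h\<in>I. C g h * \<tau> (m g h k)) = \<tau> (u k)" if "k \<in> I" for k
      using that by (rule sc.indep_eq[OF K_indep])
    have \<rho>C: "\<rho> (\<Sum>g\<in>I. \<Sum>h\<in>I. C g h * \<tau> (m g h k)) = (\<Sum>g\<in>I. \<Sum>h\<in>I. c g h * m g h k)" for k
      by (simp add: \<rho>_sum \<rho>(2) c_def)
    have "u k = (\<Sum>g\<in>I. \<Sum>h\<in>I. c g h * m g h k)" if "k \<in> I" for k
      using arg_cong[OF Cm[OF that], of \<rho>] by (simp only: \<rho>C \<rho>\<tau>)
    then have cm: "(\<Sum>g\<in>I. \<Sum>h\<in>I. \<tau> (c g h) * \<tau> (m g h k)) = \<tau> (u k)" if "k \<in> I" for k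
      using that by (simp add: hom_mult \<tau>_sum)
    have "contract (bil (\<lambda>g h. \<tau> (c g h))) =
        (\<Sum>k\<in>I. sc (\<Sum>g\<in>I. \<Sum>h\<in>I. \<tau> (c g h) * \<tau> (m g h k)) * \<beta> k)"
      by (rule contract_bil[OF m])
    also have "\<dots> = (\<Sum>k\<in>I. sc (\<tau> (u k)) * \<beta> k)" using cm by simp
    also have "\<dots> = 1" by (rule u[symmetric])
    finally show "contract (bil (\<lambda>g h. \<tau> (c g h))) = 1" .
    fix a assume a: "a \<in> lspan I \<beta>"
    obtain m where m: "\<And>g. g \<in> I \<Longrightarrow> a * \<beta> g = (\<Sum>g'\<in>I. sc (\<tau> (m g g')) * \<beta> g')"
      using coords[of "\<lambda>g. a * \<beta> g"] closed[OF a] lspan_base[OF finite_index] by auto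
    obtain n where n: "\<And>g. g \<in> I \<Longrightarrow> \<beta> g * a = (\<Sum>g'\<in>I. sc (\<tau> (n g g')) * \<beta> g')"
      using coords[of "\<lambda>g. \<beta> g * a"] closed[OF _ a] lspan_base[OF finite_index] by auto
    have "a \<in> sc.lspan I \<beta>" using a by (auto simp: lspan_def sc.lspan_def)
    then have "bil (\<lambda>g' h. \<Sum>g\<in>I. C g h * \<tau> (m g g')) = bil (\<lambda>g h'. \<Sum>h\<in>I. C g h * \<tau> (n h h'))"
      using e(3)[of a] by (simp only: bil_left[OF m, symmetric] bil_right[OF n, symmetric] e(1))
    from arg_cong[OF bil_inj[OF this], of _ _ \<rho>]
    have "(\<Sum>g\<in>I. c g h * m g g') = (\<Sum>h'\<in>I. c g' h' * n h' h)" if "g' \<in> I" "h \<in> I" for g' h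
      using that by (simp add: \<rho>_sum \<rho>(2) c_def)
    from arg_cong[OF this, of _ _ \<tau>]
    have "(\<Sum>g\<in>I. \<tau> (c g h) * \<tau> (m g g')) = (\<Sum>h'\<in>I. \<tau> (c g' h') * \<tau> (n h' h))"
      if "g' \<in> I" "h \<in> I" for g' h
      using that by (simp add: hom_mult \<tau>_sum)
    then have "bil (\<lambda>g' h. \<Sum>g\<in>I. \<tau> (c g h) * \<tau> (m g g')) = bil (\<lambda>g' h. \<Sum>h'\<in>I. \<tau> (c g' h') * \<tau> (n h' h))"
      by (rule bil_cong)
    then show "kron a 1 * bil (\<lambda>g h. \<tau> (c g h)) = kron 1 a * bil (\<lambda>g h. \<tau> (c g h))"
      by (simp only: bil_left[OF m, of "\<lambda>g h. \<tau> (c g h)"] bil_right[OF n, of "\<lambda>g h. \<tau> (c g h)"])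
  qed
qed

lemma opposite_simps [simp]:
  "carrier (opposite_algebra A) = carrier A" "monoid.mult (opposite_algebra A) = (\<lambda>x y. y \<otimes>\<^bsub>A\<^esub> x)"
  "one (opposite_algebra A) = one A" "ring.zero (opposite_algebra A) = ring.zero A"
  "add (opposite_algebra A) = add A" "module.smult (opposite_algebra A) = module.smult A"
  by (simp_all add: opposite_algebra_def)

interpretation O: lin_emb "\<lambda>c. sc (\<tau> c)" "opposite_algebra A" \<Theta> I \<beta>
  by unfold_locales
    (simp_all add: finite_index zero_mem add_mem smult_mem emb_zero emb_add emb_smult emb_inj emb_image)

interpretation T: tensor_alg_pair A "opposite_algebra A" "\<lambda>(x, y). kron (\<Theta> x) (\<Theta> y)" I O.base
proof (intro tensor_alg_pair.intro tensor_pair.intro tensor_alg_pair_axioms.intro)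
  show "Module.module ring_of_type_algebra A" by (rule module)
  show "Module.module ring_of_type_algebra (opposite_algebra A)" by (rule O.module)
  show "\<And>P y. \<lbrakk>y \<in> carrier (opposite_algebra A); P \<zero>\<^bsub>opposite_algebra A\<^esub>;
      \<And>x y. x \<in> carrier (opposite_algebra A) \<Longrightarrow> y \<in> carrier (opposite_algebra A) \<Longrightarrow> P x \<Longrightarrow> P y \<Longrightarrow>
        P (x \<oplus>\<^bsub>opposite_algebra A\<^esub> y);
      \<And>r j. j \<in> I \<Longrightarrow> P (r \<odot>\<^bsub>opposite_algebra A\<^esub> O.base j)\<rbrakk> \<Longrightarrow> P y"
    by (rule O.span_induct)
  fix x j assume x: "\<And>j. j \<in> I \<Longrightarrow> x j \<in> carrier A"
    and sum: "(\<Sum>j\<in>I. case (x j, O.base j) of (x, y) \<Rightarrow> kron (\<Theta> x) (\<Theta> y)) = 0" and j: "j \<in> I"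
  have "(\<Sum>j\<in>I. kron (\<Theta> (x j)) (\<beta> j)) = 0" using sum by (simp add: O.base cong: sum.cong)
  from kron_indep[OF K_indep this j] show "x j = \<zero>\<^bsub>A\<^esub>"
    using x[OF j] by (intro emb_eqI) (simp_all add: zero_mem emb_zero)
next
  fix x x' y y' assume "x \<in> carrier A" "x' \<in> carrier A" "y \<in> carrier (opposite_algebra A)"
    "y' \<in> carrier (opposite_algebra A)"
  then show "(case (x \<otimes>\<^bsub>A\<^esub> x', y \<otimes>\<^bsub>opposite_algebra A\<^esub> y') of (x, y) \<Rightarrow> kron (\<Theta> x) (\<Theta> y)) =
      (case (x, y) of (x, y) \<Rightarrow> kron (\<Theta> x) (\<Theta> y)) * (case (x', y') of (x, y) \<Rightarrow> kron (\<Theta> x) (\<Theta> y))"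
    by (simp add: emb_mult kron_mult)
qed (use O.base in \<open>auto simp: finite_index emb_add emb_smult kron_add kron_sc(1) mult_mem\<close>)

text \<open>The element z obtained by descent satisfies a z = z a for the outer bimodule structure
  and multiplies out to 1. Hence x to z x is a section of multiplication, and moving
  \<open>a\<close> across z makes it a bimodule map.\<close>

lemma separable:
  assumes e: "bil C = e" "contract e = 1" "\<And>a. a \<in> sc.lspan I \<beta> \<Longrightarrow> kron a 1 * e = kron 1 a * e"
  shows "separable_algebra ring_of_type_algebra A"
proof -
  obtain c where c: "contract (bil (\<lambda>g h. \<tau> (c g h))) = 1"
    "\<And>a. a \<in> lspan I \<beta> \<Longrightarrow> kron a 1 * bil (\<lambda>g h. \<tau> (c g h)) = kron 1 a * bil (\<lambda>g h. \<tau> (c g h))"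
    using separability_element_descent[OF e] by blast
  define z where "z = bil (\<lambda>g h. \<tau> (c g h))"
  define \<mu> where "\<mu> C = the_inv_into (carrier A) \<Theta> (contract (T.val C))" for C
  \<comment> \<open>A representative of z x: since the second factor is the opposite algebra,
    multiplication by 1 \<otimes> x puts \<open>x\<close> to the right of
    \<open>base h\<close>.\<close>
  define f where "f x = (\<Sum>g\<in>I. \<Sum>h\<in>I. frag_of (c g h \<odot>\<^bsub>A\<^esub> base g, base h \<otimes>\<^bsub>A\<^esub> x))" for x
  define s where "s x = T.cls (f x)" for x
  have f: "f x \<in> T.free" if "x \<in> carrier A" for x
    unfolding f_def by (intro T.free_sum) (use that in \<open>auto simp: smult_mem mult_mem base\<close>)
  have "fsum (\<lambda>(x, y). kron (\<Theta> x) (\<Theta> y)) (f x) = kron 1 (\<Theta> x) * z" if "x \<in> carrier A" for x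
    using that by (simp add: f_def z_def bil_def fsum_sum sum_distrib_left kron_mult emb_smult emb_mult base)
  then have s: "s x \<in> carrier T.tens" "T.val (s x) = kron 1 (\<Theta> x) * z" if "x \<in> carrier A" for x
    using that f[OF that] by (simp_all add: s_def T.cls_tens T.val_cls del: mem_Collect_eq)
  have contract_mem: "contract (T.val C) \<in> \<Theta> ` carrier A" if C: "C \<in> carrier T.tens" for C
  proof -
    have "T.val C \<in> T.val ` carrier T.tens" using C by simp
    then obtain x where x: "\<forall>j\<in>I. x j \<in> carrier A" "T.val C = (\<Sum>j\<in>I. kron (\<Theta> (x j)) (\<beta> j))"
      unfolding T.val_image by (auto simp: O.base cong: sum.cong)
    have "\<Theta> (x j) * \<beta> j = \<Theta> (x j \<otimes>\<^bsub>A\<^esub> base j)" if "j \<in> I" for j using x that by (simp add: emb_mult base)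
    then have "\<Theta> (x j) * \<beta> j \<in> lspan I \<beta>" if "j \<in> I" for j
      using x(1) that base emb_mem mult_mem by metis
    then show ?thesis
      unfolding emb_image x(2) by (auto simp: contract_sum contract_kron intro: lspan_sum)
  qed
  have \<mu>: "\<mu> C \<in> carrier A" "\<Theta> (\<mu> C) = contract (T.val C)" if "C \<in> carrier T.tens" for C
    using contract_mem[OF that] emb_inj by (simp_all add: \<mu>_def the_inv_into_into f_the_inv_into_f)
  have "\<mu> \<in> hom (add_monoid T.tens) (add_monoid A)"
    by (rule homI) (auto simp: \<mu> T.val_add add_mem emb_add contract_add intro!: emb_eqI)
  moreover have "s \<in> hom (add_monoid A) (add_monoid T.tens)"
  proof (rule homI)
    fix x y assume "x \<in> carrier (add_monoid A)" "y \<in> carrier (add_monoid A)"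
    then show "s (x \<otimes>\<^bsub>add_monoid A\<^esub> y) = s x \<otimes>\<^bsub>add_monoid T.tens\<^esub> s y"
      by (intro inj_onD[OF T.val_inj]) (simp_all add: s T.val_add add_mem emb_add kron_add distrib_right)
  qed (simp add: s)
  moreover have "\<mu> (pure_tensor ring_of_type_algebra A (opposite_algebra A) a b) = a \<otimes>\<^bsub>A\<^esub> b"
    if "a \<in> carrier A" "b \<in> carrier A" for a b
    using that by (intro emb_eqI) (simp_all add: \<mu> T.pure mult_mem emb_mult contract_kron)
  moreover have "s (a \<otimes>\<^bsub>A\<^esub> x \<otimes>\<^bsub>A\<^esub> b) =
      pure_tensor ring_of_type_algebra A (opposite_algebra A) a b \<otimes>\<^bsub>T.tens\<^esub> s x"
    if "a \<in> carrier A" "b \<in> carrier A" "x \<in> carrier A" for a b x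
  proof (rule inj_onD[OF T.val_inj])
    have "kron 1 (\<Theta> a * \<Theta> x * \<Theta> b) * z = kron 1 (\<Theta> x * \<Theta> b) * (kron 1 (\<Theta> a) * z)"
      by (simp add: kron_mult mult.assoc flip: mult.assoc[of "kron _ _"])
    also have "\<dots> = kron 1 (\<Theta> x * \<Theta> b) * (kron (\<Theta> a) 1 * z)"
      using c(2) emb_mem[OF that(1)] by (simp add: z_def)
    also have "\<dots> = kron (\<Theta> a) (\<Theta> b) * (kron 1 (\<Theta> x) * z)"
      by (simp add: kron_mult flip: mult.assoc[of "kron _ _"])
    finally show "T.val (s (a \<otimes>\<^bsub>A\<^esub> x \<otimes>\<^bsub>A\<^esub> b)) =
        T.val (pure_tensor ring_of_type_algebra A (opposite_algebra A) a b \<otimes>\<^bsub>T.tens\<^esub> s x)"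
      using that by (simp add: s T.val_mult T.pure mult_mem emb_mult)
  qed (use that in \<open>simp_all add: s T.val_mult T.pure mult_mem\<close>)
  moreover have "\<mu> (s x) = x" if "x \<in> carrier A" for x
  proof -
    have "contract (kron 1 (\<Theta> x) * z) = contract z * \<Theta> x"
      by (simp add: z_def bil_def sum_distrib_left sum_distrib_right kron_mult contract_sum contract_kron mult.assoc)
    then show ?thesis using that c(1) by (intro emb_eqI) (simp_all add: \<mu> s z_def)
  qed
  ultimately show ?thesis
    unfolding separable_algebra_def Let_def
    by (intro conjI assoc_algebra bexI[of _ \<mu>] bexI[of _ s] ballI) auto
qed

end

section \<open>Block algebras\<close>

text \<open>Blocks \<open>0, \<dots>, M - 2\<close> are arbitrary two by two matrices and blocks \<open>M - 1, \<dots>, M + 2\<close> are scalar;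
  every later block repeats block \<open>M + 2\<close>.\<close>

definition block_algebra :: "nat \<Rightarrow> 'k::field blocks set" where
  "block_algebra M = {d. (\<forall>l\<ge>M - 1. e12 (d l) = 0 \<and> e21 (d l) = 0 \<and> e22 (d l) = e11 (d l)) \<and>
     (\<forall>l\<ge>M + 2. d l = d (M + 2))}"

lemma block_algebraI:
  assumes "\<And>l. M - 1 \<le> l \<Longrightarrow> e12 (d l) = 0" "\<And>l. M - 1 \<le> l \<Longrightarrow> e21 (d l) = 0"
    "\<And>l. M - 1 \<le> l \<Longrightarrow> e22 (d l) = e11 (d l)" "\<And>l. M + 2 \<le> l \<Longrightarrow> d l = d (M + 2)"
  shows "d \<in> block_algebra M"
  using assms unfolding block_algebra_def by blast

lemma block_algebraD:
  assumes "d \<in> block_algebra M" "M - 1 \<le> l"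
  shows "e12 (d l) = 0" "e21 (d l) = 0" "e22 (d l) = e11 (d l)"
  using assms unfolding block_algebra_def by blast+

lemma block_algebra_tail: "d \<in> block_algebra M \<Longrightarrow> M + 2 \<le> l \<Longrightarrow> d l = d (M + 2)"
  unfolding block_algebra_def by blast

lemma block_algebra_min: "d \<in> block_algebra M \<Longrightarrow> d (min l (M + 2)) = d l"
  using block_algebra_tail[of d M l] by (cases "l \<le> M + 2") (auto simp: min_def)

lemma block_algebra_add:
  assumes "x \<in> block_algebra M" "y \<in> block_algebra M"
  shows "x + y \<in> block_algebra M"
proof (rule block_algebraI)
  fix l assume "M + 2 \<le> l"
  from block_algebra_tail[OF assms(1) this] block_algebra_tail[OF assms(2) this]
  show "(x + y) l = (x + y) (M + 2)" by (simp only: plus_fun_apply)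
qed (use assms in \<open>simp_all add: block_algebraD\<close>)

lemma block_algebra_mult:
  assumes "x \<in> block_algebra M" "y \<in> block_algebra M"
  shows "x * y \<in> block_algebra M"
proof (rule block_algebraI)
  fix l assume "M + 2 \<le> l"
  from block_algebra_tail[OF assms(1) this] block_algebra_tail[OF assms(2) this]
  show "(x * y) l = (x * y) (M + 2)" by (simp only: times_fun_apply)
qed (use assms in \<open>simp_all add: block_algebraD\<close>)

text \<open>The degree bound is expressed by vanishing coefficients, which also covers the empty
  set, where the polynomial must be zero.\<close>

lemma interpolation:
  fixes g :: "'k::field \<Rightarrow> 'k"
  assumes "finite S"
  shows "\<exists>p. (\<forall>x\<in>S. poly p x = g x) \<and> (\<forall>i\<ge>card S. coeff p i = 0)"
  using assms
proof (induction S)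
  case empty
  show ?case by (rule exI[of _ 0]) simp
next
  case (insert x S)
  then obtain p where p: "\<forall>y\<in>S. poly p y = g y" "\<forall>i\<ge>card S. coeff p i = 0" by auto
  define q where "q = (\<Prod>s\<in>S. [:- s, 1:])"
  have q: "poly q y = (\<Prod>s\<in>S. y - s)" for y by (simp add: q_def poly_prod)
  have "degree q = card S" unfolding q_def by (subst degree_prod_eq_sum_degree) auto
  then have deg: "coeff q i = 0" if "i > card S" for i using that by (simp add: coeff_eq_0)
  have "poly q x \<noteq> 0" using insert by (simp add: q prod_zero_iff)
  moreover have "poly q y = 0" if "y \<in> S" for y using that insert by (auto simp: q prod_zero_iff)
  ultimately show ?case
    using p insert deg
    by (intro exI[of _ "p + smult ((g x - poly p x) / poly q x) q"]) auto
qed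

text \<open>For l < M - 1, \<open>a l\<close> and \<open>b l\<close> are the eigenvalues of x on
  block l and \<open>f l\<close> is the value of y^2. The values of x on the scalar blocks are
  \<open>a (M - 1)\<close> and \<open>b (M - 1)\<close>, each occurring on two of them, where y is
  \<open>r 0\<close>, \<open>r 1\<close> and \<open>r 2\<close>, \<open>r 3\<close> respectively.
  The complex group algebra and the deformation are both instances.\<close>

locale block_model =
  fixes M :: nat and a b f :: "nat \<Rightarrow> 'k::field" and r :: "nat \<Rightarrow> 'k"
  assumes M_pos: "M > 0"
    and a_inj: "l < M \<Longrightarrow> m < M \<Longrightarrow> a l = a m \<Longrightarrow> l = m"
    and b_inj: "l < M \<Longrightarrow> m < M \<Longrightarrow> b l = b m \<Longrightarrow> l = m"
    and ab: "l < M \<Longrightarrow> m < M \<Longrightarrow> a l \<noteq> b m"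
    and f: "l < M - 1 \<Longrightarrow> f l \<noteq> 0"
    and r: "r 0 \<noteq> r 1" "r 2 \<noteq> r 3"
begin

definition e :: "nat \<Rightarrow> 'k" where
  "e l = (if l \<le> M then a (M - 1) else b (M - 1))"

definition rr :: "nat \<Rightarrow> 'k" where
  "rr l = (if l = M - 1 then r 0 else if l = M then r 1 else if l = M + 1 then r 2 else r 3)"

definition xx :: "'k blocks" where
  "xx = (\<lambda>l. if l < M - 1 then M2 (a l) 0 0 (b l) else M2 (e l) 0 0 (e l))"

definition yy :: "'k blocks" where
  "yy = (\<lambda>l. if l < M - 1 then M2 0 (f l) 1 0 else M2 (rr l) 0 0 (rr l))"

definition B :: "nat \<times> nat \<Rightarrow> 'k blocks" where
  "B = (\<lambda>(i, j). xx ^ i * yy ^ j)"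

abbreviation "I \<equiv> {..<2 * M} \<times> {..<2::nat}"

text \<open>This is p evaluated at \<open>xx\<close>, written out blockwise, so every element of the
  span of \<open>B\<close> has the form \<open>ev p0 + ev p1 * yy\<close>.\<close>

definition ev :: "'k poly \<Rightarrow> 'k blocks" where
  "ev p = (\<lambda>l. if l < M - 1 then M2 (poly p (a l)) 0 0 (poly p (b l)) else M2 (poly p (e l)) 0 0 (poly p (e l)))"

lemma xx_power: "xx ^ i = ev (monom 1 i)"
proof (induction i)
  case 0
  show ?case by (auto simp: fun_eq_iff ev_def m2_eq_iff poly_monom)
next
  case (Suc i)
  then show ?case by (auto simp: fun_eq_iff xx_def ev_def m2_eq_iff poly_monom)
qed

lemma sum_xx_power:
  assumes "\<And>i. n \<le> i \<Longrightarrow> coeff p i = 0"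
  shows "(\<Sum>i<n. sc (coeff p i) * xx ^ i) = ev p"
proof -
  have *: "poly p x = (\<Sum>i<n. coeff p i * x ^ i)" for x
  proof (cases "p = 0")
    case False
    then have "degree p < n" using assms[of "degree p"] by (metis leading_coeff_0_iff not_le)
    then have "(\<Sum>i<n. coeff p i * x ^ i) = (\<Sum>i\<le>degree p. coeff p i * x ^ i)"
      by (intro sum.mono_neutral_right) (auto simp: coeff_eq_0)
    then show ?thesis by (simp add: poly_altdef)
  qed simp
  show ?thesis
    unfolding xx_power by (auto simp: fun_eq_iff ev_def m2_eq_iff poly_monom *)
qed

lemma sum_B:
  assumes "\<And>i j. 2 * M \<le> i \<Longrightarrow> coeff (p j) i = 0"
  shows "(\<Sum>(i, j)\<in>I. sc (coeff (p j) i) * B (i, j)) = ev (p 0) + ev (p 1) * yy"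
proof -
  have "(\<Sum>(i, j)\<in>I. sc (coeff (p j) i) * B (i, j)) = (\<Sum>i<2 * M. \<Sum>j<2. sc (coeff (p j) i) * (xx ^ i * yy ^ j))"
    by (simp add: sum.cartesian_product B_def)
  also have "\<dots> = (\<Sum>i<2 * M. sc (coeff (p 0) i) * xx ^ i) + (\<Sum>i<2 * M. sc (coeff (p 1) i) * xx ^ i) * yy"
    by (simp add: numeral_2_eq_2 sum.distrib sum_distrib_right mult.assoc)
  finally show ?thesis using assms by (simp add: sum_xx_power)
qed

lemma coords:
  fixes c :: "nat \<times> nat \<Rightarrow> 'k"
  obtains p where "\<And>i j. 2 * M \<le> i \<Longrightarrow> coeff (p j) i = 0"
    "\<And>i j. i < 2 * M \<Longrightarrow> coeff (p j) i = c (i, j)"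
proof
  let ?p = "\<lambda>j. \<Sum>i<2 * M. monom (c (i, j)) i"
  show "coeff (?p j) i = 0" if "2 * M \<le> i" for i j using that by (simp add: coeff_sum)
  show "coeff (?p j) i = c (i, j)" if "i < 2 * M" for i j using that by (simp add: coeff_sum)
qed

lemma sum_coords:
  assumes "\<And>i j. 2 * M \<le> i \<Longrightarrow> coeff (p j) i = 0" "\<And>i j. i < 2 * M \<Longrightarrow> coeff (p j) i = c (i, j)"
  shows "(\<Sum>x\<in>I. sc (c x) * B x) = ev (p 0) + ev (p 1) * yy"
proof -
  have "(\<Sum>x\<in>I. sc (c x) * B x) = (\<Sum>(i, j)\<in>I. sc (coeff (p j) i) * B (i, j))"
    by (rule sum.cong) (auto simp: assms(2))
  then show ?thesis using sum_B[of p, OF assms(1)] by simp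
qed

lemma card_points: "card (a ` {..<M} \<union> b ` {..<M}) = 2 * M"
proof -
  have "card (a ` {..<M}) = M" "card (b ` {..<M}) = M"
    using a_inj b_inj by (simp_all add: card_image inj_on_def)
  moreover have "a ` {..<M} \<inter> b ` {..<M} = {}" using ab by auto
  ultimately show ?thesis by (simp add: card_Un_disjoint)
qed

lemma poly_zero:
  assumes "\<And>i. 2 * M \<le> i \<Longrightarrow> coeff p i = 0"
    "\<And>l. l < M \<Longrightarrow> poly p (a l) = 0" "\<And>l. l < M \<Longrightarrow> poly p (b l) = 0"
  shows "p = 0"
proof (rule ccontr)
  assume p: "p \<noteq> 0"
  have "2 * M \<le> card {x. poly p x = 0}"
    unfolding card_points[symmetric] using p assms(2,3) by (intro card_mono poly_roots_finite) auto
  also have "\<dots> \<le> degree p" using p by (rule card_poly_roots_bound)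
  finally show False using assms(1)[of "degree p"] p by simp
qed

lemma scalar_values:
  "e (M - 1) = a (M - 1)" "e M = a (M - 1)" "e (M + 1) = b (M - 1)" "e (M + 2) = b (M - 1)"
  "rr (M - 1) = r 0" "rr M = r 1" "rr (M + 1) = r 2" "rr (M + 2) = r 3"
  using M_pos by (auto simp: e_def rr_def)

text \<open>A relation reads p0(x) + p1(x) y = 0 with degrees below 2 M. On a matrix block the
  diagonal involves only p0 and the off-diagonal only p1, up to the nonzero \<open>f l\<close>. Two
  scalar blocks with the same x and different y separate p0 from p1. So both polynomials vanish at 2
  M distinct points.\<close>

lemma indep_B: "sc.indep I B"
  unfolding sc.indep_def
proof (intro allI impI)
  fix c assume c: "(\<Sum>x\<in>I. sc (c x) * B x) = 0"
  obtain p where p: "\<And>i j. 2 * M \<le> i \<Longrightarrow> coeff (p j) i = 0" "\<And>i j. i < 2 * M \<Longrightarrow> coeff (p j) i = c (i, j)"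
    using coords[of c] by blast
  have z: "ev (p 0) + ev (p 1) * yy = 0" using c sum_coords[OF p] by simp
  have pair: "poly (p 0) (a l) = 0 \<and> poly (p 0) (b l) = 0 \<and> poly (p 1) (a l) = 0 \<and> poly (p 1) (b l) = 0"
    if "l < M - 1" for l
    using fun_cong[OF z, of l] that f[OF that] by (simp add: ev_def yy_def m2_eq_iff)
  have scalar: "poly (p 0) (e l) + poly (p 1) (e l) * rr l = 0" if "l \<ge> M - 1" for l
    using fun_cong[OF z, of l] that by (simp add: ev_def yy_def m2_eq_iff)
  have solve: "x = 0 \<and> y = 0" if "x + y * s = 0" "x + y * t = 0" "s \<noteq> t" for x y s t :: 'k
  proof -
    have "x + y * s = x + y * t" using that by simp
    then have "y * s = y * t" by (rule add_left_imp_eq)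
    then show ?thesis using that by simp
  qed
  have "poly (p 0) (a (M - 1)) = 0 \<and> poly (p 1) (a (M - 1)) = 0"
    using scalar[of "M - 1"] scalar[of M] r(1) unfolding scalar_values by (intro solve[of _ _ "r 0" "r 1"]) simp_all
  moreover have "poly (p 0) (b (M - 1)) = 0 \<and> poly (p 1) (b (M - 1)) = 0"
    using scalar[of "M + 1"] scalar[of "M + 2"] r(2) unfolding scalar_values by (intro solve[of _ _ "r 2" "r 3"]) simp_all
  moreover have "l < M - 1 \<or> l = M - 1" if "l < M" for l using that by linarith
  ultimately have "\<forall>l<M. poly (p 0) (a l) = 0 \<and> poly (p 0) (b l) = 0 \<and> poly (p 1) (a l) = 0 \<and> poly (p 1) (b l) = 0"
    using pair by blast
  then have "p 0 = 0" "p 1 = 0" using p(1) by (auto intro!: poly_zero)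
  then have pz: "p j = 0" if "j < 2" for j using that by (cases j) auto
  show "\<forall>x\<in>I. c x = 0"
  proof clarify
    fix i j :: nat assume "i < 2 * M" "j < 2"
    then show "c (i, j) = 0" using p(2)[of i j] pz[of j] by simp
  qed
qed

lemma ev_block: "ev p \<in> block_algebra M"
  by (rule block_algebraI) (auto simp: ev_def e_def)

lemma yy_block: "yy \<in> block_algebra M"
  by (rule block_algebraI) (auto simp: yy_def rr_def)

lemma interpolate_points:
  obtains p where "\<And>i. 2 * M \<le> i \<Longrightarrow> coeff p i = 0"
    "\<And>l. l < M \<Longrightarrow> poly p (a l) = u l" "\<And>l. l < M \<Longrightarrow> poly p (b l) = v l"
proof -
  define g where "g x = (if x \<in> a ` {..<M} then u (inv_into {..<M} a x) else v (inv_into {..<M} b x))" for x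
  have "b l \<notin> a ` {..<M}" if "l < M" for l using that ab by force
  then have "g (a l) = u l" "g (b l) = v l" if "l < M" for l
    using that a_inj b_inj by (simp_all add: g_def inj_on_def inv_into_f_f)
  moreover obtain p where "\<forall>x\<in>a ` {..<M} \<union> b ` {..<M}. poly p x = g x" "\<forall>i\<ge>2 * M. coeff p i = 0"
    using interpolation[of "a ` {..<M} \<union> b ` {..<M}" g] unfolding card_points by auto
  ultimately show thesis by (intro that[of p]) auto
qed

text \<open>The converse inclusion is interpolation: a given block sequence prescribes the values of
  p0 and p1 at all 2 M eigenvalues of x.\<close>

lemma span_B: "sc.lspan I B = block_algebra M"
proof (intro equalityI subsetI)
  fix d assume "d \<in> sc.lspan I B"
  then obtain c where c: "d = (\<Sum>x\<in>I. sc (c x) * B x)" by (rule sc.lspanE)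
  obtain p where p: "\<And>i j. 2 * M \<le> i \<Longrightarrow> coeff (p j) i = 0" "\<And>i j. i < 2 * M \<Longrightarrow> coeff (p j) i = c (i, j)"
    using coords[of c] by blast
  have "d = ev (p 0) + ev (p 1) * yy" using c sum_coords[OF p] by simp
  then show "d \<in> block_algebra M"
    by (simp only:) (intro block_algebra_add block_algebra_mult ev_block yy_block)
next
  fix d :: "'k blocks" assume d: "d \<in> block_algebra M"
  define s where "s l = e11 (d l)" for l
  \<comment> \<open>\<open>x1\<close>, \<open>y1\<close> will be the values of p0, p1 at
    \<open>a (M - 1)\<close>, and \<open>x2\<close>, \<open>y2\<close> those at
    \<open>b (M - 1)\<close>. Each pair solves the two linear equations of the scalar blocks that
    share this value of x.\<close>
  define y1 where "y1 = (s (M - 1) - s M) / (r 0 - r 1)"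
  define y2 where "y2 = (s (M + 1) - s (M + 2)) / (r 2 - r 3)"
  define x1 where "x1 = s M - y1 * r 1"
  define x2 where "x2 = s (M + 2) - y2 * r 3"
  have sol: "x1 + y1 * r 0 = s (M - 1)" "x1 + y1 * r 1 = s M" "x2 + y2 * r 2 = s (M + 1)" "x2 + y2 * r 3 = s (M + 2)"
  proof -
    have *: "v - (u - v) / (s - t) * t + (u - v) / (s - t) * s = u" if "s \<noteq> t" for u v s t :: 'k
    proof -
      have "(u - v) / (s - t) * (s - t) = u - v" using that by simp
      then show ?thesis by (simp add: right_diff_distrib) (simp add: algebra_simps)
    qed
    show "x1 + y1 * r 0 = s (M - 1)" "x2 + y2 * r 2 = s (M + 1)"
      unfolding x1_def x2_def y1_def y2_def by (rule *[OF r(1)], rule *[OF r(2)])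
  qed (simp_all add: x1_def x2_def)
  obtain p0 where p0: "\<And>i. 2 * M \<le> i \<Longrightarrow> coeff p0 i = 0"
    "\<And>l. l < M \<Longrightarrow> poly p0 (a l) = (if l < M - 1 then e11 (d l) else x1)"
    "\<And>l. l < M \<Longrightarrow> poly p0 (b l) = (if l < M - 1 then e22 (d l) else x2)"
    by (rule interpolate_points[of "\<lambda>l. if l < M - 1 then e11 (d l) else x1" "\<lambda>l. if l < M - 1 then e22 (d l) else x2"]) blast
  obtain p1 where p1: "\<And>i. 2 * M \<le> i \<Longrightarrow> coeff p1 i = 0"
    "\<And>l. l < M \<Longrightarrow> poly p1 (a l) = (if l < M - 1 then e12 (d l) / f l else y1)"
    "\<And>l. l < M \<Longrightarrow> poly p1 (b l) = (if l < M - 1 then e21 (d l) else y2)"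
    by (rule interpolate_points[of "\<lambda>l. if l < M - 1 then e12 (d l) / f l else y1" "\<lambda>l. if l < M - 1 then e21 (d l) else y2"]) blast
  define p where "p j = (if j = 0 then p0 else p1)" for j :: nat
  have "(ev p0 + ev p1 * yy) l = d l" for l
  proof (cases "l < M - 1")
    case True
    then show ?thesis using p0 p1 f by (simp add: ev_def yy_def m2_eq_iff)
  next
    case False
    then consider "l = M - 1" | "l = M" | "l = M + 1" | "l \<ge> M + 2" by linarith
    then have "e11 ((ev p0 + ev p1 * yy) l) = s l"
    proof cases
      case 4
      have "l \<noteq> M - 1" "l \<noteq> M" using 4 by linarith+
      then have "e l = b (M - 1)" "rr l = r 3" using 4 by (simp_all add: e_def rr_def)
      then show ?thesis
        using False p0(3)[of "M - 1"] p1(3)[of "M - 1"] sol(4) M_pos block_algebra_tail[OF d 4]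
        by (simp add: ev_def yy_def s_def)
    qed (use False p0(2,3)[of "M - 1"] p1(2,3)[of "M - 1"] sol M_pos scalar_values in
        \<open>simp_all add: ev_def yy_def\<close>)
    then show ?thesis
      using False block_algebraD[OF d, of l] by (simp add: ev_def yy_def m2_eq_iff s_def)
  qed
  then have "d = (\<Sum>(i, j)\<in>I. sc (coeff (p j) i) * B (i, j))"
    using p0(1) p1(1) by (subst sum_B) (auto simp: p_def fun_eq_iff)
  also have "\<dots> \<in> sc.lspan I B"
    using sc.lspanI[of "\<lambda>(i, j). coeff (p j) i" B I] by (simp add: case_prod_unfold)
  finally show "d \<in> sc.lspan I B" .
qed

end

section \<open>Separability of forms of block algebras\<close>

text \<open>The minimum matters for l = M + 2, where the entry has to be repeated along the whole
  tail.\<close>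

definition at_block :: "nat \<Rightarrow> nat \<Rightarrow> 'k::field m2 \<Rightarrow> 'k blocks" where
  "at_block M l u = (\<lambda>l'. if min l' (M + 2) = l then u else 0)"

lemma at_block_mem:
  assumes "l < M - 1 \<or> u = M2 (e11 u) 0 0 (e11 u)"
  shows "at_block M l u \<in> block_algebra M"
  using assms by (intro block_algebraI) (auto simp: at_block_def m2_eq_iff)

context split_emb
begin

lemma kron_bil:
  assumes "finite J" "\<And>j. j \<in> J \<Longrightarrow> u j \<in> sc.lspan I \<beta>" "\<And>j. j \<in> J \<Longrightarrow> v j \<in> sc.lspan I \<beta>"
  shows "\<exists>C. bil C = (\<Sum>j\<in>J. kron (u j) (v j))"
proof -
  have "\<exists>C. bil C = kron x y" if x: "x \<in> sc.lspan I \<beta>" and y: "y \<in> sc.lspan I \<beta>" for x y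
  proof -
    obtain p where p: "x = (\<Sum>g\<in>I. sc (p g) * \<beta> g)" using x by (rule sc.lspanE)
    obtain q where q: "y = (\<Sum>h\<in>I. sc (q h) * \<beta> h)" using y by (rule sc.lspanE)
    have "kron x y = (\<Sum>g\<in>I. \<Sum>h\<in>I. kron (sc (p g * q h) * \<beta> g) (\<beta> h))"
      unfolding p q kron_sum
      by (simp add: kron_sc(1)[symmetric] sc.map_mult mult.assoc[symmetric] mult.commute[of "p _"]) (rule sum.swap)
    then show ?thesis by (intro exI[of _ "\<lambda>g h. p g * q h"]) (simp add: bil_def)
  qed
  note single = this
  have add: "bil C + bil C' = bil (\<lambda>g h. C g h + C' g h)" for C C'
    by (simp add: bil_def sc.map_add distrib_right kron_add sum.distrib)
  show ?thesis
    using assms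
  proof (induction J rule: finite_induct)
    case empty
    show ?case by (rule exI[of _ "\<lambda>_ _. 0"]) (simp add: bil_def)
  next
    case (insert j J)
    then obtain C where "bil C = (\<Sum>j\<in>J. kron (u j) (v j))" by blast
    moreover obtain C' where "bil C' = kron (u j) (v j)" using single insert.prems by blast
    ultimately show ?case using insert.hyps add[of C' C] by auto
  qed
qed

lemma separable_if_block:
  assumes span: "sc.lspan I \<beta> = block_algebra M"
  shows "separable_algebra ring_of_type_algebra A"
proof -
  \<comment> \<open>On a matrix block the separability idempotent is E11 \<otimes> E11 + E21
    \<otimes> E12, which involves no division and so exists in characteristic two; on a scalar block
    it is 1 \<otimes> 1. The Boolean numbers the two summands.\<close>
  define u :: "nat \<times> bool \<Rightarrow> 'k blocks" where
    "u = (\<lambda>(l, i). at_block M l (if l < M - 1 then if i then M2 1 0 0 0 else M2 0 0 1 0 else if i then 1 else 0))"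
  define v :: "nat \<times> bool \<Rightarrow> 'k blocks" where
    "v = (\<lambda>(l, i). at_block M l (if l < M - 1 then if i then M2 1 0 0 0 else M2 0 1 0 0 else if i then 1 else 0))"
  define e where "e = (\<Sum>j\<in>{..M + 2} \<times> UNIV. kron (u j) (v j))"
  have "u j \<in> block_algebra M" "v j \<in> block_algebra M" for j
    unfolding u_def v_def by (cases j, auto intro!: at_block_mem simp: m2_eq_iff)+
  then obtain C where C: "bil C = e"
    using kron_bil[of "{..M + 2} \<times> UNIV" u v] by (auto simp: e_def span)
  have e_apply: "e l l' = (if min l (M + 2) = min l' (M + 2) then if l < M - 1 then M2 (M2 1 0 0 0) (M2 0 0 0 0) (M2 0 0 0 0) (M2 0 0 0 0)
      + M2 (M2 0 0 0 0) (M2 0 0 0 0) (M2 0 0 1 0) (M2 0 0 0 0) else 1 else 0)" for l l'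
  proof -
    have "e = (\<Sum>m\<le>M + 2. \<Sum>i\<in>UNIV. kron (u (m, i)) (v (m, i)))"
      unfolding e_def sum.cartesian_product by simp
    then have "e l l' = (\<Sum>m\<le>M + 2. kron (u (m, True)) (v (m, True)) l l' + kron (u (m, False)) (v (m, False)) l l')"
      by (simp add: UNIV_bool add.commute del: sum.atMost_Suc)
    also have "\<dots> = (\<Sum>m\<le>M + 2. if m = min l (M + 2) then kron (u (m, True)) (v (m, True)) l l'
        + kron (u (m, False)) (v (m, False)) l l' else 0)"
      by (rule sum.cong) (auto simp: u_def v_def at_block_def kron_def m2_eq_iff)
    also have "\<dots> = kron (u (min l (M + 2), True)) (v (min l (M + 2), True)) l l'
        + kron (u (min l (M + 2), False)) (v (min l (M + 2), False)) l l'"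
      by (subst sum.delta) auto
    finally have e: "e l l' = kron (u (min l (M + 2), True)) (v (min l (M + 2), True)) l l'
        + kron (u (min l (M + 2), False)) (v (min l (M + 2), False)) l l'" .
    have less: "min l (M + 2) < M - 1 \<longleftrightarrow> l < M - 1" by auto
    show ?thesis
    proof (cases "min l' (M + 2) = min l (M + 2)")
      case True
      then show ?thesis
        unfolding e u_def v_def split at_block_def less kron_def by (cases "l < M - 1") (simp_all add: m2_eq_iff)
    next
      case False
      then show ?thesis unfolding e u_def v_def split at_block_def kron_def by (simp add: m2_eq_iff)
    qed
  qed
  have "contract e = 1"
    by (auto simp: fun_eq_iff contract_def e_apply m2_eq_iff)
  moreover have "kron d 1 * e = kron 1 d * e" if "d \<in> sc.lspan I \<beta>" for d
  proof (intro ext)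
    fix l l'
    have d: "d \<in> block_algebra M" using that span by simp
    have "d l = d l'" if "min l (M + 2) = min l' (M + 2)"
      using that block_algebra_min[OF d] by metis
    then show "(kron d 1 * e) l l' = (kron 1 d * e) l l'"
      using block_algebraD[OF d, of l] by (auto simp: kron_def e_apply m2_eq_iff)
  qed
  ultimately show ?thesis by (rule separable[OF C])
qed

end

section \<open>Groups given by presentations\<close>

definition pcls :: "('x word \<times> 'x word) set \<Rightarrow> 'x word \<Rightarrow> 'x word set" where
  "pcls rels w = {v. presentation_eq rels w v}"

lemma pcls_eq_iff: "pcls rels u = pcls rels v \<longleftrightarrow> presentation_eq rels u v"
  unfolding pcls_def by (auto intro: presentation_eq.intros)

lemma presented_group_simps:
  shows "carrier (presented_group rels) = range (pcls rels)"
    and "pcls rels u \<otimes>\<^bsub>presented_group rels\<^esub> pcls rels v = pcls rels (u @ v)"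
    and "\<one>\<^bsub>presented_group rels\<^esub> = pcls rels []"
proof -
  have *: "{(u, v). presentation_eq rels u v} `` {w} = pcls rels w" for w
    by (auto simp: pcls_def)
  show "carrier (presented_group rels) = range (pcls rels)"
    by (auto simp: presented_group_def Let_def quotient_def pcls_def)
  have cong: "pcls rels (u' @ v') = pcls rels (u @ v)" if "u' \<in> pcls rels u" "v' \<in> pcls rels v" for u' v'
    unfolding pcls_eq_iff using that unfolding pcls_def mem_Collect_eq
    by (intro presentation_eq.sym[OF presentation_eq.append])
  have self: "u \<in> pcls rels u" "v \<in> pcls rels v"
    by (simp_all add: pcls_def presentation_eq.refl)
  show "pcls rels u \<otimes>\<^bsub>presented_group rels\<^esub> pcls rels v = pcls rels (u @ v)"
  proof -
    have "(\<Union>u'\<in>pcls rels u. \<Union>v'\<in>pcls rels v. pcls rels (u' @ v')) =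
        (\<Union>u'\<in>pcls rels u. \<Union>v'\<in>pcls rels v. pcls rels (u @ v))"
      using cong by (intro SUP_cong HOL.refl)
    also have "\<dots> = pcls rels (u @ v)" using self by auto
    finally show ?thesis by (simp only: presented_group_def Let_def * monoid.simps partial_object.simps)
  qed
  show "\<one>\<^bsub>presented_group rels\<^esub> = pcls rels []"
    by (simp add: presented_group_def Let_def pcls_def)
qed

lemma monoid_presented_group: "Group.monoid (presented_group rels)"
  by (rule monoidI) (auto simp: presented_group_simps)

primrec weval :: "('x \<times> bool \<Rightarrow> 'd::monoid_mult) \<Rightarrow> 'x word \<Rightarrow> 'd" where
  "weval \<phi> [] = 1"
| "weval \<phi> (x # w) = \<phi> x * weval \<phi> w"

lemma weval_append [simp]: "weval \<phi> (u @ v) = weval \<phi> u * weval \<phi> v"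
  by (induction u) (auto simp: mult.assoc)

lemma weval_replicate [simp]: "weval \<phi> (replicate n x) = \<phi> x ^ n"
  by (induction n) auto

text \<open>\<open>R\<close> has to respect products only inside \<open>S\<close>. This is what
  congruence modulo t requires, which is multiplicative only within a lattice; equality on the whole
  ring is the other use.\<close>

lemma weval_cong:
  fixes \<phi> :: "'x \<times> bool \<Rightarrow> 'd::monoid_mult"
  assumes "presentation_eq rels u v"
    and mem: "\<And>w. weval \<phi> w \<in> S"
    and R_refl: "\<And>x. x \<in> S \<Longrightarrow> R x x" and R_sym: "\<And>x y. R x y \<Longrightarrow> R y x"
    and R_trans: "\<And>x y z. R x y \<Longrightarrow> R y z \<Longrightarrow> R x z"
    and mult: "\<And>x x' y y'. x \<in> S \<Longrightarrow> x' \<in> S \<Longrightarrow> y \<in> S \<Longrightarrow> y' \<in> S \<Longrightarrow> R x x' \<Longrightarrow> R y y' \<Longrightarrow> R (x * y) (x' * y')"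
    and rel: "\<And>u v. (u, v) \<in> rels \<Longrightarrow> R (weval \<phi> u) (weval \<phi> v)"
    and cancel_gen: "\<And>x b. R (\<phi> (x, b) * \<phi> (x, \<not> b)) 1"
  shows "R (weval \<phi> u) (weval \<phi> v)"
  using assms(1)
proof (induction rule: presentation_eq.induct)
  case (append u u' v v')
  then show ?case using mult[OF mem mem mem mem] by simp
next
  case (trans u v w)
  show ?case by (rule R_trans[OF trans.IH])
next
  case (sym u v)
  show ?case by (rule R_sym[OF sym.IH])
next
  case (cancel x b)
  show ?case using cancel_gen[of x b] by simp
next
  case (refl u)
  show ?case by (rule R_refl[OF mem])
qed (rule rel)

abbreviation "\<sigma> \<equiv> (Sigma_gen, True)"
abbreviation "\<sigma>' \<equiv> (Sigma_gen, False)"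
abbreviation "\<tau> \<equiv> (Tau_gen, True)"
abbreviation "\<tau>' \<equiv> (Tau_gen, False)"

definition quat_rels :: "nat \<Rightarrow> (quaternion_gen word \<times> quaternion_gen word) set" where
  "quat_rels M = {(replicate (2 * M) \<sigma>, []), ([\<tau>, \<tau>], replicate M \<sigma>), ([\<tau>, \<sigma>, \<tau>'], [\<sigma>'])}"

abbreviation quat :: "nat \<Rightarrow> quaternion_gen word set monoid" where
  "quat M \<equiv> presented_group (quat_rels M)"

lemma generalized_quaternion_eq:
  assumes "n \<ge> 2" shows "generalized_quaternion n = quat (2 ^ (n - 2))"
proof -
  have "(2::nat) ^ (n - 1) = 2 * 2 ^ (n - 2)"
    using assms by (simp add: Suc_diff_Suc numeral_2_eq_2 flip: power_Suc)
  then show ?thesis by (simp add: generalized_quaternion_def quat_rels_def Let_def)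
qed

definition nform :: "nat \<times> nat \<Rightarrow> quaternion_gen word" where
  "nform = (\<lambda>(i, j). replicate i \<sigma> @ replicate j \<tau>)"

context
  fixes M :: nat
  assumes M_pos: "M > 0"
begin

abbreviation quat_eq (infix "\<doteq>" 50) where "u \<doteq> v \<equiv> presentation_eq (quat_rels M) u v"

lemma eq_in: "u \<doteq> v \<Longrightarrow> x @ u @ y \<doteq> x @ v @ y"
  by (intro presentation_eq.append presentation_eq.refl)

lemmas eq_trans [trans] = presentation_eq.trans[of "quat_rels M"]

lemma rel_sigma: "replicate (2 * M) \<sigma> \<doteq> []"
  and rel_tau: "[\<tau>, \<tau>] \<doteq> replicate M \<sigma>"
  and rel_conj: "[\<tau>, \<sigma>, \<tau>'] \<doteq> [\<sigma>']"
  by (intro presentation_eq.relation; simp add: quat_rels_def)+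

lemma sigma_inv: "[\<sigma>'] \<doteq> replicate (2 * M - 1) \<sigma>"
proof -
  have "[\<sigma>'] \<doteq> [\<sigma>'] @ replicate (2 * M) \<sigma>"
    using eq_in[OF presentation_eq.sym[OF rel_sigma], of "[\<sigma>']" "[]"] by simp
  also have "[\<sigma>'] @ replicate (2 * M) \<sigma> = [(Sigma_gen, False), (Sigma_gen, \<not> False)] @ replicate (2 * M - 1) \<sigma>"
    using M_pos by (cases M) auto
  also have "\<dots> \<doteq> replicate (2 * M - 1) \<sigma>"
    using eq_in[OF presentation_eq.cancel, of "[]" Sigma_gen False "replicate (2 * M - 1) \<sigma>"] by simp
  finally show ?thesis .
qed

lemma tau_sigma: "[\<tau>, \<sigma>] \<doteq> replicate (2 * M - 1) \<sigma> @ [\<tau>]"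
proof -
  have "[\<tau>, \<sigma>] \<doteq> [\<tau>, \<sigma>] @ [(Tau_gen, False), (Tau_gen, \<not> False)]"
    using eq_in[OF presentation_eq.sym[OF presentation_eq.cancel], of "[\<tau>, \<sigma>]" "[]" Tau_gen False] by simp
  also have "\<dots> = [] @ [\<tau>, \<sigma>, \<tau>'] @ [\<tau>]" by simp
  also have "\<dots> \<doteq> [] @ [\<sigma>'] @ [\<tau>]" by (rule eq_in[OF rel_conj])
  also have "\<dots> \<doteq> [] @ replicate (2 * M - 1) \<sigma> @ [\<tau>]" by (rule eq_in[OF sigma_inv])
  finally show ?thesis by simp
qed

lemma tau_sigma_power: "\<tau> # replicate i \<sigma> \<doteq> replicate ((2 * M - 1) * i) \<sigma> @ [\<tau>]"
proof (induction i)
  case 0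
  show ?case by (simp add: presentation_eq.refl)
next
  case (Suc i)
  have "\<tau> # replicate (Suc i) \<sigma> = [] @ (\<tau> # replicate i \<sigma>) @ [\<sigma>]"
    by (simp add: replicate_append_same)
  also have "\<dots> \<doteq> [] @ (replicate ((2 * M - 1) * i) \<sigma> @ [\<tau>]) @ [\<sigma>]" by (rule eq_in[OF Suc])
  also have "\<dots> = replicate ((2 * M - 1) * i) \<sigma> @ [\<tau>, \<sigma>] @ []" by simp
  also have "\<dots> \<doteq> replicate ((2 * M - 1) * i) \<sigma> @ (replicate (2 * M - 1) \<sigma> @ [\<tau>]) @ []"
    by (rule eq_in[OF tau_sigma])
  also have "\<dots> = replicate ((2 * M - 1) * Suc i) \<sigma> @ [\<tau>]"
    by (simp only: mult_Suc_right append_assoc replicate_add append_Nil2)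
      (simp only: append_assoc[symmetric] replicate_add[symmetric] add.commute)
  finally show ?case .
qed

text \<open>Using tau^2 = sigma^M twice, sigma^(2 M) = 1 becomes tau^4 = 1.\<close>

lemma tau_inv: "[\<tau>'] \<doteq> [\<tau>, \<tau>, \<tau>]"
proof -
  have "[\<tau>'] \<doteq> [\<tau>'] @ replicate (2 * M) \<sigma>"
    using eq_in[OF presentation_eq.sym[OF rel_sigma], of "[\<tau>']" "[]"] by simp
  also have "\<dots> = [\<tau>'] @ replicate M \<sigma> @ replicate M \<sigma>" by (simp add: mult_2 replicate_add)
  also have "\<dots> \<doteq> [\<tau>'] @ [\<tau>, \<tau>] @ replicate M \<sigma>" by (rule eq_in[OF presentation_eq.sym[OF rel_tau]])
  also have "\<dots> = [\<tau>', \<tau>, \<tau>] @ replicate M \<sigma> @ []" by simp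
  also have "\<dots> \<doteq> [\<tau>', \<tau>, \<tau>] @ [\<tau>, \<tau>] @ []" by (rule eq_in[OF presentation_eq.sym[OF rel_tau]])
  also have "\<dots> = [] @ [(Tau_gen, False), (Tau_gen, \<not> False)] @ [\<tau>, \<tau>, \<tau>]" by simp
  also have "\<dots> \<doteq> [] @ [] @ [\<tau>, \<tau>, \<tau>]" by (rule eq_in[OF presentation_eq.cancel])
  finally show ?thesis by simp
qed

text \<open>Words equal to some sigma^m tau^j with j < 2 are stable under prepending a generator;
  inverse generators are first replaced by positive words. The exponent m is reduced modulo 2 M only
  at the end. This bounds the order by 4 M; that the normal forms are distinct will come from a
  matrix representation.\<close>

lemma ex_nform: "\<exists>p\<in>{..<2 * M} \<times> {..<2}. w \<doteq> nform p"
proof -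
  define nf where "nf w \<longleftrightarrow> (\<exists>m. \<exists>j<2. w \<doteq> replicate m \<sigma> @ replicate j \<tau>)" for w
  have trans: "nf u" if "u \<doteq> v" "nf v" for u v
    using that unfolding nf_def by (meson eq_trans)
  have sigma: "nf (replicate i \<sigma> @ w)" if w: "nf w" for i w
  proof -
    obtain m j where mj: "j < 2" "w \<doteq> replicate m \<sigma> @ replicate j \<tau>" using w unfolding nf_def by blast
    have "replicate i \<sigma> @ w \<doteq> replicate (i + m) \<sigma> @ replicate j \<tau>"
      using eq_in[OF mj(2), of "replicate i \<sigma>" "[]"] by (simp add: replicate_add)
    then show ?thesis using mj(1) unfolding nf_def by blast
  qed
  have tau: "nf (\<tau> # w)" if w: "nf w" for w
  proof -
    obtain m j where mj: "j < 2" "w \<doteq> replicate m \<sigma> @ replicate j \<tau>" using w unfolding nf_def by blast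
    let ?s = "replicate ((2 * M - 1) * m) \<sigma>"
    have "\<tau> # w \<doteq> [] @ (\<tau> # replicate m \<sigma>) @ replicate j \<tau>"
      using eq_in[OF mj(2), of "[\<tau>]" "[]"] by simp
    also have "\<dots> \<doteq> [] @ (?s @ [\<tau>]) @ replicate j \<tau>"
      by (rule eq_in[OF tau_sigma_power])
    finally have *: "\<tau> # w \<doteq> ?s @ \<tau> # replicate j \<tau>" by simp
    have nil: "nf []" unfolding nf_def using presentation_eq.refl[of "quat_rels M" "[]"]
      by (intro exI[of _ 0] exI[of _ 0]) simp
    have "nf [\<tau>]" unfolding nf_def using presentation_eq.refl[of "quat_rels M" "[\<tau>]"]
      by (intro exI[of _ 0] exI[of _ 1]) simp
    moreover have "nf [\<tau>, \<tau>]"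
      using trans[OF rel_tau sigma[OF nil, of M, simplified]] .
    ultimately have "nf (\<tau> # replicate j \<tau>)" using mj(1) by (auto simp: less_2_cases_iff)
    then show ?thesis using trans[OF * sigma] by blast
  qed
  have "nf w"
  proof (induction w)
    case Nil
    show ?case unfolding nf_def using presentation_eq.refl[of "quat_rels M" "[]"]
      by (intro exI[of _ 0] exI[of _ 0]) simp
  next
    case (Cons x w)
    have "nf (\<sigma> # w)" using sigma[OF Cons, of 1] by simp
    moreover have "nf (\<sigma>' # w)"
      using trans[OF _ sigma[OF Cons, of "2 * M - 1"]] eq_in[OF sigma_inv, of "[]" w] by simp
    moreover have "nf (\<tau>' # w)"
      using trans[OF _ tau[OF tau[OF tau[OF Cons]]]] eq_in[OF tau_inv, of "[]" w] by simp
    ultimately show ?case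
      using tau[OF Cons] by (cases x; cases "fst x"; cases "snd x") auto
  qed
  then obtain m j where mj: "j < 2" "w \<doteq> replicate m \<sigma> @ replicate j \<tau>" unfolding nf_def by blast
  have reduce: "replicate (2 * M * q + i) \<sigma> \<doteq> replicate i \<sigma>" for q i
  proof (induction q)
    case 0
    show ?case by (simp add: presentation_eq.refl)
  next
    case (Suc q)
    have "replicate (2 * M * Suc q + i) \<sigma> = [] @ replicate (2 * M) \<sigma> @ replicate (2 * M * q + i) \<sigma>"
      by (simp add: replicate_add[symmetric] algebra_simps)
    also have "\<dots> \<doteq> [] @ [] @ replicate (2 * M * q + i) \<sigma>" by (rule eq_in[OF rel_sigma])
    also have "\<dots> \<doteq> replicate i \<sigma>" using Suc by simp
    finally show ?case .
  qed
  have "w \<doteq> [] @ replicate m \<sigma> @ replicate j \<tau>" using mj(2) by simp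
  also have "\<dots> \<doteq> [] @ replicate (m mod (2 * M)) \<sigma> @ replicate j \<tau>"
    using reduce[of "m div (2 * M)" "m mod (2 * M)"] by (intro eq_in) simp
  finally show ?thesis
    using mj(1) M_pos by (intro bexI[of _ "(m mod (2 * M), j)"]) (auto simp: nform_def)
qed

lemma carrier_quat: "carrier (quat M) = (\<lambda>p. pcls (quat_rels M) (nform p)) ` ({..<2 * M} \<times> {..<2})"
proof -
  have "pcls (quat_rels M) w \<in> (\<lambda>p. pcls (quat_rels M) (nform p)) ` ({..<2 * M} \<times> {..<2})" for w
    using ex_nform[of w] by (auto simp: pcls_eq_iff image_iff)
  then show ?thesis by (auto simp: presented_group_simps)
qed

lemma finite_quat: "finite (carrier (quat M))"
  unfolding carrier_quat by simp

end

section \<open>Group algebras of finite monoids\<close>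

lemma group_algebra_simps:
  "carrier (group_algebra G) = {f. Poly_Mapping.keys f \<subseteq> carrier G}"
  "\<one>\<^bsub>group_algebra G\<^esub> = Poly_Mapping.single \<one>\<^bsub>G\<^esub> 1"
  "\<zero>\<^bsub>group_algebra G\<^esub> = 0" "f \<oplus>\<^bsub>group_algebra G\<^esub> g = f + g"
  "c \<odot>\<^bsub>group_algebra G\<^esub> f = Poly_Mapping.map ((*) c) f"
  by (simp_all add: group_algebra_def)

lemma lookup_map_mult: "Poly_Mapping.lookup (Poly_Mapping.map ((*) c) f) x = c * Poly_Mapping.lookup f x"
  for c :: "'k::comm_ring_1"
  by (simp add: Poly_Mapping.map.rep_eq when_def)

lemma keys_map_mult: "Poly_Mapping.keys (Poly_Mapping.map ((*) c) f) \<subseteq> Poly_Mapping.keys f"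
  for c :: "'k::comm_ring_1"
  by (auto simp: in_keys_iff lookup_map_mult)

locale fin_monoid = Group.monoid G for G (structure) +
  assumes finite_carrier: "finite (carrier G)"
begin

lemma mult_closed:
  assumes "Poly_Mapping.keys f \<subseteq> carrier G" "Poly_Mapping.keys g \<subseteq> carrier G"
  shows "Poly_Mapping.keys (f \<otimes>\<^bsub>group_algebra G\<^esub> g) \<subseteq> carrier G"
proof -
  have "Poly_Mapping.lookup (f \<otimes>\<^bsub>group_algebra G\<^esub> g) z = 0" if "z \<notin> carrier G" for z
  proof -
    have "x \<otimes> y \<noteq> z" if "x \<in> Poly_Mapping.keys f" "y \<in> Poly_Mapping.keys g" for x y
      using that assms \<open>z \<notin> carrier G\<close> m_closed by blast
    then show ?thesis
      unfolding group_algebra_def by (simp add: lookup_sum lookup_single when_def)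
  qed
  then show ?thesis by (meson in_keys_iff subsetI)
qed

context
  fixes \<iota> :: "'k::comm_ring_1 \<Rightarrow> 'd::ring_1" and \<beta> :: "'a \<Rightarrow> 'd"
  assumes \<iota>: "central_hom \<iota>"
begin

interpretation central_hom \<iota> by (fact \<iota>)

text \<open>The sum runs over the whole finite carrier rather than the support of \<open>f\<close>,
  which makes additivity immediate.\<close>

definition extend :: "('a \<Rightarrow>\<^sub>0 'k) \<Rightarrow> 'd" where
  "extend f = (\<Sum>x\<in>carrier G. \<iota> (Poly_Mapping.lookup f x) * \<beta> x)"

lemma extend_add: "extend (f + g) = extend f + extend g"
  by (simp add: extend_def lookup_add map_add distrib_right sum.distrib)

lemma extend_zero: "extend 0 = 0"
  by (simp add: extend_def)

lemma extend_sum: "extend (sum F S) = (\<Sum>s\<in>S. extend (F s))"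
  by (induction S rule: infinite_finite_induct) (auto simp: extend_zero extend_add)

lemma extend_single: "x \<in> carrier G \<Longrightarrow> extend (Poly_Mapping.single x c) = \<iota> c * \<beta> x"
  unfolding extend_def using finite_carrier
  by (subst sum.remove[of _ x]) (auto simp: lookup_single when_def intro!: sum.neutral split: if_splits)

lemma extend_smult: "extend (Poly_Mapping.map ((*) c) f) = \<iota> c * extend f"
  by (simp add: extend_def lookup_map_mult map_mult sum_distrib_left mult.assoc)

lemma extend_mult:
  assumes "Poly_Mapping.keys f \<subseteq> carrier G" "Poly_Mapping.keys g \<subseteq> carrier G"
  shows "extend (f \<otimes>\<^bsub>group_algebra G\<^esub> g) = (\<Sum>x\<in>carrier G. \<Sum>y\<in>carrier G.
    \<iota> (Poly_Mapping.lookup f x * Poly_Mapping.lookup g y) * \<beta> (x \<otimes> y))"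
proof -
  have "extend (f \<otimes>\<^bsub>group_algebra G\<^esub> g) = (\<Sum>x\<in>Poly_Mapping.keys f. \<Sum>y\<in>Poly_Mapping.keys g.
    \<iota> (Poly_Mapping.lookup f x * Poly_Mapping.lookup g y) * \<beta> (x \<otimes> y))"
    unfolding group_algebra_def using assms
    by (auto simp: extend_sum extend_single subset_iff intro!: sum.cong)
  also have "\<dots> = (\<Sum>x\<in>Poly_Mapping.keys f. \<Sum>y\<in>carrier G.
    \<iota> (Poly_Mapping.lookup f x * Poly_Mapping.lookup g y) * \<beta> (x \<otimes> y))"
    by (intro sum.cong HOL.refl sum.mono_neutral_left finite_carrier assms) (auto simp: in_keys_iff)
  also have "\<dots> = (\<Sum>x\<in>carrier G. \<Sum>y\<in>carrier G.
    \<iota> (Poly_Mapping.lookup f x * Poly_Mapping.lookup g y) * \<beta> (x \<otimes> y))"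
    by (intro sum.mono_neutral_left finite_carrier assms) (auto simp: in_keys_iff)
  finally show ?thesis .
qed

lemma group_algebra_lin_emb:
  assumes "indep (carrier G) \<beta>"
  shows "lin_emb \<iota> (group_algebra G) extend (carrier G) \<beta>"
proof
  show "inj_on extend (carrier (group_algebra G))"
  proof (rule inj_onI)
    fix f g assume fg: "f \<in> carrier (group_algebra G)" "g \<in> carrier (group_algebra G)" "extend f = extend g"
    have "Poly_Mapping.lookup f x = Poly_Mapping.lookup g x" for x
    proof (cases "x \<in> carrier G")
      case True
      then show ?thesis using indep_eq[OF assms fg(3)[unfolded extend_def]] by simp
    next
      case False
      then show ?thesis using fg(1,2) by (simp add: group_algebra_simps) (metis in_keys_iff subset_iff)
    qed
    then show "f = g" by (rule poly_mapping_eqI)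
  qed
  show "extend ` carrier (group_algebra G) = lspan (carrier G) \<beta>"
  proof (intro equalityI subsetI)
    fix d assume "d \<in> lspan (carrier G) \<beta>"
    then obtain c where c: "d = (\<Sum>x\<in>carrier G. \<iota> (c x) * \<beta> x)" by (rule lspanE)
    let ?f = "\<Sum>x\<in>carrier G. Poly_Mapping.single x (c x)"
    have "Poly_Mapping.keys ?f \<subseteq> carrier G"
      by (rule order_trans[OF keys_sum]) (auto split: if_splits)
    moreover have "d = extend ?f" by (simp add: c extend_sum extend_single)
    ultimately show "d \<in> extend ` carrier (group_algebra G)"
      by (intro image_eqI[of _ _ ?f]) (simp_all add: group_algebra_simps)
  qed (auto simp: extend_def lspan_def)
qed (auto simp: finite_carrier group_algebra_simps extend_add extend_zero extend_smult dest!: subsetD[OF keys_map_mult] subsetD[OF Poly_Mapping.keys_add])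

lemma group_algebra_alg_emb:
  assumes "indep (carrier G) \<beta>" "\<beta> \<one> = 1" "\<And>x y. x \<in> carrier G \<Longrightarrow> y \<in> carrier G \<Longrightarrow> \<beta> (x \<otimes> y) = \<beta> x * \<beta> y"
  shows "alg_emb \<iota> (group_algebra G) extend (carrier G) \<beta>"
proof (intro alg_emb.intro group_algebra_lin_emb[OF assms(1)] alg_emb_axioms.intro)
  fix f g :: "'a \<Rightarrow>\<^sub>0 'k" assume fg: "f \<in> carrier (group_algebra G)" "g \<in> carrier (group_algebra G)"
  have *: "\<iota> (c * d) * (\<beta> x * \<beta> y) = \<iota> c * \<beta> x * (\<iota> d * \<beta> y)" for c d x y
    by (metis map_mult central mult.assoc)
  have "extend (f \<otimes>\<^bsub>group_algebra G\<^esub> g) = (\<Sum>x\<in>carrier G. \<Sum>y\<in>carrier G.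
    \<iota> (Poly_Mapping.lookup f x) * \<beta> x * (\<iota> (Poly_Mapping.lookup g y) * \<beta> y))"
    using fg by (simp add: extend_mult group_algebra_simps assms(3) * cong: sum.cong)
  then show "extend (f \<otimes>\<^bsub>group_algebra G\<^esub> g) = extend f * extend g"
    by (simp add: extend_def sum_product)
qed (auto simp: group_algebra_simps extend_single assms(2) mult_closed)

end

text \<open>Indicator functions \<open>t\<close> read off single coefficients. Quantifying over all
  linear functionals lets products be compared through \<open>extend_mult\<close>, as sums over the
  carrier.\<close>

lemma group_algebra_eqI:
  fixes f g :: "'a \<Rightarrow>\<^sub>0 'k::comm_ring_1"
  assumes "Poly_Mapping.keys f \<subseteq> carrier G" "Poly_Mapping.keys g \<subseteq> carrier G"
    and "\<And>t :: 'a \<Rightarrow> 'k. extend (\<lambda>c. c) t f = extend (\<lambda>c. c) t g"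
  shows "f = g"
proof (rule poly_mapping_eqI)
  fix x
  have id: "central_hom (\<lambda>c::'k. c)" by standard (auto simp: mult.commute)
  show "Poly_Mapping.lookup f x = Poly_Mapping.lookup g x"
  proof (cases "x \<in> carrier G")
    case True
    have "extend (\<lambda>c. c) (\<lambda>y. if y = x then 1 else 0) f = Poly_Mapping.lookup f x" for f :: "'a \<Rightarrow>\<^sub>0 'k"
      using True finite_carrier unfolding extend_def[OF id] by (simp add: if_distrib cong: if_cong)
    then show ?thesis using assms(3) by metis
  next
    case False
    then show ?thesis using assms(1,2) by (metis in_keys_iff subset_iff)
  qed
qed

lemma assoc_algebra_group_algebra:
  "assoc_algebra ring_of_type_algebra (group_algebra G :: ('k::comm_ring_1, 'a \<Rightarrow>\<^sub>0 'k) module)"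
proof -
  let ?A = "group_algebra G :: ('k, 'a \<Rightarrow>\<^sub>0 'k) module"
  have id: "central_hom (\<lambda>c::'k. c)" by standard (auto simp: mult.commute)
  note pair = extend_mult[OF id] extend_def[OF id]
  \<comment> \<open>With constant functions as scalars and indicator functions as basis, the group
    algebra embeds linearly into functions. This settles the module axioms; the product is treated
    separately, since it is not pointwise.\<close>
  have const: "central_hom (\<lambda>(c::'k) (_::'a). c)" by standard (auto simp: fun_eq_iff mult.commute)
  have "central_hom.indep (\<lambda>(c::'k) (_::'a). c) (carrier G) (\<lambda>x y. if y = x then 1 else 0)"
    unfolding central_hom.indep_def[OF const] using finite_carrier
    by (auto simp: fun_eq_iff if_distrib cong: if_cong)
  from group_algebra_lin_emb[OF const this]
  interpret L: lin_emb "\<lambda>(c::'k) (_::'a). c" ?A "extend (\<lambda>(c::'k) (_::'a). c) (\<lambda>x y. if y = x then 1 else 0)"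
    "carrier G" "\<lambda>x y. if y = x then 1 else 0" .
  have mem: "f \<in> carrier ?A \<longleftrightarrow> Poly_Mapping.keys f \<subseteq> carrier G" for f by (simp add: group_algebra_simps)
  have keys_add: "Poly_Mapping.keys (f + g) \<subseteq> carrier G"
    if "Poly_Mapping.keys f \<subseteq> carrier G" "Poly_Mapping.keys g \<subseteq> carrier G" for f g :: "'a \<Rightarrow>\<^sub>0 'k"
    using that Poly_Mapping.keys_add[of f g] by auto
  have keys_map: "Poly_Mapping.keys (Poly_Mapping.map ((*) c) f) \<subseteq> carrier G"
    if "Poly_Mapping.keys f \<subseteq> carrier G" for c and f :: "'a \<Rightarrow>\<^sub>0 'k"
    by (rule order_trans[OF keys_map_mult that])
  have assoc: "(f \<otimes>\<^bsub>?A\<^esub> g) \<otimes>\<^bsub>?A\<^esub> h = f \<otimes>\<^bsub>?A\<^esub> (g \<otimes>\<^bsub>?A\<^esub> h)"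
    if "f \<in> carrier ?A" "g \<in> carrier ?A" "h \<in> carrier ?A" for f g h
  proof (rule group_algebra_eqI)
    fix t :: "'a \<Rightarrow> 'k"
    let ?f = "Poly_Mapping.lookup f" and ?g = "Poly_Mapping.lookup g" and ?h = "Poly_Mapping.lookup h"
    have "extend (\<lambda>c. c) t ((f \<otimes>\<^bsub>?A\<^esub> g) \<otimes>\<^bsub>?A\<^esub> h) = (\<Sum>z\<in>carrier G. ?h z * extend (\<lambda>c. c) (\<lambda>u. t (u \<otimes> z)) (f \<otimes>\<^bsub>?A\<^esub> g))"
    proof -
      have "extend (\<lambda>c. c) t ((f \<otimes>\<^bsub>?A\<^esub> g) \<otimes>\<^bsub>?A\<^esub> h) =
          (\<Sum>u\<in>carrier G. \<Sum>z\<in>carrier G. Poly_Mapping.lookup (f \<otimes>\<^bsub>?A\<^esub> g) u * ?h z * t (u \<otimes> z))"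
        using that by (intro extend_mult[OF id]) (simp_all add: mem mult_closed)
      then show ?thesis
        by (subst (asm) sum.swap) (simp add: extend_def[OF id] sum_distrib_left mult_ac)
    qed
    also have "\<dots> = (\<Sum>z\<in>carrier G. \<Sum>x\<in>carrier G. \<Sum>y\<in>carrier G. ?f x * (?g y * ?h z) * t (x \<otimes> (y \<otimes> z)))"
      using that by (simp add: extend_mult[OF id] mem sum_distrib_left m_assoc mult_ac)
    also have "\<dots> = (\<Sum>x\<in>carrier G. \<Sum>y\<in>carrier G. \<Sum>z\<in>carrier G. ?f x * (?g y * ?h z) * t (x \<otimes> (y \<otimes> z)))"
      by (subst sum.swap) (intro sum.cong HOL.refl sum.swap)
    also have "\<dots> = (\<Sum>x\<in>carrier G. ?f x * extend (\<lambda>c. c) (\<lambda>u. t (x \<otimes> u)) (g \<otimes>\<^bsub>?A\<^esub> h))"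
      using that by (simp add: extend_mult[OF id] mem sum_distrib_left mult_ac)
    also have "\<dots> = extend (\<lambda>c. c) t (f \<otimes>\<^bsub>?A\<^esub> (g \<otimes>\<^bsub>?A\<^esub> h))"
    proof -
      have "extend (\<lambda>c. c) t (f \<otimes>\<^bsub>?A\<^esub> (g \<otimes>\<^bsub>?A\<^esub> h)) =
          (\<Sum>x\<in>carrier G. \<Sum>u\<in>carrier G. ?f x * Poly_Mapping.lookup (g \<otimes>\<^bsub>?A\<^esub> h) u * t (x \<otimes> u))"
        using that by (intro extend_mult[OF id]) (simp_all add: mem mult_closed)
      then show ?thesis by (simp add: extend_def[OF id] sum_distrib_left mult_ac)
    qed
    finally show "extend (\<lambda>c. c) t ((f \<otimes>\<^bsub>?A\<^esub> g) \<otimes>\<^bsub>?A\<^esub> h) = extend (\<lambda>c. c) t (f \<otimes>\<^bsub>?A\<^esub> (g \<otimes>\<^bsub>?A\<^esub> h))" .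
  qed (use that in \<open>simp_all add: mem mult_closed\<close>)
  have one: "\<one>\<^bsub>?A\<^esub> \<in> carrier ?A" by (simp add: group_algebra_simps)
  have one_sum: "(\<Sum>x\<in>carrier G. Poly_Mapping.lookup (Poly_Mapping.single \<one> (1::'k)) x * F x) = F \<one>" for F
    using extend_single[OF id, of "\<one>" F 1] by (simp add: extend_def[OF id])
  have ring: "ring ?A"
  proof (intro ringI L.abelian_group monoidI assoc one)
    fix f g assume fg: "f \<in> carrier ?A" "g \<in> carrier ?A"
    then show "f \<otimes>\<^bsub>?A\<^esub> g \<in> carrier ?A" by (simp add: mem mult_closed)
    show "\<one>\<^bsub>?A\<^esub> \<otimes>\<^bsub>?A\<^esub> f = f"
    proof (rule group_algebra_eqI)
      fix t :: "'a \<Rightarrow> 'k"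
      have "extend (\<lambda>c. c) t (\<one>\<^bsub>?A\<^esub> \<otimes>\<^bsub>?A\<^esub> f) = (\<Sum>x\<in>carrier G. Poly_Mapping.lookup \<one>\<^bsub>?A\<^esub> x *
          (\<Sum>y\<in>carrier G. Poly_Mapping.lookup f y * t (x \<otimes> y)))"
        unfolding sum_distrib_left mult.assoc[symmetric] using fg one by (intro extend_mult[OF id]) (simp_all add: mem)
      also have "\<dots> = extend (\<lambda>c. c) t f"
        unfolding group_algebra_simps one_sum by (simp add: extend_def[OF id] cong: sum.cong)
      finally show "extend (\<lambda>c. c) t (\<one>\<^bsub>?A\<^esub> \<otimes>\<^bsub>?A\<^esub> f) = extend (\<lambda>c. c) t f" .
    qed (use fg one in \<open>simp_all add: mem mult_closed\<close>)
    show "f \<otimes>\<^bsub>?A\<^esub> \<one>\<^bsub>?A\<^esub> = f"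
    proof (rule group_algebra_eqI)
      fix t :: "'a \<Rightarrow> 'k"
      have "extend (\<lambda>c. c) t (f \<otimes>\<^bsub>?A\<^esub> \<one>\<^bsub>?A\<^esub>) = (\<Sum>x\<in>carrier G. Poly_Mapping.lookup f x *
          (\<Sum>y\<in>carrier G. Poly_Mapping.lookup \<one>\<^bsub>?A\<^esub> y * t (x \<otimes> y)))"
        unfolding sum_distrib_left mult.assoc[symmetric] using fg one by (intro extend_mult[OF id]) (simp_all add: mem)
      also have "\<dots> = extend (\<lambda>c. c) t f"
        unfolding group_algebra_simps one_sum by (simp add: extend_def[OF id] cong: sum.cong)
      finally show "extend (\<lambda>c. c) t (f \<otimes>\<^bsub>?A\<^esub> \<one>\<^bsub>?A\<^esub>) = extend (\<lambda>c. c) t f" .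
    qed (use fg one in \<open>simp_all add: mem mult_closed\<close>)
    fix h assume h: "h \<in> carrier ?A"
    show "(f \<oplus>\<^bsub>?A\<^esub> g) \<otimes>\<^bsub>?A\<^esub> h = f \<otimes>\<^bsub>?A\<^esub> h \<oplus>\<^bsub>?A\<^esub> g \<otimes>\<^bsub>?A\<^esub> h"
      using fg h by (intro group_algebra_eqI)
        (simp_all add: mem mult_closed keys_add group_algebra_simps(4) extend_mult[OF id] extend_add[OF id] lookup_add
          algebra_simps sum.distrib)
    show "h \<otimes>\<^bsub>?A\<^esub> (f \<oplus>\<^bsub>?A\<^esub> g) = h \<otimes>\<^bsub>?A\<^esub> f \<oplus>\<^bsub>?A\<^esub> h \<otimes>\<^bsub>?A\<^esub> g"
      using fg h by (intro group_algebra_eqI)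
        (simp_all add: mem mult_closed keys_add group_algebra_simps(4) extend_mult[OF id] extend_add[OF id] lookup_add
          algebra_simps sum.distrib)
  qed
  show ?thesis
    unfolding assoc_algebra_def
  proof (intro conjI L.module ring ballI)
    have smult: "extend (\<lambda>c. c) t (c \<odot>\<^bsub>?A\<^esub> f) = c * extend (\<lambda>c. c) t f" for c t f
      by (simp add: extend_def[OF id] group_algebra_simps lookup_map_mult sum_distrib_left mult_ac)
    fix c f g assume fg: "f \<in> carrier ?A" "g \<in> carrier ?A"
    then have c: "c \<odot>\<^bsub>?A\<^esub> f \<in> carrier ?A" "c \<odot>\<^bsub>?A\<^esub> g \<in> carrier ?A" "c \<odot>\<^bsub>?A\<^esub> (f \<otimes>\<^bsub>?A\<^esub> g) \<in> carrier ?A"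
      by (simp_all add: mem mult_closed L.smult_mem[unfolded mem])
    have l: "Poly_Mapping.lookup (c \<odot>\<^bsub>?A\<^esub> f) x = c * Poly_Mapping.lookup f x" for f x
      by (simp add: group_algebra_simps lookup_map_mult)
    show "(c \<odot>\<^bsub>?A\<^esub> f) \<otimes>\<^bsub>?A\<^esub> g = c \<odot>\<^bsub>?A\<^esub> (f \<otimes>\<^bsub>?A\<^esub> g)" "f \<otimes>\<^bsub>?A\<^esub> (c \<odot>\<^bsub>?A\<^esub> g) = c \<odot>\<^bsub>?A\<^esub> (f \<otimes>\<^bsub>?A\<^esub> g)"
      using fg c by (intro group_algebra_eqI;
        simp add: mem mult_closed smult extend_mult[OF id] l sum_distrib_left mult_ac)+
  qed
qed

end

section \<open>Deformed quaternion relations\<close>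

lemma char_2_power_sum:
  fixes x y :: "'d::ring_1"
  assumes "(1::'d) + 1 = 0" "x * y = y * x"
  shows "(x + y) ^ 2 ^ m = x ^ 2 ^ m + y ^ 2 ^ m"
proof (induction m)
  case (Suc m)
  let ?x = "x ^ 2 ^ m" and ?y = "y ^ 2 ^ m"
  have comm: "?y * ?x = ?x * ?y" by (metis assms(2) power_commuting_commutes)
  have double: "a + a = 0" for a :: 'd
    using assms(1) distrib_right[of 1 1 a] by simp
  have "(x + y) ^ 2 ^ Suc m = (?x + ?y) * (?x + ?y)"
    by (simp add: Suc power_mult[symmetric] power2_eq_square[symmetric] mult.commute) (simp add: Suc[symmetric] power_mult[symmetric] mult.commute)
  also have "\<dots> = ?x * ?x + ?y * ?y + (?x * ?y + ?x * ?y)"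
    by (simp add: distrib_left distrib_right comm add_ac)
  also have "\<dots> = ?x * ?x + ?y * ?y" by (simp add: double)
  finally show ?case by (simp add: power_add[symmetric] mult_2)
qed simp

lemma power_mult_commuting:
  fixes x y :: "'d::monoid_mult"
  assumes "x * y = y * x" shows "(x * y) ^ n = x ^ n * y ^ n"
proof (induction n)
  case (Suc n)
  have "y * x ^ n = x ^ n * y" by (metis assms power_commuting_commutes)
  then show ?case by (simp add: Suc mult.assoc) (simp add: mult.assoc[symmetric])
qed simp

text \<open>Kept abstract over the ambient ring and the parameters: closure of the lattice and its
  reduction follow from these relations alone. As \<open>t\<close> divides \<open>c\<close>,
  \<open>s\<close> and \<open>u\<close>, modulo \<open>t\<close> they turn into the relations of the
  quaternion group.\<close>

locale deformed_quat = central_hom \<iota>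
  for \<iota> :: "'r::comm_ring_1 \<Rightarrow> 'd::ring_1" +
  fixes x v y :: 'd and t c s u :: 'r and m :: nat and M w z
  defines "M \<equiv> 2 ^ m" and "w \<equiv> x + v" and "z \<equiv> \<iota> c * (w ^ (M - 1) + \<iota> u)"
  assumes char_2: "(1::'r) + 1 = 0" and m_pos: "m > 0"
    and inv: "x * v = 1" "v * x = 1"
    and small: "t dvd c" "t dvd s" "t dvd u"
    and rel_yx: "y * x = (v + z) * y"
    and rel_yy: "y * y = z * y + x ^ M + \<iota> u * x"
    and rel_w: "(w + \<iota> s) * (w ^ (M - 1) + \<iota> u) = 0"
begin

lemma double: "a + a = (0::'d)"
proof -
  have "(1::'d) + 1 = 0" using map_add[of 1 1] char_2 by simp
  then show ?thesis using distrib_right[of 1 1 a] by simp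
qed

lemma cancel: "a + (a + b) = (b::'d)"
  by (simp add: add.assoc[symmetric] double)

lemma M_ge: "M \<ge> 2"
  using m_pos unfolding M_def by (cases m) auto

section \<open>Polynomials in x and the reduction of x^(2 M)\<close>

definition P :: "nat \<Rightarrow> 'd set" where
  "P n = lspan {..<n} (\<lambda>i. x ^ i)"

lemma P_power: "i < n \<Longrightarrow> x ^ i \<in> P n"
  unfolding P_def by (rule lspan_base) auto

lemma P_mono: "n \<le> n' \<Longrightarrow> P n \<subseteq> P n'"
  unfolding P_def by (rule lspan_subset) (auto intro!: lspan_base)

lemma P_add: "a \<in> P n \<Longrightarrow> b \<in> P n \<Longrightarrow> a + b \<in> P n"
  and P_scale: "a \<in> P n \<Longrightarrow> \<iota> r * a \<in> P n"
  and P_sum: "(\<And>k. k \<in> K \<Longrightarrow> f k \<in> P n) \<Longrightarrow> sum f K \<in> P n"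
  unfolding P_def by (rule lspan_add lspan_scale lspan_sum; assumption)+

lemma x_central: "x ^ i * (\<iota> r * a) = \<iota> r * (x ^ i * a)" "x * (\<iota> r * a) = \<iota> r * (x * a)"
  by (metis central mult.assoc)+

lemma P_shift: assumes "a \<in> P n" shows "x * a \<in> P (Suc n)"
proof -
  obtain f where a: "a = (\<Sum>i<n. \<iota> (f i) * x ^ i)" using assms unfolding P_def by (rule lspanE)
  have "x * a = (\<Sum>i<n. \<iota> (f i) * x ^ Suc i)" by (simp add: a sum_distrib_left x_central)
  then show ?thesis by (auto intro!: P_sum P_scale P_power simp del: power_Suc)
qed

abbreviation "U \<equiv> x * x + 1"

lemma U_power: "U ^ j \<in> P (2 * j + 1)"
proof (induction j)
  case 0
  show ?case using P_power[of 0 1] by simp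
next
  case (Suc j)
  have "x * (x * U ^ j) \<in> P (2 * Suc j + 1)" using P_shift[OF P_shift[OF Suc]] by simp
  moreover have "U ^ j \<in> P (2 * Suc j + 1)" using Suc P_mono[of "2 * j + 1" "2 * Suc j + 1"] by auto
  ultimately show ?case using P_add by (simp add: distrib_right mult.assoc)
qed

text \<open>Chosen so that x^M (w + s) (w^(M-1) + u) = x^(2 M) + 1 + x R. Its degree in x is at most
  2 M - 2, and every summand carries a factor \<open>u\<close> or \<open>s\<close>, hence t.\<close>

definition R :: 'd where
  "R = \<iota> u * x ^ M + \<iota> u * x ^ (M - 2) + \<iota> s * U ^ (M - 1) + \<iota> (s * u) * x ^ (M - 1)"

lemma x_w: "x * w = U" "w * x = U" "x * w = w * x"
  by (simp_all add: w_def distrib_left distrib_right inv)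

text \<open>Multiplying \<open>rel_w\<close> by x^M turns powers of w into powers of x w = x^2 + 1.
  As M is a power of two, Frobenius gives (x^2 + 1)^M = x^(2 M) + 1.\<close>

lemma x_order: "x ^ (2 * M) = 1 + x * R"
proof -
  have c1: "x ^ (M - 1) * (w + \<iota> s) = (w + \<iota> s) * x ^ (M - 1)"
    by (metis x_w(3) central distrib_left distrib_right power_commuting_commutes)
  have "0 = x * (x ^ (M - 1) * ((w + \<iota> s) * (w ^ (M - 1) + \<iota> u)))"
    by (simp only: rel_w mult_zero_right)
  also have "\<dots> = x * (w + \<iota> s) * (x ^ (M - 1) * (w ^ (M - 1) + \<iota> u))"
    by (metis c1 mult.assoc)
  also have "x ^ (M - 1) * (w ^ (M - 1) + \<iota> u) = U ^ (M - 1) + \<iota> u * x ^ (M - 1)"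
    using power_mult_commuting[OF x_w(3), of "M - 1"] by (simp add: distrib_left x_w(1) central[of u])
  also have "x * (w + \<iota> s) = U + \<iota> s * x" by (simp add: distrib_left x_w(1) central[of s])
  also have "(U + \<iota> s * x) * (U ^ (M - 1) + \<iota> u * x ^ (M - 1)) =
      U ^ M + \<iota> u * (U * x ^ (M - 1)) + \<iota> s * (x * U ^ (M - 1)) + \<iota> (s * u) * (x * x ^ (M - 1))"
  proof -
    have expand: "(A + \<iota> s * x) * (D + \<iota> u * E) = A * D + \<iota> u * (A * E) + \<iota> s * (x * D) + \<iota> (s * u) * (x * E)" for A D E
    proof -
      have "A * (\<iota> u * E) = \<iota> u * (A * E)" by (metis central mult.assoc)
      then show ?thesis by (simp add: distrib_left distrib_right mult.assoc map_mult x_central add_ac)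
    qed
    have "U * U ^ (M - 1) = U ^ M" using M_ge by (cases M) auto
    then show ?thesis by (simp only: expand)
  qed
  also have "U ^ M = x ^ (2 * M) + 1"
  proof -
    have "(1::'d) + 1 = 0" by (rule double)
    from char_2_power_sum[OF this, of "x * x" 1 m] show ?thesis
      by (simp add: M_def power_mult power2_eq_square)
  qed
  also have "U * x ^ (M - 1) = x * (x ^ M + x ^ (M - 2))"
  proof -
    obtain k where "M = Suc (Suc k)" using M_ge by (metis add_2_eq_Suc le_Suc_ex)
    then show ?thesis by (simp add: distrib_left distrib_right mult.assoc)
  qed
  finally have "0 = x ^ (2 * M) + (1 + x * R)"
    by (simp add: R_def distrib_left x_central add_ac)
  then show ?thesis by (metis cancel add.commute add_0)
qed

abbreviation "N \<equiv> 2 * M"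

lemma R_mem: "R \<in> P (N - 1)"
proof -
  have "2 * (M - 1) + 1 = N - 1" using M_ge by simp
  then have "U ^ (M - 1) \<in> P (N - 1)" using U_power[of "M - 1"] by simp
  then show ?thesis unfolding R_def using M_ge by (intro P_add P_scale P_power) auto
qed

lemma x_order_mem: "x ^ N \<in> P N"
proof -
  have "x * R \<in> P N" using P_shift[OF R_mem] M_ge by simp
  moreover have "1 \<in> P N" using P_power[of 0 N] M_ge by simp
  ultimately show ?thesis unfolding x_order by (intro P_add)
qed

lemma P_x: assumes "a \<in> P N" shows "x * a \<in> P N"
proof -
  obtain f where a: "a = (\<Sum>i<N. \<iota> (f i) * x ^ i)" using assms unfolding P_def by (rule lspanE)
  have "x * a = (\<Sum>i<N. \<iota> (f i) * x ^ Suc i)" by (simp add: a sum_distrib_left x_central)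
  moreover have "x ^ Suc i \<in> P N" if "i < N" for i
  proof (cases "Suc i = N")
    case True
    then show ?thesis using x_order_mem by simp
  next
    case False
    then show ?thesis using that by (intro P_power) simp
  qed
  ultimately show ?thesis by (auto intro!: P_sum P_scale simp del: power_Suc)
qed

lemma P_x_power: "a \<in> P N \<Longrightarrow> x ^ i * a \<in> P N"
  by (induction i) (auto simp: mult.assoc P_x)

lemma P_mult: assumes "a \<in> P N" "b \<in> P N" shows "a * b \<in> P N"
proof -
  obtain f where a: "a = (\<Sum>i<N. \<iota> (f i) * x ^ i)" using assms(1) unfolding P_def by (rule lspanE)
  show ?thesis unfolding a sum_distrib_right mult.assoc by (intro P_sum P_scale P_x_power assms(2))
qed

lemma P_one: "1 \<in> P N"
  using P_power[of 0 N] M_ge by simp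

lemma P_zero: "0 \<in> P N"
  using P_scale[OF P_one, of 0] by simp

lemma P_pow: "a \<in> P N \<Longrightarrow> a ^ i \<in> P N"
  by (induction i) (auto simp: P_one P_mult)

lemma P_const: "\<iota> r \<in> P N"
  using P_scale[OF P_one, of r] by simp

lemma x_mem: "x \<in> P N"
  using P_x[OF P_one] by simp

text \<open>Multiplying 1 = x^(2 M) + x R by the inverse of x gives v = x^(2 M - 1) + R; this is why
  x was split off in front of \<open>R\<close>.\<close>

lemma v_mem: "v \<in> P N"
proof -
  have "1 = x ^ N + x * R" unfolding x_order by (metis cancel add.commute)
  then have "v = v * (x * x ^ (N - 1) + x * R)" using M_ge by (cases N) auto
  also have "\<dots> = x ^ (N - 1) + R" by (simp add: distrib_left mult.assoc[symmetric] inv)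
  finally show ?thesis
    using P_add[OF P_power[of "N - 1" N], of R] R_mem P_mono[of "N - 1" N] M_ge by auto
qed

lemma w_mem: "w \<in> P N"
  unfolding w_def by (intro P_add x_mem v_mem)

lemma z_mem: "z \<in> P N"
  unfolding z_def by (intro P_scale P_add P_pow w_mem P_const)

text \<open>Moving y from left to right replaces x by v + z, which is again a polynomial in
  x.\<close>

lemma y_P: assumes "a \<in> P N" shows "\<exists>b\<in>P N. y * a = b * y"
proof -
  obtain f where a: "a = (\<Sum>i<N. \<iota> (f i) * x ^ i)" using assms unfolding P_def by (rule lspanE)
  have yx: "y * x ^ i = (v + z) ^ i * y" for i
  proof (induction i)
    case (Suc i)
    have "y * x ^ Suc i = (y * x) * x ^ i" by (simp add: mult.assoc)
    also have "\<dots> = (v + z) * (y * x ^ i)" by (simp add: rel_yx mult.assoc)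
    finally show ?case by (simp add: Suc mult.assoc)
  qed simp
  have "y * (\<iota> r * b) = \<iota> r * (y * b)" for r b by (metis central mult.assoc)
  then have "y * a = (\<Sum>i<N. \<iota> (f i) * (v + z) ^ i) * y"
    by (simp add: a sum_distrib_left sum_distrib_right yx mult.assoc)
  then show ?thesis by (intro bexI[of _ "\<Sum>i<N. \<iota> (f i) * (v + z) ^ i"] P_sum P_scale P_pow P_add v_mem z_mem)
qed

section \<open>The lattice \<open>L\<close>, closed under multiplication, that becomes the deformed
  integral algebra\<close>

definition L :: "'d set" where
  "L = lspan ({..<N} \<times> {..<2::nat}) (\<lambda>(i, j). x ^ i * y ^ j)"

lemma L_iff: "a \<in> L \<longleftrightarrow> (\<exists>p\<in>P N. \<exists>q\<in>P N. a = p + q * y)"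
proof -
  have sum: "(\<Sum>k\<in>{..<N} \<times> {..<2::nat}. \<iota> (f k) * (case k of (i, j) \<Rightarrow> x ^ i * y ^ j)) =
      (\<Sum>i<N. \<iota> (f (i, 0)) * x ^ i) + (\<Sum>i<N. \<iota> (f (i, 1)) * x ^ i) * y" for f
  proof -
    have two: "{..<2::nat} = {0, 1}" by auto
    have "(\<Sum>k\<in>{..<N} \<times> {..<2::nat}. \<iota> (f k) * (case k of (i, j) \<Rightarrow> x ^ i * y ^ j)) =
        (\<Sum>i<N. \<Sum>j<2. \<iota> (f (i, j)) * (x ^ i * y ^ j))"
      unfolding sum.cartesian_product by (simp add: split_def)
    then show ?thesis by (simp add: two sum.distrib sum_distrib_right mult.assoc)
  qed
  show ?thesis
  proof
    assume "a \<in> L"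
    then obtain f where "a = (\<Sum>k\<in>{..<N} \<times> {..<2::nat}. \<iota> (f k) * (case k of (i, j) \<Rightarrow> x ^ i * y ^ j))"
      unfolding L_def by (rule lspanE)
    then show "\<exists>p\<in>P N. \<exists>q\<in>P N. a = p + q * y" unfolding sum P_def
      by (intro bexI[of _ "\<Sum>i<N. \<iota> (f (i, 0)) * x ^ i"] bexI[of _ "\<Sum>i<N. \<iota> (f (i, 1)) * x ^ i"] lspanI)
  next
    assume "\<exists>p\<in>P N. \<exists>q\<in>P N. a = p + q * y"
    then obtain f g where a: "a = (\<Sum>i<N. \<iota> (f i) * x ^ i) + (\<Sum>i<N. \<iota> (g i) * x ^ i) * y"
      unfolding P_def by (blast elim: lspanE)
    have "a = (\<Sum>k\<in>{..<N} \<times> {..<2::nat}. \<iota> (if snd k = 0 then f (fst k) else g (fst k)) * (case k of (i, j) \<Rightarrow> x ^ i * y ^ j))"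
      unfolding sum a by simp
    then show "a \<in> L" unfolding L_def by (simp only: lspanI)
  qed
qed

lemma L_add: "a \<in> L \<Longrightarrow> b \<in> L \<Longrightarrow> a + b \<in> L"
  and L_scale: "a \<in> L \<Longrightarrow> \<iota> r * a \<in> L"
  unfolding L_def by (rule lspan_add lspan_scale; assumption)+

lemma L_P: "a \<in> P N \<Longrightarrow> a \<in> L"
  unfolding L_iff using P_zero by (intro bexI[of _ a] bexI[of _ 0]) auto

lemma L_y: "y \<in> L"
  unfolding L_iff using P_zero P_one by (intro bexI[of _ 0] bexI[of _ 1]) auto

lemma L_P_mult: assumes "a \<in> P N" "b \<in> L" shows "a * b \<in> L"
proof -
  obtain p q where "p \<in> P N" "q \<in> P N" "b = p + q * y" using assms(2) unfolding L_iff by auto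
  then show ?thesis unfolding L_iff using P_mult[OF assms(1)]
    by (intro bexI[of _ "a * p"] bexI[of _ "a * q"]) (auto simp: distrib_left mult.assoc)
qed

lemma L_y_mult: assumes "b \<in> L" shows "y * b \<in> L"
proof -
  obtain p q where pq: "p \<in> P N" "q \<in> P N" "b = p + q * y" using assms unfolding L_iff by auto
  obtain p' q' where p': "p' \<in> P N" "y * p = p' * y" and q': "q' \<in> P N" "y * q = q' * y"
    using y_P pq(1,2) by blast
  have "y * b = p' * y + (y * q) * y" by (simp add: pq distrib_left p' mult.assoc)
  also have "\<dots> = q' * (x ^ M + \<iota> u * x) + (p' + q' * z) * y"
    by (simp add: q' mult.assoc rel_yy distrib_left distrib_right add_ac)
  finally show ?thesis unfolding L_iff
    by (intro bexI[of _ "q' * (x ^ M + \<iota> u * x)"] bexI[of _ "p' + q' * z"])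
      (auto intro!: P_add P_mult P_pow x_mem P_const z_mem p' q')
qed

lemma L_mult: assumes "a \<in> L" "b \<in> L" shows "a * b \<in> L"
proof -
  obtain p q where "p \<in> P N" "q \<in> P N" "a = p + q * y" using assms(1) unfolding L_iff by auto
  then show ?thesis
    using L_add[OF L_P_mult[OF _ assms(2), of p] L_P_mult[OF _ L_y_mult[OF assms(2)], of q]]
    by (simp add: distrib_right mult.assoc)
qed

lemma L_one: "1 \<in> L"
  by (rule L_P[OF P_one])

lemma L_pow: "a \<in> L \<Longrightarrow> a ^ i \<in> L"
  by (induction i) (auto simp: L_one L_mult)

subsection \<open>Reduction modulo \<open>t\<close>\<close>

text \<open>The error has to come from \<open>L\<close>: in the matrix ring of the application t is
  invertible, and a congruence there would say nothing.\<close>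

definition congr :: "'d \<Rightarrow> 'd \<Rightarrow> bool" where
  "congr a b \<longleftrightarrow> (\<exists>l\<in>L. a = b + \<iota> t * l)"

lemma congr_refl: "congr a a"
  unfolding congr_def by (intro bexI[of _ 0] L_P P_zero) simp

lemma congr_sym: "congr a b \<Longrightarrow> congr b a"
  unfolding congr_def by (metis cancel add.commute)

lemma congr_trans: "congr a b \<Longrightarrow> congr b d \<Longrightarrow> congr a d"
  unfolding congr_def by (metis L_add add.assoc distrib_left)

lemma congr_mult:
  assumes "a \<in> L" "a' \<in> L" "b \<in> L" "b' \<in> L" "congr a a'" "congr b b'"
  shows "congr (a * b) (a' * b')"
proof -
  obtain l k where l: "l \<in> L" "a = a' + \<iota> t * l" and k: "k \<in> L" "b = b' + \<iota> t * k"
    using assms(5,6) unfolding congr_def by auto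
  have "a' * (\<iota> t * k) = \<iota> t * (a' * k)" by (metis central mult.assoc)
  then have "a * b = a' * b' + \<iota> t * (a' * k + l * b)"
    by (simp add: l(2) distrib_right) (simp add: k(2) distrib_left mult.assoc add_ac)
  then show ?thesis unfolding congr_def using L_add[OF L_mult L_mult] assms l k by blast
qed

lemma congr_small:
  assumes "t dvd r" "l \<in> L" shows "congr (a + \<iota> r * l) a"
proof -
  obtain r' where "r = t * r'" using assms(1) by (elim dvdE)
  then show ?thesis unfolding congr_def
    by (intro bexI[of _ "\<iota> r' * l"]) (auto simp: map_mult mult.assoc intro: L_scale assms(2))
qed

lemma congr_x_order: "congr (x ^ N) 1"
proof -
  have *: "R = \<iota> u * x ^ M + \<iota> u * x ^ (M - 2) + \<iota> s * (U ^ (M - 1) + \<iota> u * x ^ (M - 1))"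
    by (simp add: R_def distrib_left map_mult mult.assoc add_ac)
  have "1 + x * R = 1 + \<iota> u * (x * x ^ M) + \<iota> u * (x * x ^ (M - 2)) + \<iota> s * (x * (U ^ (M - 1) + \<iota> u * x ^ (M - 1)))"
    unfolding * by (simp add: distrib_left x_central add_ac)
  also have "congr \<dots> 1"
    by (rule congr_trans[OF congr_small congr_trans[OF congr_small congr_small]])
      (intro small L_P P_mult P_add P_scale P_pow x_mem P_one)+
  finally show ?thesis unfolding x_order .
qed

lemma congr_yy: "congr (y * y) (x ^ M)"
proof -
  have "y * y = x ^ M + \<iota> u * x + \<iota> c * ((w ^ (M - 1) + \<iota> u) * y)"
    by (simp add: rel_yy z_def mult.assoc add_ac)
  also have "congr \<dots> (x ^ M)"
    by (rule congr_trans[OF congr_small congr_small])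
      (intro small L_mult L_y L_P P_add P_pow x_mem w_mem P_const)+
  finally show ?thesis .
qed

lemma congr_yx: "congr (y * x) (v * y)"
proof -
  have "y * x = v * y + \<iota> c * ((w ^ (M - 1) + \<iota> u) * y)"
    by (simp add: rel_yx z_def distrib_right mult.assoc)
  also have "congr \<dots> (v * y)"
    by (rule congr_small) (intro small L_mult L_y L_P P_add P_pow w_mem P_const)+
  finally show ?thesis .
qed

text \<open>The inverse of tau is sent to y^3, because y^4 is congruent to 1 modulo t; for sigma the
  exact inverse v is at hand.\<close>

definition gen :: "quaternion_gen \<times> bool \<Rightarrow> 'd" where
  "gen = (\<lambda>(g, b). case g of Sigma_gen \<Rightarrow> if b then x else v | Tau_gen \<Rightarrow> if b then y else y ^ 3)"

lemma gen_simps [simp]: "gen \<sigma> = x" "gen \<sigma>' = v" "gen \<tau> = y" "gen \<tau>' = y ^ 3"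
  by (simp_all add: gen_def)

lemma gen_mem: "gen g \<in> L"
  by (cases g; cases "fst g"; cases "snd g") (auto simp: gen_def intro: L_P x_mem v_mem L_y L_pow)

lemma weval_mem: "weval gen a \<in> L"
  by (induction a) (auto intro: L_one L_mult gen_mem)

lemma congr_y4: "congr (y ^ 4) 1"
proof -
  have x: "x ^ i \<in> L" for i by (intro L_P P_pow x_mem)
  have "congr (y * y * (y * y)) (x ^ M * x ^ M)"
    by (intro congr_mult congr_yy L_mult L_y x)
  also have "y * y * (y * y) = y ^ 4" by (simp add: eval_nat_numeral mult.assoc)
  also have "x ^ M * x ^ M = x ^ N" by (simp add: mult_2 power_add)
  finally show ?thesis using congr_trans congr_x_order by blast
qed

text \<open>Each defining relation of the group holds for x and y up to terms with a factor
  \<open>c\<close>, \<open>s\<close> or \<open>u\<close>, and congruence is compatible with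
  concatenation of words since all values lie in \<open>L\<close>.\<close>

lemma weval_congr:
  assumes "presentation_eq (quat_rels M) a b"
  shows "congr (weval gen a) (weval gen b)"
  using assms weval_mem congr_refl congr_sym congr_trans congr_mult
proof (rule weval_cong)
  fix a b assume "(a, b) \<in> quat_rels M"
  then consider "a = replicate N \<sigma>" "b = []" | "a = [\<tau>, \<tau>]" "b = replicate M \<sigma>" | "a = [\<tau>, \<sigma>, \<tau>']" "b = [\<sigma>']"
    by (auto simp: quat_rels_def)
  then show "congr (weval gen a) (weval gen b)"
  proof cases
    case 3
    have "congr (y * x * y ^ 3) (v * y * y ^ 3)"
      by (intro congr_mult congr_yx congr_refl L_mult L_pow L_y L_P[OF x_mem] L_P[OF v_mem])
    moreover have "congr (v * y ^ 4) (v * 1)"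
      by (intro congr_mult congr_y4 congr_refl L_pow L_y L_P[OF v_mem] L_one)
    ultimately have "congr (y * x * y ^ 3) v"
      using congr_trans by (simp add: eval_nat_numeral mult.assoc)
    then show ?thesis using 3 by (simp add: mult.assoc)
  qed (use congr_x_order congr_yy in \<open>simp_all\<close>)
next
  fix g b
  show "congr (gen (g, b) * gen (g, \<not> b)) 1"
  proof (cases g)
    case Tau_gen
    then show ?thesis using congr_y4 by (cases b) (simp_all add: eval_nat_numeral mult.assoc)
  qed (cases b; simp add: inv congr_refl)
qed

lemma weval_nform: "weval gen (nform (i, j)) = x ^ i * y ^ j"
  by (simp add: nform_def)

end

section \<open>Algebras embedded onto a block algebra\<close>

definition to_mat :: "'k::comm_ring_1 m2 \<Rightarrow> 'k mat" where
  "to_mat u = mat 2 2 (\<lambda>(i, j). if i = 0 then if j = 0 then e11 u else e12 u else if j = 0 then e21 u else e22 u)"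

lemma to_mat_dim [simp]: "dim_row (to_mat u) = 2" "dim_col (to_mat u) = 2" "to_mat u \<in> carrier_mat 2 2"
  by (simp_all add: to_mat_def)

lemma to_mat_index [simp]:
  "to_mat u $$ (0, 0) = e11 u" "to_mat u $$ (0, Suc 0) = e12 u"
  "to_mat u $$ (Suc 0, 0) = e21 u" "to_mat u $$ (Suc 0, Suc 0) = e22 u"
  by (simp_all add: to_mat_def)

lemma eq_mat_2:
  assumes "A \<in> carrier_mat 2 2" "B \<in> carrier_mat 2 2" "A $$ (0, 0) = B $$ (0, 0)" "A $$ (0, Suc 0) = B $$ (0, Suc 0)"
    "A $$ (Suc 0, 0) = B $$ (Suc 0, 0)" "A $$ (Suc 0, Suc 0) = B $$ (Suc 0, Suc 0)"
  shows "A = B"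
  by (rule eq_matI) (use assms in \<open>auto simp: less_2_cases_iff\<close>)

lemma to_mat_hom:
  fixes u v :: "'k::comm_ring_1 m2"
  shows "to_mat (u * v) = to_mat u * to_mat v" "to_mat (u + v) = to_mat u + to_mat v"
    "to_mat (1 :: 'k m2) = 1\<^sub>m 2" "to_mat (0 :: 'k m2) = 0\<^sub>m 2 2" "to_mat (sc c l * u) = c \<cdot>\<^sub>m to_mat u"
proof -
  have two: "(\<Sum>i\<in>{0..<2::nat}. f i) = f 0 + f (Suc 0)" for f :: "nat \<Rightarrow> 'k"
    by (simp add: numeral_2_eq_2)
  show "to_mat (u * v) = to_mat u * to_mat v" "to_mat (u + v) = to_mat u + to_mat v"
    "to_mat (1 :: 'k m2) = 1\<^sub>m 2" "to_mat (0 :: 'k m2) = 0\<^sub>m 2 2" "to_mat (sc c l * u) = c \<cdot>\<^sub>m to_mat u"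
    by (rule eq_mat_2; simp add: scalar_prod_def two carrier_matI)+
qed

lemma to_mat_inj: "to_mat u = to_mat v \<Longrightarrow> u = v"
  unfolding m2_eq_iff by (metis to_mat_index)

lemma to_mat_surj: "A \<in> carrier_mat 2 2 \<Longrightarrow> to_mat (M2 (A $$ (0, 0)) (A $$ (0, Suc 0)) (A $$ (Suc 0, 0)) (A $$ (Suc 0, Suc 0))) = A"
  by (rule eq_mat_2) simp_all

text \<open>If the entry x_ij is nonzero, then E_1i x E_j1 + E_2i x E_j2 is x_ij times the identity.
  This is the simplicity of the matrix ring in explicit form.\<close>

lemma m2_simple:
  fixes x :: "'k::field m2"
  assumes "x \<noteq> 0"
  shows "\<exists>u v u' v'. u * x * v + u' * x * v' = 1"
proof -
  consider "e11 x \<noteq> 0" | "e12 x \<noteq> 0" | "e21 x \<noteq> 0" | "e22 x \<noteq> 0"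
    using assms by (auto simp: m2_eq_iff)
  then show ?thesis
  proof cases
    case 1
    show ?thesis
      by (rule exI[of _ "M2 (1 / e11 x) 0 0 0"], rule exI[of _ "M2 1 0 0 0"],
          rule exI[of _ "M2 0 0 (1 / e11 x) 0"], rule exI[of _ "M2 0 1 0 0"]) (use 1 in \<open>simp add: m2_eq_iff\<close>)
  next
    case 2
    show ?thesis
      by (rule exI[of _ "M2 (1 / e12 x) 0 0 0"], rule exI[of _ "M2 0 0 1 0"],
          rule exI[of _ "M2 0 0 (1 / e12 x) 0"], rule exI[of _ "M2 0 0 0 1"]) (use 2 in \<open>simp add: m2_eq_iff\<close>)
  next
    case 3
    show ?thesis
      by (rule exI[of _ "M2 0 (1 / e21 x) 0 0"], rule exI[of _ "M2 1 0 0 0"],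
          rule exI[of _ "M2 0 0 0 (1 / e21 x)"], rule exI[of _ "M2 0 1 0 0"]) (use 3 in \<open>simp add: m2_eq_iff\<close>)
  next
    case 4
    show ?thesis
      by (rule exI[of _ "M2 0 (1 / e22 x) 0 0"], rule exI[of _ "M2 0 0 1 0"],
          rule exI[of _ "M2 0 0 0 (1 / e22 x)"], rule exI[of _ "M2 0 0 0 1"]) (use 4 in \<open>simp add: m2_eq_iff\<close>)
  qed
qed

text \<open>Met by the deformation over the algebraic closure and by the complex group algebra with
  the same \<open>M\<close>, which is all that the comparison of component dimensions rests
  on.\<close>

locale full_emb = alg_emb sc A \<Phi> I \<beta>
  for A :: "('k::field, 'a) module" and \<Phi> and I :: "'i set" and \<beta> +
  fixes M :: nat
  assumes span: "sc.lspan I \<beta> = block_algebra M" and M_pos: "M > 0"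
begin

lemma emb_block: "x \<in> carrier A \<Longrightarrow> \<Phi> x \<in> block_algebra M"
  using emb_mem span by simp

lemma block_surj:
  assumes "d \<in> block_algebra M" obtains x where "x \<in> carrier A" "\<Phi> x = d"
  using emb_surj assms span by metis

text \<open>The factors of the target are numbered from 1 and the blocks from 0: matrix factor i is
  block i - 1, and the scalar factors 1, ..., 4 are the blocks M - 1, ..., M + 2.\<close>

definition iso :: "'a \<Rightarrow> (nat \<Rightarrow> 'k mat) \<times> (nat \<Rightarrow> 'k)" where
  "iso x = (\<lambda>i\<in>{1..M - 1}. to_mat (\<Phi> x (i - 1)), \<lambda>i\<in>{1..4}. e11 (\<Phi> x (M + i - 2)))"

abbreviation "target \<equiv> direct_sum_algebra
  (product_algebra {1..M - 1} (\<lambda>_. module_mat TYPE('k) 2 2)) (product_algebra {1..4::nat} (\<lambda>_. algebra_along (\<lambda>c. c)))"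

lemma iso_inj: "inj_on iso (carrier A)"
proof (rule inj_onI)
  fix x y assume xy: "x \<in> carrier A" "y \<in> carrier A" "iso x = iso y"
  note bx = emb_block[OF xy(1)] and yb = emb_block[OF xy(2)]
  have fst: "to_mat (\<Phi> x l) = to_mat (\<Phi> y l)" if "l < M - 1" for l
    using fun_cong[OF arg_cong[OF xy(3), of fst], of "Suc l"] that by (simp add: iso_def)
  have snd: "e11 (\<Phi> x l) = e11 (\<Phi> y l)" if "M - 1 \<le> l" "l \<le> M + 2" for l
  proof -
    have "l + 2 - M \<in> {1..4}" "M + (l + 2 - M) - 2 = l" using that M_pos by auto
    then show ?thesis
      using fun_cong[OF arg_cong[OF xy(3), of snd], of "l + 2 - M"]
      unfolding iso_def snd_conv by (simp only: restrict_apply if_True)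
  qed
  have low: "\<Phi> x l = \<Phi> y l" if "l \<le> M + 2" for l
  proof (cases "l < M - 1")
    case True
    then show ?thesis using fst to_mat_inj by blast
  next
    case False
    then show ?thesis using snd[of l] that block_algebraD[OF bx, of l] block_algebraD[OF yb, of l] by (simp add: m2_eq_iff)
  qed
  have "\<Phi> x l = \<Phi> y l" for l
    using low[of "min l (M + 2)"] block_algebra_min[OF bx, of l] block_algebra_min[OF yb, of l] by simp
  then show "x = y" using xy by (intro emb_eqI) auto
qed

lemma iso_surj: "iso ` carrier A = carrier target"
proof (intro equalityI subsetI)
  fix z assume "z \<in> iso ` carrier A"
  then show "z \<in> carrier target"
    by (auto simp: iso_def direct_sum_algebra_def product_algebra_def module_mat_simps)
next
  fix z assume z: "z \<in> carrier target"
  obtain F G where FG: "z = (F, G)" by (cases z)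
  have F: "F \<in> {1..M - 1} \<rightarrow>\<^sub>E carrier_mat 2 2" and G: "G \<in> {1..4} \<rightarrow>\<^sub>E UNIV"
    using z unfolding FG by (auto simp: direct_sum_algebra_def product_algebra_def module_mat_simps)
  \<comment> \<open>The minimum with 4 repeats the last scalar in all blocks after M + 2, as
    \<open>block_algebra\<close> demands.\<close>
  define d where "d l = (if l < M - 1 then let B = F (Suc l) in
      M2 (B $$ (0, 0)) (B $$ (0, Suc 0)) (B $$ (Suc 0, 0)) (B $$ (Suc 0, Suc 0))
    else M2 (G (min (l + 2 - M) 4)) 0 0 (G (min (l + 2 - M) 4)))" for l
  have "d \<in> block_algebra M" by (rule block_algebraI) (auto simp: d_def)
  then obtain x where x: "x \<in> carrier A" "\<Phi> x = d" by (rule block_surj)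
  have "to_mat (d (i - 1)) = F i" if "i \<in> {1..M - 1}" for i
  proof -
    have "F i \<in> carrier_mat 2 2" using F that by (auto simp: PiE_iff)
    then show ?thesis using that to_mat_surj[of "F i"] by (auto simp: d_def Let_def)
  qed
  moreover have "e11 (d (M + i - 2)) = G i" if "i \<in> {1..4}" for i
  proof -
    have "\<not> M + i - 2 < M - 1" "min (M + i - 2 + 2 - M) 4 = i" using that M_pos by auto
    then show ?thesis unfolding d_def by (simp only: if_False m2.sel)
  qed
  ultimately have "(\<lambda>i\<in>{1..M - 1}. to_mat (d (i - 1))) = F" "(\<lambda>i\<in>{1..4}. e11 (d (M + i - 2))) = G"
    using F G by (auto simp: fun_eq_iff PiE_iff extensional_def restrict_def)
  then have "iso x = (F, G)" unfolding iso_def x by simp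
  then show "z \<in> iso ` carrier A" unfolding FG by (metis imageI x(1))
qed

lemma iso_split: "algebra_isomorphic ring_of_type_algebra A target"
proof -
  have comp: "\<Phi> (x \<otimes>\<^bsub>A\<^esub> y) l = \<Phi> x l * \<Phi> y l" "\<Phi> (x \<oplus>\<^bsub>A\<^esub> y) l = \<Phi> x l + \<Phi> y l"
    if "x \<in> carrier A" "y \<in> carrier A" for x y l
    using that by (simp_all add: emb_mult emb_add)
  have scalar: "e12 (\<Phi> x (M + i - 2)) = 0" if "x \<in> carrier A" "i \<ge> 1" for x i
    using block_algebraD(1)[OF emb_block[OF that(1)], of "M + i - 2"] that(2) M_pos by simp
  have "iso \<in> Ring.ring_hom A target"
  proof (rule ring_hom_memI)
    fix x y assume xy: "x \<in> carrier A" "y \<in> carrier A"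
    show "iso x \<in> carrier target" using xy iso_surj by blast
    show "iso (x \<otimes>\<^bsub>A\<^esub> y) = iso x \<otimes>\<^bsub>target\<^esub> iso y" "iso (x \<oplus>\<^bsub>A\<^esub> y) = iso x \<oplus>\<^bsub>target\<^esub> iso y"
      using xy scalar[OF xy(1)]
      by (auto simp: iso_def direct_sum_algebra_def product_algebra_def module_mat_simps comp to_mat_hom
          intro!: restrict_ext)
  next
    show "iso \<one>\<^bsub>A\<^esub> = \<one>\<^bsub>target\<^esub>"
      by (auto simp: iso_def direct_sum_algebra_def product_algebra_def module_mat_simps emb_one to_mat_hom
          intro!: restrict_ext)
  qed
  moreover have "iso (r \<odot>\<^bsub>A\<^esub> x) = r \<odot>\<^bsub>target\<^esub> iso x" if "x \<in> carrier A" for r x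
    using that by (auto simp: iso_def direct_sum_algebra_def product_algebra_def module_mat_simps emb_smult to_mat_hom(5)
        intro!: restrict_ext)
  ultimately show ?thesis
    unfolding algebra_isomorphic_def ring_iso_def using iso_inj iso_surj by (auto simp: bij_betw_def)
qed

subsection \<open>Simple components\<close>

definition blockset :: "nat \<Rightarrow> 'k blocks set" where
  "blockset l = {d \<in> block_algebra M. \<forall>l'. min l' (M + 2) \<noteq> l \<longrightarrow> d l' = 0}"

definition component :: "nat \<Rightarrow> 'a set" where
  "component l = {x \<in> carrier A. \<Phi> x \<in> blockset l}"

lemma block_zero: "0 \<in> block_algebra M"
  by (rule block_algebraI) auto

lemma block_uminus: "(d :: 'k blocks) \<in> block_algebra M \<Longrightarrow> - d \<in> block_algebra M"
  using sc.lspan_minus[of d I \<beta>] by (simp add: span)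

lemma blockset_closed:
  "0 \<in> blockset l" "d \<in> blockset l \<Longrightarrow> d' \<in> blockset l \<Longrightarrow> d + d' \<in> blockset l" "d \<in> blockset l \<Longrightarrow> - d \<in> blockset l"
  "d \<in> blockset l \<Longrightarrow> d' \<in> block_algebra M \<Longrightarrow> d * d' \<in> blockset l"
  "d \<in> blockset l \<Longrightarrow> d' \<in> block_algebra M \<Longrightarrow> d' * d \<in> blockset l"
  by (simp_all add: blockset_def block_zero block_algebra_add block_algebra_mult block_uminus)

lemma emb_uminus: assumes "x \<in> carrier A" shows "\<ominus>\<^bsub>A\<^esub> x \<in> carrier A" "\<Phi> (\<ominus>\<^bsub>A\<^esub> x) = - \<Phi> x"
proof -
  interpret ring A by (rule ring)
  show mem: "\<ominus>\<^bsub>A\<^esub> x \<in> carrier A" using assms by simp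
  have "\<Phi> x + \<Phi> (\<ominus>\<^bsub>A\<^esub> x) = 0"
    using emb_add[OF assms mem] r_neg[OF assms] emb_zero by simp
  then show "\<Phi> (\<ominus>\<^bsub>A\<^esub> x) = - \<Phi> x" by (simp add: eq_neg_iff_add_eq_0 add.commute)
qed

lemma component_ideal: "ideal (component l) A"
proof (rule idealI[OF ring])
  interpret ring A by (rule ring)
  show "subgroup (component l) (add_monoid A)"
  proof (rule add.subgroupI)
    show "component l \<noteq> {}" using zero_mem emb_zero blockset_closed(1) by (auto simp: component_def)
  qed (auto simp: component_def emb_uminus emb_add add_mem blockset_closed)
qed (auto simp: component_def emb_mult mult_mem blockset_closed emb_block)

lemma at_block_blockset: "l < M - 1 \<or> u = M2 (e11 u) 0 0 (e11 u) \<Longrightarrow> at_block M l u \<in> blockset l"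
  using at_block_mem[of l M u] by (auto simp: blockset_def at_block_def)

lemma blockset_at_block: assumes "d \<in> blockset l" "l \<le> M + 2" shows "d = at_block M l (d l)"
proof
  fix l'
  show "d l' = at_block M l (d l) l'"
    using assms block_algebra_min[of d M l'] by (auto simp: blockset_def at_block_def)
qed

text \<open>A nonzero element of \<open>J\<close> has a nonzero block l. Multiplying by elements
  supported on this block, simplicity of the block puts its unit e into \<open>J\<close>, and e is
  the identity on the whole component.\<close>

lemma ex_component_subset:
  assumes J: "ideal J A" "J \<noteq> {\<zero>\<^bsub>A\<^esub>}"
  shows "\<exists>l\<le>M + 2. component l \<subseteq> J"
proof -
  interpret ideal J A by (rule J(1))
  obtain x where x: "x \<in> J" "x \<noteq> \<zero>\<^bsub>A\<^esub>" using J(2) additive_subgroup.zero_closed[OF is_additive_subgroup] by auto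
  have xA: "x \<in> carrier A" using x(1) a_subset by auto
  have b: "\<Phi> x \<in> block_algebra M" by (rule emb_block[OF xA])
  have "\<Phi> x \<noteq> 0" using x(2) emb_eqI[OF xA zero_mem] emb_zero by auto
  then obtain l' where "\<Phi> x l' \<noteq> 0" by (auto simp: fun_eq_iff)
  then have "\<Phi> x (min l' (M + 2)) \<noteq> 0" using block_algebra_min[OF b] by simp
  moreover define l where "l = min l' (M + 2)"
  ultimately have l: "l \<le> M + 2" "\<Phi> x l \<noteq> 0" by simp_all
  have "\<exists>u v u' v'. u * \<Phi> x l * v + u' * \<Phi> x l * v' = 1 \<and>
      (\<forall>w\<in>{u, v, u', v'}. l < M - 1 \<or> w = M2 (e11 w) 0 0 (e11 w))"
  proof (cases "l < M - 1")
    case True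
    then show ?thesis using m2_simple[OF l(2)] by auto
  next
    case False
    then have *: "e12 (\<Phi> x l) = 0" "e21 (\<Phi> x l) = 0" "e22 (\<Phi> x l) = e11 (\<Phi> x l)"
      using block_algebraD[OF b, of l] by auto
    then have "e11 (\<Phi> x l) \<noteq> 0" using l(2) by (auto simp: m2_eq_iff)
    then show ?thesis
      by (intro exI[of _ "M2 (1 / e11 (\<Phi> x l)) 0 0 (1 / e11 (\<Phi> x l))"] exI[of _ 1] exI[of _ 0])
        (simp add: m2_eq_iff *)
  qed
  then obtain u v u' v' where uv: "u * \<Phi> x l * v + u' * \<Phi> x l * v' = 1"
    "\<And>w. w \<in> {u, v, u', v'} \<Longrightarrow> at_block M l w \<in> block_algebra M"
    by (meson at_block_mem)
  then obtain p q p' q' where pq: "p \<in> carrier A" "\<Phi> p = at_block M l u" "q \<in> carrier A" "\<Phi> q = at_block M l v"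
    "p' \<in> carrier A" "\<Phi> p' = at_block M l u'" "q' \<in> carrier A" "\<Phi> q' = at_block M l v'"
    by (metis block_surj insertCI)
  define e where "e = (p \<otimes>\<^bsub>A\<^esub> x \<otimes>\<^bsub>A\<^esub> q) \<oplus>\<^bsub>A\<^esub> (p' \<otimes>\<^bsub>A\<^esub> x \<otimes>\<^bsub>A\<^esub> q')"
  have e: "e \<in> J" using x(1) pq unfolding e_def by (intro additive_subgroup.a_closed[OF is_additive_subgroup] I_l_closed I_r_closed)
  have "\<Phi> e = at_block M l 1"
  proof
    fix m
    show "\<Phi> e m = at_block M l 1 m"
      using uv(1) block_algebra_min[OF b, of m] pq xA
      by (auto simp: e_def emb_add emb_mult mult_mem at_block_def)
  qed
  note \<Phi>e = this
  have eA: "e \<in> carrier A" using e a_subset by blast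
  have ey: "y = e \<otimes>\<^bsub>A\<^esub> y" if y: "y \<in> carrier A" "\<And>m. min m (M + 2) \<noteq> l \<Longrightarrow> \<Phi> y m = 0" for y
  proof (rule emb_eqI)
    show "\<Phi> y = \<Phi> (e \<otimes>\<^bsub>A\<^esub> y)"
    proof
      fix m
      show "\<Phi> y m = \<Phi> (e \<otimes>\<^bsub>A\<^esub> y) m"
        using y eA by (cases "min m (M + 2) = l") (simp_all add: emb_mult \<Phi>e at_block_def)
    qed
  qed (simp_all add: y(1) eA mult_mem)
  have "component l \<subseteq> J"
  proof
    fix y assume "y \<in> component l"
    then have y: "y \<in> carrier A" "\<And>m. min m (M + 2) \<noteq> l \<Longrightarrow> \<Phi> y m = 0"
      by (auto simp: component_def blockset_def)
    show "y \<in> J" using ey[OF y] I_r_closed[OF e y(1)] by simp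
  qed
  then show ?thesis using l(1) by blast
qed

lemma component_nonzero: "\<exists>x\<in>component l. \<Phi> x = at_block M l 1"
proof -
  have *: "at_block M l (1::'k m2) \<in> blockset l" by (rule at_block_blockset) (simp add: m2_eq_iff)
  then obtain x where "x \<in> carrier A" "\<Phi> x = at_block M l 1"
    using block_surj[of "at_block M l 1"] by (auto simp: blockset_def)
  then show ?thesis using * by (auto simp: component_def)
qed

lemma component_subset:
  assumes "component l \<subseteq> component m" "l \<le> M + 2" shows "l = m"
proof (rule ccontr)
  assume "l \<noteq> m"
  obtain x where "x \<in> component l" "\<Phi> x = at_block M l 1" using component_nonzero by blast
  then have "(at_block M l 1 :: 'k blocks) l = 0" using assms \<open>l \<noteq> m\<close> by (auto simp: component_def blockset_def subset_iff)
  then show False using assms(2) by (simp add: at_block_def)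
qed

lemma component_ne_zero: "l \<le> M + 2 \<Longrightarrow> component l \<noteq> {\<zero>\<^bsub>A\<^esub>}"
proof
  assume l: "l \<le> M + 2" "component l = {\<zero>\<^bsub>A\<^esub>}"
  then have "(at_block M l 1 :: 'k blocks) = 0" using component_nonzero[of l] emb_zero by auto
  then have "(at_block M l 1 :: 'k blocks) l = 0" by simp
  then show False using l(1) by (simp add: at_block_def)
qed

lemma simple_components_eq: "simple_components A = component ` {..M + 2}"
proof (intro equalityI subsetI)
  fix J assume "J \<in> simple_components A"
  then have J: "ideal J A" "J \<noteq> {\<zero>\<^bsub>A\<^esub>}" "\<And>J'. ideal J' A \<Longrightarrow> J' \<subseteq> J \<Longrightarrow> J' = {\<zero>\<^bsub>A\<^esub>} \<or> J' = J"
    by (auto simp: simple_components_def)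
  obtain l where "l \<le> M + 2" "component l \<subseteq> J" using ex_component_subset[OF J(1,2)] by blast
  then show "J \<in> component ` {..M + 2}"
    using J(3)[OF component_ideal[of l]] component_ne_zero[of l] by auto
next
  fix J assume "J \<in> component ` {..M + 2}"
  then obtain l where l: "l \<le> M + 2" "J = component l" by auto
  have "J' = {\<zero>\<^bsub>A\<^esub>} \<or> J' = J" if J': "ideal J' A" "J' \<subseteq> J" for J'
  proof (cases "J' = {\<zero>\<^bsub>A\<^esub>}")
    case False
    obtain m where "m \<le> M + 2" "component m \<subseteq> J'" using ex_component_subset[OF J'(1) False] by blast
    then show ?thesis using component_subset[of m l] J'(2) l(2) by blast
  qed simp
  then show "J \<in> simple_components A"
    using l component_ideal component_ne_zero by (simp add: simple_components_def)
qed

lemma component_inj: "inj_on component {..M + 2}"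
  by (rule inj_onI) (metis component_subset atMost_iff order_refl)

section \<open>Dimensions of the simple components\<close>

definition pre :: "'k blocks set \<Rightarrow> 'a set" where
  "pre S = {x \<in> carrier A. \<Phi> x \<in> S}"

abbreviation "scalars \<equiv> (\<lambda>c. c \<odot>\<^bsub>A\<^esub> \<one>\<^bsub>A\<^esub>) ` carrier (ring_of_type_algebra :: 'k ring)"

text \<open>The dimension predicate grows by adjoining one line at a time; this transfers such a
  step from \<open>A\<close> to the matrices.\<close>

lemma dimension_step:
  assumes "ring.dimension A n scalars (pre S)" "S \<subseteq> block_algebra M" "v \<in> block_algebra M" "v \<notin> S"
  shows "ring.dimension A (Suc n) scalars (pre {sc c * v + d | c d. d \<in> S})"
proof -
  interpret ring A by (rule ring)
  obtain x where x: "x \<in> carrier A" "\<Phi> x = v" using assms(3) by (rule block_surj)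
  have "line_extension scalars x (pre S) = pre {sc c * v + d | c d. d \<in> S}"
  proof (intro equalityI subsetI)
    fix y assume "y \<in> line_extension scalars x (pre S)"
    then obtain c u where "u \<in> pre S" "y = (c \<odot>\<^bsub>A\<^esub> \<one>\<^bsub>A\<^esub>) \<otimes>\<^bsub>A\<^esub> x \<oplus>\<^bsub>A\<^esub> u"
      by (auto simp: line_extension_mem_iff)
    then show "y \<in> pre {sc c * v + d | c d. d \<in> S}"
      using x by (auto simp: pre_def emb_add emb_mult emb_smult emb_one mult_mem add_mem smult_mem one_mem)
  next
    fix y assume "y \<in> pre {sc c * v + d | c d. d \<in> S}"
    then obtain c d where y: "y \<in> carrier A" "\<Phi> y = sc c * v + d" "d \<in> S" by (auto simp: pre_def)
    obtain u where u: "u \<in> carrier A" "\<Phi> u = d" using y(3) assms(2) block_surj by blast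
    have "y = (c \<odot>\<^bsub>A\<^esub> \<one>\<^bsub>A\<^esub>) \<otimes>\<^bsub>A\<^esub> x \<oplus>\<^bsub>A\<^esub> u"
      using x y u by (intro emb_eqI) (simp_all add: emb_add emb_mult emb_smult emb_one mult_mem add_mem smult_mem one_mem)
    then show "y \<in> line_extension scalars x (pre S)"
      using y u by (auto simp: line_extension_mem_iff pre_def)
  qed
  moreover have "x \<notin> pre S" using x assms(4) by (simp add: pre_def)
  ultimately show ?thesis using Suc_dim[OF x(1) _ assms(1)] by simp
qed

lemma dimension_zero: "ring.dimension A 0 scalars (pre {0})"
proof -
  interpret ring A by (rule ring)
  have "pre {0} = {\<zero>\<^bsub>A\<^esub>}"
    using emb_eqI[OF _ zero_mem] by (auto simp: pre_def zero_mem emb_zero)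
  then show ?thesis using zero_dim by simp
qed

text \<open>A matrix block is built from zero by adjoining E11, E12, E21 and E22 in this order, each
  outside the span of its predecessors; a scalar block needs only its unit.\<close>

lemma component_dimension:
  assumes l: "l \<le> M + 2"
  shows "subspace_dimension ring_of_type_algebra A (component l) (if l < M - 1 then 4 else 1)"
proof (cases "l < M - 1")
  case False
  let ?S = "{sc c * at_block M l 1 + d | c d. d \<in> {0 :: 'k blocks}}"
  have "at_block M l 1 \<in> block_algebra M" by (rule at_block_mem) (simp add: m2_eq_iff)
  moreover have "at_block M l 1 \<noteq> (0 :: 'k blocks)"
    using l by (auto simp: fun_eq_iff at_block_def intro!: exI[of _ l])
  ultimately have "ring.dimension A (Suc 0) scalars (pre ?S)"
    using block_zero by (intro dimension_step[OF dimension_zero]) auto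
  moreover have "?S = blockset l"
  proof (intro equalityI subsetI)
    fix d assume d: "d \<in> blockset l"
    then have "e12 (d l) = 0" "e21 (d l) = 0" "e22 (d l) = e11 (d l)"
      using False block_algebraD[of d M l] by (auto simp: blockset_def)
    then have "d = sc (e11 (d l)) * at_block M l 1 + 0"
      by (subst blockset_at_block[OF d l]) (auto simp: fun_eq_iff at_block_def m2_eq_iff)
    then show "d \<in> ?S" by blast
  next
    fix d assume "d \<in> ?S"
    then obtain c where "d = sc c * at_block M l 1" by auto
    then have "d = at_block M l (M2 c 0 0 c)" by (auto simp: fun_eq_iff at_block_def m2_eq_iff)
    then show "d \<in> blockset l" using at_block_blockset[of l "M2 c 0 0 c"] by simp
  qed
  moreover have "pre (blockset l) = component l" by (simp add: pre_def component_def)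
  ultimately show ?thesis using False unfolding subspace_dimension_def by simp
next
  case True
  have mem: "at_block M l u \<in> block_algebra M" for u :: "'k m2" using True by (intro at_block_mem) simp
  have eq: "at_block M l u = at_block M l v \<longleftrightarrow> u = v" for u v :: "'k m2"
  proof
    assume "at_block M l u = at_block M l v"
    from fun_cong[OF this, of l] show "u = v" using l by (simp add: at_block_def)
  qed simp
  have alg: "sc c * at_block M l u + at_block M l v = at_block M l (M2 c 0 0 c * u + v)" for c :: 'k and u v
    by (auto simp: fun_eq_iff at_block_def m2_eq_iff)
  let ?B = "\<lambda>P. {at_block M l u | u :: 'k m2. P u}"
  have step: "ring.dimension A (Suc n) scalars (pre (?B Q))"
    if dim: "ring.dimension A n scalars (pre (?B P))" and v: "\<not> P v"
      and Q: "\<And>u. Q u \<longleftrightarrow> (\<exists>c w. P w \<and> u = M2 c 0 0 c * v + w)" for n P Q v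
  proof -
    have seteq: "{sc c * at_block M l v + d | c d. d \<in> ?B P} = ?B Q"
    proof (intro equalityI subsetI)
      fix d assume "d \<in> ?B Q"
      then obtain u c w where "d = at_block M l u" "P w" "u = M2 c 0 0 c * v + w" using Q by auto
      then have "d = sc c * at_block M l v + at_block M l w" "at_block M l w \<in> ?B P" by (auto simp: alg)
      then show "d \<in> {sc c * at_block M l v + d | c d. d \<in> ?B P}" by blast
    next
      fix d assume "d \<in> {sc c * at_block M l v + d | c d. d \<in> ?B P}"
      then obtain c w where "d = at_block M l (M2 c 0 0 c * v + w)" "P w" by (auto simp: alg)
      then show "d \<in> ?B Q" using Q by blast
    qed
    have "at_block M l v \<notin> ?B P" using v by (auto simp: eq)
    moreover have "?B P \<subseteq> block_algebra M" using mem by blast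
    ultimately have "ring.dimension A (Suc n) scalars (pre {sc c * at_block M l v + d | c d. d \<in> ?B P})"
      using mem by (intro dimension_step[OF dim])
    then show ?thesis unfolding seteq .
  qed
  have "?B (\<lambda>u. u = 0) = {0}" by (auto simp: at_block_def fun_eq_iff)
  then have "ring.dimension A 0 scalars (pre (?B (\<lambda>u. u = 0)))" using dimension_zero by simp
  then have "ring.dimension A (Suc 0) scalars (pre (?B (\<lambda>u. e12 u = 0 \<and> e21 u = 0 \<and> e22 u = 0)))"
  proof (rule step[of _ _ "M2 1 0 0 0"])
    show "(e12 u = 0 \<and> e21 u = 0 \<and> e22 u = 0) = (\<exists>c w. w = 0 \<and> u = M2 c 0 0 c * M2 1 0 0 0 + w)" for u :: "'k m2"
      by (auto simp: m2_eq_iff intro!: exI[of _ "e11 u"] exI[of _ "0 :: 'k m2"])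
  qed (simp add: m2_eq_iff)
  then have "ring.dimension A (Suc (Suc 0)) scalars (pre (?B (\<lambda>u. e21 u = 0 \<and> e22 u = 0)))"
  proof (rule step[of _ _ "M2 0 1 0 0"])
    show "(e21 u = 0 \<and> e22 u = 0) = (\<exists>c w. (e12 w = 0 \<and> e21 w = 0 \<and> e22 w = 0) \<and> u = M2 c 0 0 c * M2 0 1 0 0 + w)" for u :: "'k m2"
      by (auto simp: m2_eq_iff intro!: exI[of _ "e12 u"] exI[of _ "M2 (e11 u) 0 0 0"])
  qed simp
  then have "ring.dimension A (Suc (Suc (Suc 0))) scalars (pre (?B (\<lambda>u. e22 u = 0)))"
  proof (rule step[of _ _ "M2 0 0 1 0"])
    show "(e22 u = 0) = (\<exists>c w. (e21 w = 0 \<and> e22 w = 0) \<and> u = M2 c 0 0 c * M2 0 0 1 0 + w)" for u :: "'k m2"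
      by (auto simp: m2_eq_iff intro!: exI[of _ "e21 u"] exI[of _ "M2 (e11 u) (e12 u) 0 0"])
  qed simp
  then have "ring.dimension A (Suc (Suc (Suc (Suc 0)))) scalars (pre (?B (\<lambda>u. True)))"
  proof (rule step[of _ _ "M2 0 0 0 1"])
    show "True = (\<exists>c w. e22 w = 0 \<and> u = M2 c 0 0 c * M2 0 0 0 1 + w)" for u :: "'k m2"
      by (auto simp: m2_eq_iff intro!: exI[of _ "e22 u"] exI[of _ "M2 (e11 u) (e12 u) (e21 u) 0"])
  qed simp
  moreover have "?B (\<lambda>u. True) = blockset l"
    using blockset_at_block[OF _ l] at_block_blockset True by auto
  moreover have "pre (blockset l) = component l" by (simp add: pre_def component_def)
  moreover have "Suc (Suc (Suc (Suc 0))) = 4" by simp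
  ultimately show ?thesis using True unfolding subspace_dimension_def by (simp only: if_True)
qed

end

lemma same_component_dimensions_full:
  assumes "full_emb A \<Phi> I \<beta> M" "full_emb B \<Psi> J \<gamma> M"
  shows "same_component_dimensions ring_of_type_algebra A ring_of_type_algebra B"
proof -
  interpret A: full_emb A \<Phi> I \<beta> M by (fact assms(1))
  interpret B: full_emb B \<Psi> J \<gamma> M by (fact assms(2))
  define f where "f = B.component \<circ> the_inv_into {..M + 2} A.component"
  have "bij_betw f (simple_components A) (simple_components B)"
    unfolding f_def A.simple_components_eq B.simple_components_eq
    by (rule bij_betw_trans[OF bij_betw_the_inv_into[OF inj_on_imp_bij_betw[OF A.component_inj]]
          inj_on_imp_bij_betw[OF B.component_inj]])
  moreover have "\<exists>d. subspace_dimension ring_of_type_algebra A J d \<and> subspace_dimension ring_of_type_algebra B (f J) d"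
    if J: "J \<in> simple_components A" for J
  proof -
    obtain l where l: "l \<le> M + 2" "J = A.component l" using J unfolding A.simple_components_eq by auto
    then have "f J = B.component l" using the_inv_into_f_f[OF A.component_inj, of l] by (simp add: f_def)
    then show ?thesis using A.component_dimension[OF l(1)] B.component_dimension[OF l(1)] l(2) by auto
  qed
  ultimately show ?thesis unfolding same_component_dimensions_def by blast
qed

section \<open>The quotient modulo \<open>t\<close>\<close>

lemma (in central_hom) lspan_reindex:
  assumes "bij_betw g J I" shows "lspan J (\<beta> \<circ> g) = lspan I \<beta>"
proof (intro equalityI subsetI)
  fix x assume "x \<in> lspan J (\<beta> \<circ> g)"
  then obtain c where "x = (\<Sum>j\<in>J. \<iota> (c j) * (\<beta> \<circ> g) j)" by (rule lspanE)
  also have "\<dots> = (\<Sum>j\<in>J. \<iota> (c (the_inv_into J g (g j))) * \<beta> (g j))"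
    using assms by (intro sum.cong) (auto simp: bij_betw_def the_inv_into_f_f)
  also have "\<dots> = (\<Sum>i\<in>I. \<iota> (c (the_inv_into J g i)) * \<beta> i)"
    by (rule sum.reindex_bij_betw[OF assms])
  finally show "x \<in> lspan I \<beta>" by (simp only: lspanI)
next
  fix x assume "x \<in> lspan I \<beta>"
  then obtain c where "x = (\<Sum>i\<in>I. \<iota> (c i) * \<beta> i)" by (rule lspanE)
  also have "\<dots> = (\<Sum>j\<in>J. \<iota> (c (g j)) * (\<beta> \<circ> g) j)"
    using sum.reindex_bij_betw[OF assms, of "\<lambda>i. \<iota> (c i) * \<beta> i"] by simp
  finally show "x \<in> lspan J (\<beta> \<circ> g)" by (simp only: lspanI)
qed

lemma (in central_hom) indep_reindex:
  assumes "bij_betw g J I" "indep I \<beta>" shows "indep J (\<beta> \<circ> g)"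
  unfolding indep_def
proof (intro allI impI ballI)
  fix c j assume c: "(\<Sum>j\<in>J. \<iota> (c j) * (\<beta> \<circ> g) j) = 0" and j: "j \<in> J"
  have "(\<Sum>i\<in>I. \<iota> (c (the_inv_into J g i)) * \<beta> i) = (\<Sum>j\<in>J. \<iota> (c (the_inv_into J g (g j))) * \<beta> (g j))"
    by (rule sum.reindex_bij_betw[OF assms(1), symmetric])
  also have "\<dots> = (\<Sum>j\<in>J. \<iota> (c j) * (\<beta> \<circ> g) j)"
    using assms(1) by (intro sum.cong) (auto simp: bij_betw_def the_inv_into_f_f)
  finally have "c (the_inv_into J g (g j)) = 0"
    using c assms j unfolding indep_def by (auto simp: bij_betw_def)
  then show "c j = 0" using assms(1) j by (simp add: bij_betw_def the_inv_into_f_f)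
qed

lemma (in central_hom) indep_inj:
  assumes "indep I \<beta>" "finite I" "i \<in> I" "j \<in> I" "\<beta> i = \<beta> j" "(1::'r) \<noteq> 0"
  shows "i = j"
proof (rule ccontr)
  assume ij: "i \<noteq> j"
  have delta: "(\<Sum>k\<in>I. \<iota> (if k = m then 1 else 0) * \<beta> k) = \<beta> m" if "m \<in> I" for m
  proof -
    have "(\<Sum>k\<in>I. \<iota> (if k = m then 1 else 0) * \<beta> k) = (\<Sum>k\<in>I. if k = m then \<beta> k else 0)"
      by (rule sum.cong) auto
    then show ?thesis using that assms(2) by simp
  qed
  have "(if i = i then 1 else 0 :: 'r) = (if i = j then 1 else 0)"
    by (rule indep_eq[OF assms(1) _ assms(3), of "\<lambda>k. if k = i then 1 else 0" "\<lambda>k. if k = j then 1 else 0"])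
      (simp only: delta assms)
  then show False using ij assms(6) by simp
qed

lemma (in fin_monoid) group_algebra_mult:
  fixes f g :: "'a \<Rightarrow>\<^sub>0 'k::comm_ring_1"
  assumes "Poly_Mapping.keys f \<subseteq> carrier G" "Poly_Mapping.keys g \<subseteq> carrier G"
  shows "f \<otimes>\<^bsub>group_algebra G\<^esub> g = (\<Sum>x\<in>carrier G. \<Sum>y\<in>carrier G.
    Poly_Mapping.single (x \<otimes> y) (Poly_Mapping.lookup f x * Poly_Mapping.lookup g y))"
proof -
  have "f \<otimes>\<^bsub>group_algebra G\<^esub> g = (\<Sum>x\<in>Poly_Mapping.keys f. \<Sum>y\<in>carrier G.
      Poly_Mapping.single (x \<otimes> y) (Poly_Mapping.lookup f x * Poly_Mapping.lookup g y))"
    unfolding group_algebra_def using assms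
    by (simp, intro sum.cong HOL.refl sum.mono_neutral_left finite_carrier) (auto simp: in_keys_iff)
  also have "\<dots> = (\<Sum>x\<in>carrier G. \<Sum>y\<in>carrier G.
    Poly_Mapping.single (x \<otimes> y) (Poly_Mapping.lookup f x * Poly_Mapping.lookup g y))"
    by (intro sum.mono_neutral_left finite_carrier assms) (auto simp: in_keys_iff)
  finally show ?thesis .
qed

lemma fps_eq_X_times: "fps_nth (f :: 'k::field fps) 0 = 0 \<Longrightarrow> f = fps_X * fps_shift 1 f"
  by (rule fps_ext) (auto simp: fps_X_mult_nth)

text \<open>The basis is indexed by the group but multiplicative only modulo t. This is enough for
  the quotient modulo t to be the group algebra, while \<open>\<Lambda>\<close> itself may multiply
  differently.\<close>

locale reduction = alg_emb \<iota> \<Lambda> \<Phi> "carrier G" \<beta> + fin_monoid G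
  for \<iota> :: "'k::field fps \<Rightarrow> 'd::ring_1" and \<Lambda> :: "('k fps, 'n) module" and \<Phi>
    and G :: "('g, 'm) monoid_scheme" (structure) and \<beta> +
  assumes independent: "indep (carrier G) \<beta>"
    and base_one: "\<beta> \<one> = 1"
    and base_mult: "x \<in> carrier G \<Longrightarrow> y \<in> carrier G \<Longrightarrow>
      \<exists>l\<in>lspan (carrier G) \<beta>. \<beta> x * \<beta> y = \<beta> (x \<otimes> y) + \<iota> fps_X * l"
begin

abbreviation "L \<equiv> lspan (carrier G) \<beta>"

definition co :: "'d \<Rightarrow> 'g \<Rightarrow> 'k fps" where
  "co d = (SOME c. d = (\<Sum>x\<in>carrier G. \<iota> (c x) * \<beta> x))"

lemma co: assumes "d \<in> L" shows "d = (\<Sum>x\<in>carrier G. \<iota> (co d x) * \<beta> x)"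
proof -
  obtain c where "d = (\<Sum>x\<in>carrier G. \<iota> (c x) * \<beta> x)" using assms by (rule lspanE)
  then show ?thesis unfolding co_def by (rule someI[where P="\<lambda>c. d = (\<Sum>x\<in>carrier G. \<iota> (c x) * \<beta> x)"])
qed

lemma co_eq: "d \<in> L \<Longrightarrow> d = (\<Sum>x\<in>carrier G. \<iota> (c x) * \<beta> x) \<Longrightarrow> x \<in> carrier G \<Longrightarrow> co d x = c x"
  by (rule indep_eq[OF independent HOL.trans[OF HOL.sym[OF co]]])

definition red :: "'d \<Rightarrow> 'g \<Rightarrow>\<^sub>0 'k" where
  "red d = (\<Sum>x\<in>carrier G. Poly_Mapping.single x (fps_nth (co d x) 0))"

lemma red_keys: "Poly_Mapping.keys (red d) \<subseteq> carrier G"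
  unfolding red_def by (rule order_trans[OF keys_sum]) (auto split: if_splits)

lemma red_lookup: "x \<in> carrier G \<Longrightarrow> Poly_Mapping.lookup (red d) x = fps_nth (co d x) 0"
  unfolding red_def using finite_carrier by (simp add: lookup_sum lookup_single when_def)

lemma red_eqI:
  assumes "d \<in> L" "d = (\<Sum>x\<in>carrier G. \<iota> (c x) * \<beta> x)"
  shows "red d = (\<Sum>x\<in>carrier G. Poly_Mapping.single x (fps_nth (c x) 0))"
  unfolding red_def by (rule sum.cong) (simp_all add: co_eq[OF assms])

lemma red_add: assumes "d \<in> L" "d' \<in> L" shows "red (d + d') = red d + red d'"
proof -
  have "d + d' = (\<Sum>x\<in>carrier G. \<iota> (co d x) * \<beta> x) + (\<Sum>x\<in>carrier G. \<iota> (co d' x) * \<beta> x)"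
    by (rule arg_cong2[where f="(+)", OF co[OF assms(1)] co[OF assms(2)]])
  also have "\<dots> = (\<Sum>x\<in>carrier G. \<iota> (co d x + co d' x) * \<beta> x)"
    by (simp add: map_add distrib_right sum.distrib)
  finally have "d + d' = (\<Sum>x\<in>carrier G. \<iota> (co d x + co d' x) * \<beta> x)" .
  from red_eqI[OF lspan_add[OF assms] this] show ?thesis
    by (simp add: red_def single_add sum.distrib)
qed

lemma red_scale: assumes "d \<in> L" shows "red (\<iota> r * d) = Poly_Mapping.map ((*) (fps_nth r 0)) (red d)"
proof (rule poly_mapping_eqI)
  fix x
  have "\<iota> r * d = \<iota> r * (\<Sum>x\<in>carrier G. \<iota> (co d x) * \<beta> x)"
    by (rule arg_cong[OF co[OF assms]])
  also have "\<dots> = (\<Sum>x\<in>carrier G. \<iota> (r * co d x) * \<beta> x)"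
    by (simp add: map_mult sum_distrib_left mult.assoc)
  finally have *: "x \<in> carrier G \<Longrightarrow> co (\<iota> r * d) x = r * co d x"
    by (intro co_eq lspan_scale assms)
  show "Poly_Mapping.lookup (red (\<iota> r * d)) x = Poly_Mapping.lookup (Poly_Mapping.map ((*) (fps_nth r 0)) (red d)) x"
  proof (cases "x \<in> carrier G")
    case True
    then show ?thesis by (simp add: red_lookup * lookup_map_mult)
  next
    case False
    then have "Poly_Mapping.lookup (red d') x = 0" for d' using red_keys by (meson in_keys_iff subsetD)
    then show ?thesis by (simp add: lookup_map_mult)
  qed
qed

lemma red_zero: "red 0 = 0"
  using red_add[OF lspan_zero lspan_zero] by simp

lemma red_sum: "(\<And>k. k \<in> K \<Longrightarrow> f k \<in> L) \<Longrightarrow> red (sum f K) = (\<Sum>k\<in>K. red (f k))"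
  by (induction K rule: infinite_finite_induct) (auto simp: red_zero red_add lspan_sum)

lemma base_L: "x \<in> carrier G \<Longrightarrow> \<beta> x \<in> L"
  by (rule lspan_base[OF finite_carrier])

lemma red_base: assumes "x \<in> carrier G" shows "red (\<iota> r * \<beta> x) = Poly_Mapping.single x (fps_nth r 0)"
proof -
  have "\<iota> r * \<beta> x = (\<Sum>y\<in>carrier G. if y = x then \<iota> r * \<beta> y else 0)" using assms finite_carrier by simp
  also have "\<dots> = (\<Sum>y\<in>carrier G. \<iota> (if y = x then r else 0) * \<beta> y)" by (rule sum.cong) auto
  finally have "red (\<iota> r * \<beta> x) = (\<Sum>y\<in>carrier G. Poly_Mapping.single y (fps_nth (if y = x then r else 0) 0))"
    by (rule red_eqI[OF lspan_scale[OF base_L[OF assms]]])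
  also have "\<dots> = (\<Sum>y\<in>carrier G. if y = x then Poly_Mapping.single y (fps_nth r 0) else 0)"
    by (rule sum.cong) auto
  finally show ?thesis using assms finite_carrier by simp
qed

lemma red_X: "d \<in> L \<Longrightarrow> red (\<iota> fps_X * d) = 0"
  by (rule poly_mapping_eqI) (simp add: red_scale lookup_map_mult)

lemma L_mult: "d \<in> L \<Longrightarrow> d' \<in> L \<Longrightarrow> d * d' \<in> L"
  by (metis emb_surj emb_mult emb_mem mult_mem)

text \<open>For two basis elements the deviation from the group product is a multiple of t and is
  killed by \<open>red_X\<close>; the rest is bilinearity, as constant terms of power series
  multiply.\<close>

lemma red_mult: assumes "d \<in> L" "d' \<in> L" shows "red (d * d') = red d \<otimes>\<^bsub>group_algebra G\<^esub> red d'"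
proof -
  have central2: "\<iota> p * b * (\<iota> q * b') = \<iota> (p * q) * (b * b')" for p q b b'
    by (metis map_mult central mult.assoc)
  have mono: "red (\<iota> r * (\<beta> x * \<beta> y)) = Poly_Mapping.single (x \<otimes> y) (fps_nth r 0)"
    if xy: "x \<in> carrier G" "y \<in> carrier G" for x y r
  proof -
    obtain l where l: "l \<in> L" "\<beta> x * \<beta> y = \<beta> (x \<otimes> y) + \<iota> fps_X * l" using base_mult[OF xy] by blast
    have "\<iota> r * (\<beta> x * \<beta> y) = \<iota> r * \<beta> (x \<otimes> y) + \<iota> fps_X * (\<iota> r * l)"
      by (metis l(2) distrib_left central mult.assoc)
    then show ?thesis
      using xy l(1) by (simp add: red_add red_X lspan_scale base_L red_base)
  qed
  have "d * d' = (\<Sum>x\<in>carrier G. \<iota> (co d x) * \<beta> x) * (\<Sum>x\<in>carrier G. \<iota> (co d' x) * \<beta> x)"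
    by (rule arg_cong2[where f="(*)", OF co[OF assms(1)] co[OF assms(2)]])
  also have "\<dots> = (\<Sum>x\<in>carrier G. \<Sum>y\<in>carrier G. \<iota> (co d x * co d' y) * (\<beta> x * \<beta> y))"
    by (simp only: sum_product central2)
  finally have "red (d * d') = (\<Sum>x\<in>carrier G. \<Sum>y\<in>carrier G. Poly_Mapping.single (x \<otimes> y) (fps_nth (co d x * co d' y) 0))"
    by (simp add: red_sum lspan_sum lspan_scale L_mult base_L mono)
  also have "\<dots> = red d \<otimes>\<^bsub>group_algebra G\<^esub> red d'"
    unfolding group_algebra_mult[OF red_keys red_keys] by (intro sum.cong) (simp_all add: red_lookup fps_mult_nth_0)
  finally show ?thesis .
qed

section \<open>Reduction modulo t as a surjective algebra map and its kernel\<close>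

definition \<pi> :: "'n \<Rightarrow> 'g \<Rightarrow>\<^sub>0 'k" where
  "\<pi> x = red (\<Phi> x)"

lemma \<pi>_simps:
  "x \<in> carrier \<Lambda> \<Longrightarrow> \<pi> x \<in> carrier (group_algebra G)"
  "x \<in> carrier \<Lambda> \<Longrightarrow> y \<in> carrier \<Lambda> \<Longrightarrow> \<pi> (x \<oplus>\<^bsub>\<Lambda>\<^esub> y) = \<pi> x + \<pi> y"
  "x \<in> carrier \<Lambda> \<Longrightarrow> y \<in> carrier \<Lambda> \<Longrightarrow> \<pi> (x \<otimes>\<^bsub>\<Lambda>\<^esub> y) = \<pi> x \<otimes>\<^bsub>group_algebra G\<^esub> \<pi> y"
  "x \<in> carrier \<Lambda> \<Longrightarrow> \<pi> (r \<odot>\<^bsub>\<Lambda>\<^esub> x) = Poly_Mapping.map ((*) (fps_nth r 0)) (\<pi> x)"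
  "\<pi> \<one>\<^bsub>\<Lambda>\<^esub> = \<one>\<^bsub>group_algebra G\<^esub>" "\<pi> \<zero>\<^bsub>\<Lambda>\<^esub> = 0"
  using red_base[of "\<one>" 1]
  by (simp_all add: \<pi>_def group_algebra_simps red_keys emb_add red_add emb_mem emb_mult red_mult emb_smult red_scale
      emb_one emb_zero red_zero base_one)

lemma \<pi>_surj: assumes "f \<in> carrier (group_algebra G)" obtains x where "x \<in> carrier \<Lambda>" "\<pi> x = f"
proof -
  let ?d = "\<Sum>x\<in>carrier G. \<iota> (fps_const (Poly_Mapping.lookup f x)) * \<beta> x"
  obtain x where x: "x \<in> carrier \<Lambda>" "\<Phi> x = ?d" using emb_surj[OF lspanI] .
  have "\<pi> x = (\<Sum>x\<in>carrier G. Poly_Mapping.single x (Poly_Mapping.lookup f x))"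
    unfolding \<pi>_def x(2) by (subst red_eqI[OF lspanI HOL.refl]) simp
  also have "\<dots> = f"
  proof (rule poly_mapping_eqI)
    fix y
    show "Poly_Mapping.lookup (\<Sum>x\<in>carrier G. Poly_Mapping.single x (Poly_Mapping.lookup f x)) y = Poly_Mapping.lookup f y"
      using assms finite_carrier
      by (cases "y \<in> carrier G") (auto simp: lookup_sum lookup_single when_def group_algebra_simps in_keys_iff subset_iff)
  qed
  finally show thesis using that x(1) by blast
qed

definition J :: "'n set" where
  "J = {x \<in> carrier \<Lambda>. \<pi> x = 0}"

lemma uminus_mem: "x \<in> carrier \<Lambda> \<Longrightarrow> \<ominus>\<^bsub>\<Lambda>\<^esub> x \<in> carrier \<Lambda>"
  and \<pi>_uminus: "x \<in> carrier \<Lambda> \<Longrightarrow> \<pi> (\<ominus>\<^bsub>\<Lambda>\<^esub> x) = - \<pi> x"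
proof -
  interpret \<Lambda>: ring \<Lambda> by (rule ring)
  assume x: "x \<in> carrier \<Lambda>"
  then show *: "\<ominus>\<^bsub>\<Lambda>\<^esub> x \<in> carrier \<Lambda>" by simp
  have "\<pi> x + \<pi> (\<ominus>\<^bsub>\<Lambda>\<^esub> x) = 0"
    using \<pi>_simps(2)[OF x *] \<Lambda>.r_neg[OF x] \<pi>_simps(6) by simp
  then show "\<pi> (\<ominus>\<^bsub>\<Lambda>\<^esub> x) = - \<pi> x" by (simp add: eq_neg_iff_add_eq_0 add.commute)
qed

lemma zero_mult: "(0 :: 'g \<Rightarrow>\<^sub>0 'k) \<otimes>\<^bsub>group_algebra G\<^esub> f = 0" "f \<otimes>\<^bsub>group_algebra G\<^esub> (0 :: 'g \<Rightarrow>\<^sub>0 'k) = 0"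
  by (simp_all add: group_algebra_def)

lemma ideal_J: "ideal J \<Lambda>"
proof (rule idealI[OF ring])
  interpret \<Lambda>: ring \<Lambda> by (rule ring)
  show "subgroup J (add_monoid \<Lambda>)"
  proof (rule \<Lambda>.add.subgroupI)
    show "J \<noteq> {}" using zero_mem \<pi>_simps(6) by (auto simp: J_def)
  qed (auto simp: J_def uminus_mem \<pi>_uminus \<pi>_simps(2) add_mem)
qed (auto simp: J_def \<pi>_simps(3) mult_mem zero_mult)

text \<open>A power series without constant term is t times its shift. Applied to coordinates, this
  writes every element of \<open>J\<close> as t times an element of
  \<open>\<Lambda>\<close>.\<close>

lemma J_eq: "J = Idl\<^bsub>\<Lambda>\<^esub> {fps_X \<odot>\<^bsub>\<Lambda>\<^esub> x | x. x \<in> carrier \<Lambda>}"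
proof (intro equalityI subsetI)
  interpret \<Lambda>: ring \<Lambda> by (rule ring)
  have sub: "{fps_X \<odot>\<^bsub>\<Lambda>\<^esub> x | x. x \<in> carrier \<Lambda>} \<subseteq> carrier \<Lambda>" by (auto simp: smult_mem)
  {
    fix x assume "x \<in> J"
    then have x: "x \<in> carrier \<Lambda>" "\<pi> x = 0" by (auto simp: J_def)
    have "fps_nth (co (\<Phi> x) y) 0 = 0" if "y \<in> carrier G" for y
      using red_lookup[OF that, of "\<Phi> x"] x(2) by (simp add: \<pi>_def)
    then have "(\<Sum>y\<in>carrier G. \<iota> (co (\<Phi> x) y) * \<beta> y) =
        (\<Sum>y\<in>carrier G. \<iota> (fps_X * fps_shift 1 (co (\<Phi> x) y)) * \<beta> y)"
      by (intro sum.cong HOL.refl) (simp only: fps_eq_X_times[symmetric])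
    with co[OF emb_mem[OF x(1)]] have "\<Phi> x = (\<Sum>y\<in>carrier G. \<iota> (fps_X * fps_shift 1 (co (\<Phi> x) y)) * \<beta> y)"
      by (rule HOL.trans)
    also have "\<dots> = \<iota> fps_X * (\<Sum>y\<in>carrier G. \<iota> (fps_shift 1 (co (\<Phi> x) y)) * \<beta> y)"
      by (simp add: map_mult sum_distrib_left mult.assoc)
    finally have "\<Phi> x = \<iota> fps_X * (\<Sum>y\<in>carrier G. \<iota> (fps_shift 1 (co (\<Phi> x) y)) * \<beta> y)" .
    moreover obtain x' where "x' \<in> carrier \<Lambda>" "\<Phi> x' = (\<Sum>y\<in>carrier G. \<iota> (fps_shift 1 (co (\<Phi> x) y)) * \<beta> y)"
      using emb_surj[OF lspanI] .
    ultimately have "x = fps_X \<odot>\<^bsub>\<Lambda>\<^esub> x'" "x' \<in> carrier \<Lambda>"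
      using x(1) by (auto intro!: emb_eqI simp: smult_mem emb_smult)
    then show "x \<in> Idl\<^bsub>\<Lambda>\<^esub> {fps_X \<odot>\<^bsub>\<Lambda>\<^esub> x | x. x \<in> carrier \<Lambda>}"
      using \<Lambda>.genideal_self[OF sub] by blast
  }
  have "{fps_X \<odot>\<^bsub>\<Lambda>\<^esub> x | x. x \<in> carrier \<Lambda>} \<subseteq> J"
    by (auto simp: J_def smult_mem \<pi>_def emb_smult red_X emb_mem)
  then have "Idl\<^bsub>\<Lambda>\<^esub> {fps_X \<odot>\<^bsub>\<Lambda>\<^esub> x | x. x \<in> carrier \<Lambda>} \<subseteq> J"
    by (rule \<Lambda>.genideal_minimal[OF ideal_J])
  then show "x \<in> J" if "x \<in> Idl\<^bsub>\<Lambda>\<^esub> {fps_X \<odot>\<^bsub>\<Lambda>\<^esub> x | x. x \<in> carrier \<Lambda>}" for x using that by blast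
qed

lemma coset: assumes "x \<in> carrier \<Lambda>" shows "J +>\<^bsub>\<Lambda>\<^esub> x = {y \<in> carrier \<Lambda>. \<pi> y = \<pi> x}"
proof (intro equalityI subsetI)
  interpret \<Lambda>: ring \<Lambda> by (rule ring)
  fix y assume "y \<in> J +>\<^bsub>\<Lambda>\<^esub> x"
  then obtain j where "j \<in> J" "y = j \<oplus>\<^bsub>\<Lambda>\<^esub> x" by (auto simp: a_r_coset_def' )
  then show "y \<in> {y \<in> carrier \<Lambda>. \<pi> y = \<pi> x}" using assms by (auto simp: J_def add_mem \<pi>_simps(2))
next
  interpret \<Lambda>: ring \<Lambda> by (rule ring)
  fix y assume y: "y \<in> {y \<in> carrier \<Lambda>. \<pi> y = \<pi> x}"
  let ?j = "y \<oplus>\<^bsub>\<Lambda>\<^esub> (\<ominus>\<^bsub>\<Lambda>\<^esub> x)"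
  have "?j \<in> J" using y assms by (simp add: J_def add_mem uminus_mem \<pi>_simps(2) \<pi>_uminus)
  moreover have "y = ?j \<oplus>\<^bsub>\<Lambda>\<^esub> x" using y assms by (simp add: \<Lambda>.a_assoc \<Lambda>.l_neg)
  ultimately show "y \<in> J +>\<^bsub>\<Lambda>\<^esub> x" by (auto simp: a_r_coset_def')
qed

lemma quotient_iso:
  "algebra_isomorphic ring_of_type_algebra (group_algebra G)
     (restrict_scalars fps_const (quotient_algebra \<Lambda> (Idl\<^bsub>\<Lambda>\<^esub> {fps_X \<odot>\<^bsub>\<Lambda>\<^esub> x | x. x \<in> carrier \<Lambda>})))"
proof -
  interpret J: ideal J \<Lambda> by (rule ideal_J)
  let ?Q = "restrict_scalars fps_const (quotient_algebra \<Lambda> J)"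
  \<comment> \<open>Any lift of \<open>f\<close> would do, since two lifts differ by an element of
    \<open>J\<close>.\<close>
  define h where "h f = J +>\<^bsub>\<Lambda>\<^esub> (SOME x. x \<in> carrier \<Lambda> \<and> \<pi> x = f)" for f
  have h: "h (\<pi> x) = J +>\<^bsub>\<Lambda>\<^esub> x" if "x \<in> carrier \<Lambda>" for x
  proof -
    have "(SOME y. y \<in> carrier \<Lambda> \<and> \<pi> y = \<pi> x) \<in> carrier \<Lambda> \<and> \<pi> (SOME y. y \<in> carrier \<Lambda> \<and> \<pi> y = \<pi> x) = \<pi> x"
      by (rule someI[of _ x]) (use that in simp)
    then show ?thesis unfolding h_def using that by (simp add: coset)
  qed
  have Q: "carrier ?Q = {J +>\<^bsub>\<Lambda>\<^esub> x | x. x \<in> carrier \<Lambda>}"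
    by (auto simp: restrict_scalars_def quotient_algebra_def FactRing_def A_RCOSETS_def')
  have "h \<in> Ring.ring_hom (group_algebra G) ?Q"
  proof (rule ring_hom_memI)
    fix f g :: "'g \<Rightarrow>\<^sub>0 'k" assume "f \<in> carrier (group_algebra G)" "g \<in> carrier (group_algebra G)"
    then obtain x y where x: "x \<in> carrier \<Lambda>" "\<pi> x = f" and y: "y \<in> carrier \<Lambda>" "\<pi> y = g" by (metis \<pi>_surj)
    show "h f \<in> carrier ?Q" using h[OF x(1)] x Q by auto
    show "h (f \<otimes>\<^bsub>group_algebra G\<^esub> g) = h f \<otimes>\<^bsub>?Q\<^esub> h g"
      using h[OF x(1)] h[OF y(1)] h[OF mult_mem[OF x(1) y(1)]] J.rcoset_mult_add[OF x(1) y(1)] x y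
      by (simp add: \<pi>_simps(3) restrict_scalars_def quotient_algebra_def FactRing_def)
    show "h (f \<oplus>\<^bsub>group_algebra G\<^esub> g) = h f \<oplus>\<^bsub>?Q\<^esub> h g"
      using h[OF x(1)] h[OF y(1)] h[OF add_mem[OF x(1) y(1)]] J.a_rcos_sum[OF x(1) y(1)] x y
      by (simp add: \<pi>_simps(2) restrict_scalars_def quotient_algebra_def FactRing_def group_algebra_simps(4))
  next
    show "h \<one>\<^bsub>group_algebra G\<^esub> = \<one>\<^bsub>?Q\<^esub>"
      using h[OF one_mem] by (simp add: \<pi>_simps(5) restrict_scalars_def quotient_algebra_def FactRing_def)
  qed
  moreover have "inj_on h (carrier (group_algebra G))"
  proof (rule inj_onI)
    fix f g :: "'g \<Rightarrow>\<^sub>0 'k" assume fg: "f \<in> carrier (group_algebra G)" "g \<in> carrier (group_algebra G)" "h f = h g"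
    then obtain x y where x: "x \<in> carrier \<Lambda>" "\<pi> x = f" and y: "y \<in> carrier \<Lambda>" "\<pi> y = g" by (metis \<pi>_surj)
    then have "J +>\<^bsub>\<Lambda>\<^esub> x = J +>\<^bsub>\<Lambda>\<^esub> y" using h fg(3) by metis
    then show "f = g" using x y by (auto simp: coset)
  qed
  moreover have "h ` carrier (group_algebra G) = carrier ?Q"
  proof (intro equalityI subsetI)
    fix C assume "C \<in> carrier ?Q"
    then obtain x where "x \<in> carrier \<Lambda>" "C = J +>\<^bsub>\<Lambda>\<^esub> x" unfolding Q by auto
    then show "C \<in> h ` carrier (group_algebra G)"
      using h \<pi>_simps(1) by (intro image_eqI[of _ _ "\<pi> x"]) simp_all
  next
    fix C assume "C \<in> h ` carrier (group_algebra G)"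
    then obtain f where f: "f \<in> carrier (group_algebra G)" "C = h f" by blast
    obtain x where "x \<in> carrier \<Lambda>" "\<pi> x = f" using \<pi>_surj[OF f(1)] .
    then show "C \<in> carrier ?Q" unfolding Q f(2) using h by blast
  qed
  moreover have "h (r \<odot>\<^bsub>group_algebra G\<^esub> f) = r \<odot>\<^bsub>?Q\<^esub> h f" if f: "f \<in> carrier (group_algebra G)" for r f
  proof -
    obtain x where x: "x \<in> carrier \<Lambda>" "\<pi> x = f" using \<pi>_surj[OF f] .
    let ?r = "fps_const r"
    have \<pi>r: "\<pi> (?r \<odot>\<^bsub>\<Lambda>\<^esub> y) = r \<odot>\<^bsub>group_algebra G\<^esub> \<pi> y" if "y \<in> carrier \<Lambda>" for y
      using that by (simp add: \<pi>_simps(4) group_algebra_simps)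
    have "J +>\<^bsub>\<Lambda>\<^esub> (?r \<odot>\<^bsub>\<Lambda>\<^esub> y) = J +>\<^bsub>\<Lambda>\<^esub> (?r \<odot>\<^bsub>\<Lambda>\<^esub> x)" if "y \<in> J +>\<^bsub>\<Lambda>\<^esub> x" for y
      using that x(1) by (simp add: coset smult_mem \<pi>r)
    moreover have "x \<in> J +>\<^bsub>\<Lambda>\<^esub> x" using x(1) by (simp add: coset)
    ultimately have "(\<Union>y\<in>J +>\<^bsub>\<Lambda>\<^esub> x. J +>\<^bsub>\<Lambda>\<^esub> (?r \<odot>\<^bsub>\<Lambda>\<^esub> y)) = J +>\<^bsub>\<Lambda>\<^esub> (?r \<odot>\<^bsub>\<Lambda>\<^esub> x)" by blast
    then show ?thesis
      using h[OF x(1)] h[OF smult_mem[OF x(1)], of ?r] x \<pi>r[OF x(1)] by (simp add: restrict_scalars_def quotient_algebra_def)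
  qed
  ultimately show ?thesis
    unfolding algebra_isomorphic_def ring_iso_def J_eq[symmetric]
    by (intro bexI[of _ h]) (auto simp: bij_betw_def)
qed

end

section \<open>The complex group algebra\<close>

lemma diag_power: "M2 p 0 0 q ^ n = M2 (p ^ n) 0 0 (q ^ n)" for p q :: "'k::comm_ring_1"
  by (induction n) (simp_all add: m2_eq_iff)

text \<open>Here x has the 2 M-th roots of unity as eigenvalues. A pair of distinct inverse roots
  gives a matrix block with y^2 = x^M. The self-inverse values 1 and -1 give scalar blocks, where y
  is 1 or -1 because x^M = 1 for even M.\<close>

lemma complex_quaternion_model:
  assumes M: "M \<ge> 2" "even M"
  obtains \<phi> :: "quaternion_gen \<times> bool \<Rightarrow> complex blocks"
  where "sc.indep ({..<2 * M} \<times> {..<2}) (\<lambda>p. weval \<phi> (nform p))"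
    "sc.lspan ({..<2 * M} \<times> {..<2}) (\<lambda>p. weval \<phi> (nform p)) = block_algebra M"
    "\<And>u v. presentation_eq (quat_rels M) u v \<Longrightarrow> weval \<phi> u = weval \<phi> v"
proof -
  define \<zeta> where "\<zeta> i = cis (2 * pi * real i / real (2 * M))" for i
  have \<zeta>_inj: "i = j" if "\<zeta> i = \<zeta> j" "i < 2 * M" "j < 2 * M" for i j
    using bij_betw_roots_unity[of "2 * M"] M(1) that by (auto simp: bij_betw_def inj_on_def \<zeta>_def)
  have \<zeta>_mult: "\<zeta> i * \<zeta> j = \<zeta> (i + j)" for i j
    by (simp add: \<zeta>_def cis_mult add_divide_distrib distrib_left)
  have \<zeta>_0: "\<zeta> 0 = 1" by (simp add: \<zeta>_def)
  have \<zeta>_M: "\<zeta> M = -1" using M(1) by (simp add: \<zeta>_def)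
  have \<zeta>_2M: "\<zeta> (2 * M) = 1" using \<zeta>_mult[of M M] \<zeta>_M by (simp add: mult_2)
  have \<zeta>_order: "\<zeta> i ^ (2 * M) = 1" for i
  proof -
    have "real (2 * M) * (2 * pi * real i / real (2 * M)) = 2 * pi * real i" using M(1) by simp
    then show ?thesis unfolding \<zeta>_def DeMoivre by (simp only: cis_multiple_2pi Ints_of_nat)
  qed
  \<comment> \<open>The exponents l + 1 and 2 M - 1 - l add up to 2 M, so for l < M - 1 the two
    values are inverse to each other; the last index holds 1 and -1.\<close>
  define a where "a l = (if l < M - 1 then \<zeta> (l + 1) else \<zeta> 0)" for l
  define b where "b l = (if l < M - 1 then \<zeta> (2 * M - 1 - l) else \<zeta> M)" for l
  define f where "f l = a l ^ M" for l
  define r where "r = (\<lambda>i::nat. if even i then 1 else -1 :: complex)"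
  have nz: "\<zeta> i \<noteq> 0" for i by (simp add: \<zeta>_def)
  interpret block_model M a b f r
  proof
    show "l = m" if "l < M" "m < M" "a l = a m" for l m
      using that \<zeta>_inj[of "if l < M - 1 then l + 1 else 0" "if m < M - 1 then m + 1 else 0"]
      by (auto simp: a_def split: if_splits)
    show "l = m" if "l < M" "m < M" "b l = b m" for l m
      using that \<zeta>_inj[of "if l < M - 1 then 2 * M - 1 - l else M" "if m < M - 1 then 2 * M - 1 - m else M"]
      by (auto simp: b_def split: if_splits)
    show "a l \<noteq> b m" if "l < M" "m < M" for l m
      using that \<zeta>_inj[of "if l < M - 1 then l + 1 else 0" "if m < M - 1 then 2 * M - 1 - m else M"]
      by (auto simp: a_def b_def split: if_splits)
  qed (use M nz in \<open>auto simp: f_def a_def r_def\<close>)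
  have pair: "a l * b l = 1" "a l ^ (2 * M) = 1" "b l ^ (2 * M) = 1" if "l < M - 1" for l
    using that \<zeta>_order \<zeta>_2M by (auto simp: a_def b_def \<zeta>_mult)
  have pair_inv: "a l ^ (2 * M - 1) = b l" "b l ^ (2 * M - 1) = a l" "b l ^ M = a l ^ M" if l: "l < M - 1" for l
  proof -
    have *: "x ^ (2 * M) = x * x ^ (2 * M - 1)" for x :: complex using M(1) by (cases M) auto
    show "a l ^ (2 * M - 1) = b l" "b l ^ (2 * M - 1) = a l"
      using pair[OF l] * by (metis mult.assoc mult.commute mult.right_neutral)+
    have "b l ^ M = b l ^ M * (a l ^ M * a l ^ M)"
      using pair(2)[OF l] by (simp add: mult_2 power_add)
    also have "\<dots> = (a l * b l) ^ M * a l ^ M" by (simp add: power_mult_distrib)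
    finally show "b l ^ M = a l ^ M" using pair(1)[OF l] by simp
  qed
  have e: "e l ^ M = 1" "e l ^ (2 * M - 1) = e l" for l
  proof -
    have "e l = 1 \<or> e l = -1" by (auto simp: e_def a_def b_def \<zeta>_0 \<zeta>_M)
    moreover have "odd (2 * M - 1)" using M(1) by simp
    ultimately show "e l ^ M = 1" "e l ^ (2 * M - 1) = e l" using M(2) by auto
  qed
  have rr: "rr l * rr l = 1" for l unfolding rr_def by (simp add: r_def)
  have x_power: "xx ^ n = (\<lambda>l. if l < M - 1 then M2 (a l ^ n) 0 0 (b l ^ n) else M2 (e l ^ n) 0 0 (e l ^ n))" for n
    by (rule ext) (simp add: xx_def diag_power)
  have e2: "e l ^ (2 * M) = 1" for l using e(1)[of l] by (simp add: mult_2 power_add)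
  have x_order: "xx ^ (2 * M) = 1"
    unfolding x_power using pair(2,3) e2 by (auto simp: fun_eq_iff m2_eq_iff)
  have yy: "yy * yy = xx ^ M"
    unfolding x_power using pair_inv(3) e(1) rr by (auto simp: fun_eq_iff m2_eq_iff yy_def f_def)
  have yx: "yy * xx = xx ^ (2 * M - 1) * yy"
    unfolding x_power using pair_inv(1,2) e(2) by (auto simp: fun_eq_iff m2_eq_iff yy_def xx_def)
  have inv: "xx * xx ^ (2 * M - 1) = 1" "xx ^ (2 * M - 1) * xx = 1"
  proof -
    have "Suc (2 * M - 1) = 2 * M" using M(1) by simp
    then have "xx ^ Suc (2 * M - 1) = 1" using x_order by (simp only:)
    then show "xx * xx ^ (2 * M - 1) = 1" "xx ^ (2 * M - 1) * xx = 1"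
      by (simp_all only: power_Suc power_commutes)
  qed
  have y4: "yy * yy * (yy * yy) = 1" unfolding yy using x_order by (simp add: mult_2 power_add)
  define \<phi> where "\<phi> = (\<lambda>(g, b). case g of Sigma_gen \<Rightarrow> if b then xx else xx ^ (2 * M - 1)
    | Tau_gen \<Rightarrow> if b then yy else yy * yy * yy)"
  have \<phi>: "\<phi> \<sigma> = xx" "\<phi> \<sigma>' = xx ^ (2 * M - 1)" "\<phi> \<tau> = yy" "\<phi> \<tau>' = yy * yy * yy"
    by (simp_all add: \<phi>_def)
  have "weval \<phi> u = weval \<phi> v" if "presentation_eq (quat_rels M) u v" for u v
    using that
  proof (rule weval_cong[where S=UNIV and R="(=)"])
    fix u v assume "(u, v) \<in> quat_rels M"
    then consider "u = replicate (2 * M) \<sigma>" "v = []" | "u = [\<tau>, \<tau>]" "v = replicate M \<sigma>" | "u = [\<tau>, \<sigma>, \<tau>']" "v = [\<sigma>']"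
      by (auto simp: quat_rels_def)
    then show "weval \<phi> u = weval \<phi> v"
    proof cases
      case 3
      have "yy * xx * (yy * yy * yy) = xx ^ (2 * M - 1) * (yy * yy * (yy * yy))"
        by (simp only: yx mult.assoc)
      then show ?thesis using y4 by (simp only: 3 weval.simps \<phi> mult.assoc mult_1_right)
    qed (simp_all add: \<phi> x_order yy)
  next
    fix g b
    show "\<phi> (g, b) * \<phi> (g, \<not> b) = 1"
      using inv y4 by (cases g; cases b) (simp_all add: \<phi> mult.assoc)
  qed simp_all
  moreover have "(\<lambda>p. weval \<phi> (nform p)) = B"
    by (auto simp: fun_eq_iff nform_def B_def \<phi>)
  ultimately show thesis using that[of \<phi>] indep_B span_B by simp
qed

abbreviation quat_elem :: "nat \<Rightarrow> nat \<times> nat \<Rightarrow> quaternion_gen word set" where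
  "quat_elem M p \<equiv> pcls (quat_rels M) (nform p)"

text \<open>The complex representation counts the group: the values of the 4 M normal forms are
  linearly independent, hence distinct. As a fact about the group it then serves over k as
  well.\<close>

lemma quat_elem_bij:
  assumes "M \<ge> 2" "even M"
  shows "bij_betw (quat_elem M) ({..<2 * M} \<times> {..<2}) (carrier (quat M))"
proof -
  obtain \<phi> :: "quaternion_gen \<times> bool \<Rightarrow> complex blocks"
    where ind: "sc.indep ({..<2 * M} \<times> {..<2}) (\<lambda>p. weval \<phi> (nform p))"
    and eq: "\<And>u v. presentation_eq (quat_rels M) u v \<Longrightarrow> weval \<phi> u = weval \<phi> v"
    by (rule complex_quaternion_model[OF assms]) (rule that; blast)
  have "inj_on (quat_elem M) ({..<2 * M} \<times> {..<2})"
  proof (rule inj_onI)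
    fix p q assume pq: "p \<in> {..<2 * M} \<times> {..<2::nat}" "q \<in> {..<2 * M} \<times> {..<2::nat}"
      and "quat_elem M p = quat_elem M q"
    then have "weval \<phi> (nform p) = weval \<phi> (nform q)" using eq by (simp add: pcls_eq_iff)
    then show "p = q" using sc.indep_inj[OF ind _ pq] by simp
  qed
  then show ?thesis using carrier_quat[of M] assms(1) by (simp add: bij_betw_def)
qed

definition quat_index :: "nat \<Rightarrow> quaternion_gen word set \<Rightarrow> nat \<times> nat" where
  "quat_index M = the_inv_into ({..<2 * M} \<times> {..<2}) (quat_elem M)"

lemma quat_index:
  assumes "M \<ge> 2" "even M"
  shows "bij_betw (quat_index M) (carrier (quat M)) ({..<2 * M} \<times> {..<2})"
    and "presentation_eq (quat_rels M) w (nform (quat_index M (pcls (quat_rels M) w)))"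
    and "p \<in> {..<2 * M} \<times> {..<2} \<Longrightarrow> quat_index M (quat_elem M p) = p"
proof -
  note bij = quat_elem_bij[OF assms]
  show "bij_betw (quat_index M) (carrier (quat M)) ({..<2 * M} \<times> {..<2})"
    unfolding quat_index_def by (rule bij_betw_the_inv_into[OF bij])
  show idx: "p \<in> {..<2 * M} \<times> {..<2} \<Longrightarrow> quat_index M (quat_elem M p) = p" for p
    unfolding quat_index_def using bij by (intro the_inv_into_f_f) (auto simp: bij_betw_def)
  obtain p where p: "p \<in> {..<2 * M} \<times> {..<2}" "presentation_eq (quat_rels M) w (nform p)"
    using ex_nform[of M w] assms(1) by auto
  then have "pcls (quat_rels M) w = quat_elem M p" by (simp add: pcls_eq_iff)
  then show "presentation_eq (quat_rels M) w (nform (quat_index M (pcls (quat_rels M) w)))"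
    using p idx[OF p(1)] by simp
qed

lemma fin_monoid_quat: "M > 0 \<Longrightarrow> fin_monoid (quat M)"
  by (intro fin_monoid.intro fin_monoid_axioms.intro monoid_presented_group finite_quat)

lemma complex_full_emb:
  assumes M: "M \<ge> 2" "even M"
  shows "\<exists>\<Phi> \<beta>. full_emb (group_algebra (quat M) :: (complex, _) module) \<Phi> (carrier (quat M)) \<beta> M"
proof -
  obtain \<phi> :: "quaternion_gen \<times> bool \<Rightarrow> complex blocks"
    where ind: "sc.indep ({..<2 * M} \<times> {..<2}) (\<lambda>p. weval \<phi> (nform p))"
    and span: "sc.lspan ({..<2 * M} \<times> {..<2}) (\<lambda>p. weval \<phi> (nform p)) = block_algebra M"
    and eq: "\<And>u v. presentation_eq (quat_rels M) u v \<Longrightarrow> weval \<phi> u = weval \<phi> v"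
    by (rule complex_quaternion_model[OF assms]) (rule that; blast)
  interpret G: fin_monoid "quat M" using M(1) by (intro fin_monoid_quat) simp
  define \<beta> where "\<beta> = (\<lambda>p. weval \<phi> (nform p)) \<circ> quat_index M"
  have \<beta>: "\<beta> (pcls (quat_rels M) w) = weval \<phi> w" for w
    using eq[OF quat_index(2)[OF M, of w]] by (simp add: \<beta>_def)
  have "alg_emb sc (group_algebra (quat M)) (G.extend sc \<beta>) (carrier (quat M)) \<beta>"
  proof (rule G.group_algebra_alg_emb[OF sc.central_hom_axioms])
    show "sc.indep (carrier (quat M)) \<beta>"
      unfolding \<beta>_def by (rule sc.indep_reindex[OF quat_index(1)[OF M] ind])
    show "\<beta> \<one>\<^bsub>quat M\<^esub> = 1" by (simp add: presented_group_simps \<beta>)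
    show "\<beta> (x \<otimes>\<^bsub>quat M\<^esub> y) = \<beta> x * \<beta> y" if "x \<in> carrier (quat M)" "y \<in> carrier (quat M)" for x y
      using that by (auto simp: presented_group_simps \<beta>)
  qed
  moreover have "sc.lspan (carrier (quat M)) \<beta> = block_algebra M"
    unfolding \<beta>_def sc.lspan_reindex[OF quat_index(1)[OF M]] by (rule span)
  ultimately show ?thesis
    using M(1) by (intro exI full_emb.intro full_emb_axioms.intro) auto
qed

section \<open>The deformed block model in characteristic two\<close>

context block_model
begin

text \<open>The inverse of \<open>xx\<close> once a l * b l = 1: the two eigenvalues change
  places.\<close>

definition vv :: "'k blocks" where
  "vv = (\<lambda>l. if l < M - 1 then M2 (b l) 0 0 (a l) else if l \<le> M then M2 (b (M - 1)) 0 0 (b (M - 1))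
     else M2 (a (M - 1)) 0 0 (a (M - 1)))"

text \<open>Everything is checked block by block. By \<open>w\<close> the element w is scalar on
  each block; by \<open>wu\<close> and \<open>c\<close>, z is 0 on matrix blocks and s on scalar
  ones. So y x = (v + z) y is the swap of eigenvalues or the identity v + s = x. For y^2,
  \<open>fa\<close> says that x^M + u x is the scalar \<open>f l\<close> on a matrix block, and
  \<open>ra\<close>, \<open>rb\<close> are the quadratic equations on the scalar blocks.\<close>

lemma deformed_relations:
  fixes w :: "nat \<Rightarrow> 'k" and c s u :: 'k
  assumes char_2: "(1::'k) + 1 = 0"
    and w: "\<And>l. l < M \<Longrightarrow> a l + b l = w l" "\<And>l. l < M \<Longrightarrow> a l * b l = 1" "w (M - 1) = s"
    and wu: "\<And>l. l < M - 1 \<Longrightarrow> w l ^ (M - 1) = u"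
    and c: "c * (s ^ (M - 1) + u) = s"
    and fa: "\<And>l. l < M - 1 \<Longrightarrow> f l = a l ^ M + u * a l" "\<And>l. l < M - 1 \<Longrightarrow> f l = b l ^ M + u * b l"
    and ra: "r 0 * r 0 = s * r 0 + (a (M - 1) ^ M + u * a (M - 1))" "r 1 * r 1 = s * r 1 + (a (M - 1) ^ M + u * a (M - 1))"
    and rb: "r 2 * r 2 = s * r 2 + (b (M - 1) ^ M + u * b (M - 1))" "r 3 * r 3 = s * r 3 + (b (M - 1) ^ M + u * b (M - 1))"
  defines "z \<equiv> sc c * ((xx + vv) ^ (M - 1) + sc u)"
  shows "xx * vv = 1" "vv * xx = 1" "yy * xx = (vv + z) * yy" "yy * yy = z * yy + xx ^ M + sc u * xx"
    "(xx + vv + sc s) * ((xx + vv) ^ (M - 1) + sc u) = 0"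
proof -
  have double: "x + x = 0" "x + (x + y) = y" for x y :: 'k
  proof -
    show *: "x + x = 0" for x :: 'k using char_2 distrib_right[of 1 1 x] by simp
    show "x + (x + y) = y" by (simp add: add.assoc[symmetric] *)
  qed
  define v where "v l = (if l \<le> M then b (M - 1) else a (M - 1))" for l
  have ev: "e l + v l = s" "e l * v l = 1" for l
    using w(1,2)[of "M - 1"] w(3) M_pos by (auto simp: e_def v_def add.commute mult.commute)
  then have ve: "v l + s = e l" for l using double(2)[of "v l" "e l"] by (metis add.commute)
  have vv: "vv l = (if l < M - 1 then M2 (b l) 0 0 (a l) else M2 (v l) 0 0 (v l))" for l
    by (auto simp: vv_def v_def)
  have rr: "rr l * rr l = s * rr l + (e l ^ M + u * e l)" if l: "\<not> l < M - 1" for l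
  proof -
    consider "l = M - 1" | "l = M" | "l = M + 1" | "l > M + 1" using l by linarith
    then show ?thesis
    proof cases
      case 1
      then show ?thesis using ra(1) by (simp only: scalar_values)
    next
      case 2
      then show ?thesis using ra(2) by (simp only: scalar_values)
    next
      case 3
      then show ?thesis using rb(1) by (simp only: scalar_values)
    next
      case 4
      then have "l \<noteq> M - 1" "l \<noteq> M" "l \<noteq> M + 1" "\<not> l \<le> M" by linarith+
      then have "e l = b (M - 1)" "rr l = r 3" by (simp_all add: e_def rr_def)
      then show ?thesis using rb(2) by simp
    qed
  qed
  have sum: "(xx + vv) l = (if l < M - 1 then M2 (w l) 0 0 (w l) else M2 s 0 0 s)" for l
    using w(1)[of l] ev(1)[of l] by (auto simp: xx_def vv m2_eq_iff add.commute)
  have z: "z l = (if l < M - 1 then 0 else M2 s 0 0 s)" for l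
    unfolding z_def times_fun_apply plus_fun_apply[of "(xx + vv) ^ (M - 1)"] power_fun_apply sum
    using wu[of l] c by (auto simp: diag_power m2_eq_iff double)
  have xM: "(xx ^ M) l = (if l < M - 1 then M2 (a l ^ M) 0 0 (b l ^ M) else M2 (e l ^ M) 0 0 (e l ^ M))" for l
    by (simp add: xx_def diag_power)
  have mult1: "a l * b l = 1" "b l * a l = 1" if "l < M - 1" for l using w(2)[of l] that by (simp_all add: mult.commute)
  show "xx * vv = 1" "vv * xx = 1"
    using mult1 ev(2) by (auto simp: fun_eq_iff xx_def vv m2_eq_iff mult.commute)
  show "yy * xx = (vv + z) * yy"
    using ve by (auto simp: fun_eq_iff times_fun_apply plus_fun_apply z vv xx_def yy_def m2_eq_iff mult.commute)
  show "yy * yy = z * yy + xx ^ M + sc u * xx"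
  proof
    fix l
    show "(yy * yy) l = (z * yy + xx ^ M + sc u * xx) l"
      unfolding plus_fun_apply times_fun_apply z xM
      using fa[of l] rr[of l] by (cases "l < M - 1") (simp_all add: yy_def xx_def m2_eq_iff add.assoc)
  qed
  show "(xx + vv + sc s) * ((xx + vv) ^ (M - 1) + sc u) = 0"
  proof
    fix l
    show "((xx + vv + sc s) * ((xx + vv) ^ (M - 1) + sc u)) l = 0 l"
      unfolding times_fun_apply plus_fun_apply[of "xx + vv"] plus_fun_apply[of "(xx + vv) ^ (M - 1)"] power_fun_apply sum
      using wu[of l] by (cases "l < M - 1") (simp_all add: diag_power m2_eq_iff double)
  qed
qed

end

section \<open>Finite subfields of characteristic two\<close>

lemma subfield_of_type:
  fixes F :: "'k::field set"
  assumes "subfield F (ring_of_type_algebra :: 'k ring)"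
  shows "1 \<in> F" "x \<in> F \<Longrightarrow> y \<in> F \<Longrightarrow> x + y \<in> F" "x \<in> F \<Longrightarrow> y \<in> F \<Longrightarrow> x * y \<in> F"
  using subringE(3,6,7)[OF subfieldE(1)[OF assms]] by auto

text \<open>Translation by 1 permutes \<open>F\<close>; comparing the sums over \<open>F\<close>
  shows that its cardinality, a power of two, vanishes in the field.\<close>

lemma char_2_of_card:
  fixes F :: "'k::field set"
  assumes "subfield F (ring_of_type_algebra :: 'k ring)" "card F = 2 ^ m"
  shows "(1::'k) + 1 = 0"
proof -
  have fin: "finite F" using assms(2) by (metis card.infinite power_not_zero zero_neq_numeral)
  have inj: "inj_on (\<lambda>x. x + 1) F" and "(\<lambda>x. x + 1) ` F \<subseteq> F"
    using subfield_of_type[OF assms(1)] by (auto simp: inj_on_def)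
  then have "bij_betw (\<lambda>x. x + 1) F F" by (intro bij_betw_imageI endo_inj_surj fin)
  then have "(\<Sum>x\<in>F. x + 1) = (\<Sum>x\<in>F. x)" by (rule sum.reindex_bij_betw)
  then have "of_nat (card F) = (0::'k)" by (simp add: sum.distrib)
  then have "(2::'k) ^ m = 0" by (simp add: assms(2))
  then show ?thesis by simp
qed

lemma finite_field_power:
  fixes F :: "'k::field set"
  assumes "subfield F (ring_of_type_algebra :: 'k ring)" "finite F" "\<alpha> \<in> F - {0}"
  shows "\<alpha> ^ (card F - 1) = 1"
proof -
  have "inj_on (\<lambda>x. \<alpha> * x) (F - {0})" "(\<lambda>x. \<alpha> * x) ` (F - {0}) \<subseteq> F - {0}"
    using subfield_of_type[OF assms(1)] assms(3) by (auto simp: inj_on_def)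
  then have "bij_betw (\<lambda>x. \<alpha> * x) (F - {0}) (F - {0})" using assms(2) by (simp add: bij_betw_def endo_inj_surj)
  then have "(\<Prod>x\<in>F - {0}. \<alpha> * x) = (\<Prod>x\<in>F - {0}. x)" by (rule prod.reindex_bij_betw)
  then have *: "\<alpha> ^ card (F - {0}) * (\<Prod>x\<in>F - {0}. x) = (\<Prod>x\<in>F - {0}. x)" by (simp add: prod.distrib)
  have "(\<Prod>x\<in>F - {0}. x) \<noteq> 0" using assms(2) by (simp add: prod_zero_iff)
  with * have "\<alpha> ^ card (F - {0}) = 1" by simp
  moreover have "0 \<in> F"
    using subringE(2)[OF subfieldE(1)[OF assms(1)]] by simp
  ultimately show ?thesis using assms(2) by simp
qed

lemma quadratic_root: "\<exists>x::'a::alg_closed_field. x * x = p * x + q"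
proof -
  obtain x where "(\<Sum>k\<le>2. (if k = 0 then - q else if k = 1 then - p else 1) * x ^ k) = 0"
    using alg_closed[of 2 "\<lambda>k. if k = 0 then - q else if k = 1 then - p else 1"] by auto
  then have "x * x - p * x - q = 0" by (simp add: numeral_2_eq_2 algebra_simps)
  then show ?thesis by (intro exI[of _ x]) (simp add: algebra_simps)
qed

section \<open>The deformation\<close>

definition ac :: "'k::field fps \<Rightarrow> 'k fls alg_closure" where
  "ac p = to_ac (fps_to_fls p)"

lemma ac_simps [simp]:
  "ac (p + q) = ac p + ac q" "ac (p * q) = ac p * ac q" "ac 1 = 1" "ac 0 = 0" "ac p = ac q \<longleftrightarrow> p = q"
  by (simp_all add: ac_def fls_times_fps_to_fls)

lemma ac_power [simp]: "ac (p ^ n) = ac p ^ n"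
  by (induction n) simp_all

lemma central_hom_sc: "central_hom (\<lambda>r. sc (\<kappa> r))"
  if "\<And>r s. \<kappa> (r + s) = \<kappa> r + \<kappa> s" "\<And>r s. \<kappa> (r * s) = \<kappa> r * \<kappa> s" "\<kappa> 1 = 1"
  by standard (simp_all only: that sc.map_add sc.map_mult sc.map_one, rule sc.central)

lemma deformation_model:
  fixes F :: "'k::field set"
  assumes F: "subfield F (ring_of_type_algebra :: 'k ring)" "card F = 2 ^ m" and m: "m > 0"
  obtains x v y and c s u :: "'k fps"
  where "deformed_quat (\<lambda>p. sc (ac p)) x v y fps_X c s u m"
    "sc.indep ({..<2 * 2 ^ m} \<times> {..<2}) (\<lambda>(i, j). x ^ i * y ^ j)"
    "sc.lspan ({..<2 * 2 ^ m} \<times> {..<2}) (\<lambda>(i, j). x ^ i * y ^ j) = block_algebra (2 ^ m)"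
proof -
  define M where "M = (2::nat) ^ m"
  have M: "M \<ge> 2" using m unfolding M_def by (cases m) auto
  have k2: "(1::'k) + 1 = 0" by (rule char_2_of_card[OF F])
  have p2: "(1::'k fps) + 1 = 0"
    using k2 by (metis fps_const_0_eq_0 fps_const_1_eq_1 fps_const_add)
  have K2: "(1::'k fls alg_closure) + 1 = 0"
  proof -
    have "ac (1::'k fps) + ac 1 = ac 0" by (simp only: ac_simps(1)[symmetric] p2)
    then show ?thesis by (simp only: ac_simps(3,4))
  qed
  have double: "a + a = 0" "a + (a + b) = b" for a b :: "'k fls alg_closure"
  proof -
    show *: "a + a = 0" for a :: "'k fls alg_closure" by (simp only: distrib_right[of 1 1 a, symmetric, unfolded mult_1_left] K2 mult_zero_left)
    show "a + (a + b) = b" by (simp add: add.assoc[symmetric] *)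
  qed
  have eq_iff: "a = b \<longleftrightarrow> a + b = 0" for a b :: "'k fls alg_closure"
  proof
    show "a + b = 0" if "a = b" using that double(1) by simp
    show "a = b" if "a + b = 0" using double(2)[of a b] that by simp
  qed
  have finF: "finite F" using F(2) by (metis card.infinite power_not_zero zero_neq_numeral)
  have "0 \<in> F" using subringE(2)[OF subfieldE(1)[OF F(1)]] by simp
  then have "card (F - {0}) = M - 1" using F(2) by (simp add: M_def)
  then obtain \<alpha> where \<alpha>: "bij_betw \<alpha> {0..<M - 1} (F - {0})"
    using ex_bij_betw_nat_finite[of "F - {0}"] finF by auto
  have \<alpha>_mem: "\<alpha> l \<noteq> 0" "\<alpha> l ^ (M - 1) = 1" if "l < M - 1" for l
  proof -
    have "\<alpha> l \<in> F - {0}" using \<alpha> that by (auto simp: bij_betw_def)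
    then show "\<alpha> l \<noteq> 0" "\<alpha> l ^ (M - 1) = 1"
      using finite_field_power[OF F(1) finF, of "\<alpha> l"] F(2) by (auto simp: M_def)
  qed
  have \<alpha>_inj: "l = l'" if "\<alpha> l = \<alpha> l'" "l < M - 1" "l' < M - 1" for l l'
    using \<alpha> that by (auto simp: bij_betw_def inj_on_def)
  \<comment> \<open>\<open>c\<close> solves \<open>c (s\<^bsup>M-1\<^esup> + u) = s\<close>, so that \<open>z\<close> equals \<open>s\<close> on the scalar blocks.\<close>
  define s u c :: "'k fps" where "s = fps_X ^ M" and "u = fps_X ^ (M - 1)"
    and "c = fps_X * inverse (1 + fps_X ^ ((M - 1) * (M - 1)))"
  define w0 where "w0 l = (if l < M - 1 then fps_X * fps_const (\<alpha> l) else s)" for l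
  define w where "w l = ac (w0 l)" for l
  \<comment> \<open>The linear coefficient separates all M eigenvalues of w: it is
    \<open>\<alpha> l\<close>, nonzero, for the matrix blocks and 0 for s = t^M, as M is at least
    2.\<close>
  have w0_1: "fps_nth (w0 l) 1 = (if l < M - 1 then \<alpha> l else 0)" for l
    using M by (simp add: w0_def s_def)
  have w_inj: "l = l'" if "w l = w l'" "l < M" "l' < M" for l l'
  proof -
    have "fps_nth (w0 l) 1 = fps_nth (w0 l') 1" using that(1) by (simp add: w_def)
    then show ?thesis
      using \<alpha>_inj[of l l'] \<alpha>_mem(1)[of l] \<alpha>_mem(1)[of l'] that(2,3) unfolding w0_1
      by (auto split: if_splits)
  qed
  have w_nz: "w l \<noteq> 0" for l
  proof -
    have "w0 l \<noteq> 0" using \<alpha>_mem(1)[of l] by (auto simp: w0_def s_def)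
    then show ?thesis unfolding w_def by (metis ac_simps(4,5))
  qed
  have w_pow: "w l ^ (M - 1) = ac u" if "l < M - 1" for l
  proof -
    have "w0 l ^ (M - 1) = u"
      using \<alpha>_mem(2)[OF that] that by (simp add: w0_def u_def power_mult_distrib fps_const_power)
    then show ?thesis by (simp only: w_def ac_power[symmetric])
  qed
  \<comment> \<open>The equation x + x^-1 = w, cleared of the inverse. In characteristic two its
    second root is a + w.\<close>
  have "\<forall>l. \<exists>x. x * x = w l * x + 1" by (intro allI quadratic_root)
  from choice[OF this] obtain a where a: "\<And>l. a l * a l = w l * a l + 1" by blast
  define b where "b l = a l + w l" for l
  have ab_rel: "a l + b l = w l" "a l * b l = 1" for l
  proof -
    show "a l + b l = w l" unfolding b_def by (rule double(2))
    have "a l * b l = w l * a l + (w l * a l + 1)"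
      by (simp only: b_def distrib_left a[of l] mult.commute[of "a l" "w l"] add.assoc add.commute[of 1])
    then show "a l * b l = 1" by (simp only: double(2))
  qed
  have inv_unique: "y = z" if "x * y = 1" "x * z = 1" for x y z :: "'k fls alg_closure"
  proof -
    have "y = (x * z) * y" by (simp only: that mult_1_left)
    also have "\<dots> = (x * y) * z" by (simp only: mult.assoc mult.commute[of z])
    finally show ?thesis by (simp only: that mult_1_left)
  qed
  have MM: "M = Suc (M - 1)" using M by simp
  \<comment> \<open>By Frobenius a^M + b^M = w^M, and w^M = u w because w^(M-1) = u. Adding u a
    therefore makes the expression symmetric in a and b, as y^2 has to be.\<close>
  define f where "f l = a l ^ M + ac u * a l" for l
  have fb: "f l = b l ^ M + ac u * b l" if "l < M - 1" for l
  proof -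
    have "b l ^ M = a l ^ M + w l ^ M"
      unfolding b_def M_def by (rule char_2_power_sum[OF K2]) (rule mult.commute)
    also have "w l ^ M = w l * ac u" using w_pow[OF that] by (subst MM) simp
    finally have "b l ^ M + ac u * b l = a l ^ M + (w l * ac u + (ac u * a l + ac u * w l))"
      by (simp add: b_def distrib_left add.assoc)
    also have "\<dots> = f l" by (simp add: f_def double mult.commute[of "w l"] add.commute[of "ac u * a l"])
    finally show ?thesis by simp
  qed
  \<comment> \<open>If f vanished, both a and b would have (M-1)-st power u, so u^2 = (a b)^(M-1) =
    1; but u has no constant term.\<close>
  have f_nz: "f l \<noteq> 0" if l: "l < M - 1" for l
  proof
    assume 0: "f l = 0"
    have "x ^ (M - 1) = ac u" if "x ^ M + ac u * x = 0" "x \<noteq> 0" for x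
    proof -
      have "x ^ M = ac u * x" using that(1) by (rule eq_iff[THEN iffD2])
      then have "x * x ^ (M - 1) = ac u * x" by (subst (asm) MM) simp
      then show ?thesis using that(2) by (simp add: mult.commute)
    qed
    moreover have "a l \<noteq> 0" "b l \<noteq> 0" using ab_rel(2)[of l] by auto
    ultimately have "a l ^ (M - 1) = ac u" "b l ^ (M - 1) = ac u" using 0 fb[OF l] by (auto simp: f_def)
    then have "ac u * ac u = (a l * b l) ^ (M - 1)" by (simp add: power_mult_distrib)
    then have "ac (u * u) = ac 1" by (simp add: ab_rel(2))
    then have "u * u = 1" by (simp only: ac_simps(5))
    then have "fps_nth (u * u) 0 = 1" by simp
    then show False using M by (simp add: u_def)
  qed
  define q where "q x = x ^ M + ac u * x" for x
  obtain ra rb where ra: "ra * ra = ac s * ra + q (a (M - 1))" and rb: "rb * rb = ac s * rb + q (b (M - 1))"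
    using quadratic_root[of "ac s" "q (a (M - 1))"] quadratic_root[of "ac s" "q (b (M - 1))"] by blast
  \<comment> \<open>Adding s passes to the second root of X^2 = s X + q, and the roots differ
    because s is nonzero.\<close>
  define r where "r i = (if i = 0 then ra else if i = 1 then ra + ac s else if i = 2 then rb else rb + ac s)" for i :: nat
  have s_nz: "ac s \<noteq> 0" using w_nz[of "M - 1"] by (simp add: w_def w0_def)
  interpret block_model M a b f r
  proof
    show "M > 0" using M by simp
    show a_inj: "l = l'" if "l < M" "l' < M" "a l = a l'" for l l'
    proof -
      have "b l = b l'" using inv_unique[OF ab_rel(2)[of l], of "b l'"] ab_rel(2)[of l'] that(3) by simp
      then have "w l = w l'" using that(3) by (simp only: ab_rel(1)[symmetric])
      then show ?thesis using w_inj that by blast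
    qed
    show "l = l'" if "l < M" "l' < M" "b l = b l'" for l l'
    proof -
      have "a l = a l'" using inv_unique[of "b l" "a l" "a l'"] ab_rel(2)[of l] ab_rel(2)[of l'] that(3) by (simp add: mult.commute)
      then show ?thesis using a_inj that by blast
    qed
    show "a l \<noteq> b l'" if "l < M" "l' < M" for l l'
    proof
      assume eq: "a l = b l'"
      then have "b l = a l'" using inv_unique[of "a l" "b l" "a l'"] ab_rel(2)[of l] ab_rel(2)[of l'] by (simp add: mult.commute)
      then have "w l = w l'" using ab_rel(1)[of l] ab_rel(1)[of l'] eq by (simp add: add.commute)
      then have "l = l'" using w_inj that by blast
      then show False using eq ab_rel(1)[of l] w_nz[of l] double(1)[of "a l"] by auto
    qed
    show "f l \<noteq> 0" if "l < M - 1" for l using f_nz[OF that] .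
  qed (use s_nz in \<open>simp_all add: r_def\<close>)
  \<comment> \<open>Since s^(M-1) = u t^((M-1)^2), the sum s^(M-1) + u is u times a unit of k[[t]],
    and s = t u; so the solution c is even divisible by t.\<close>
  have c: "c * (s ^ (M - 1) + u) = s"
  proof -
    let ?d = "1 + fps_X ^ ((M - 1) * (M - 1)) :: 'k fps"
    have "M * (M - 1) = (M - 1) + (M - 1) * (M - 1)" by (subst (1) MM) simp
    then have "s ^ (M - 1) + u = u * ?d"
      by (simp add: s_def u_def power_mult[symmetric] distrib_left power_add)
    moreover have "inverse ?d * ?d = 1" using M by (intro inverse_mult_eq_1) simp
    ultimately have "c * (s ^ (M - 1) + u) = fps_X * u"
      by (simp add: c_def mult.assoc mult.left_commute[of _ u])
    then show ?thesis using MM by (simp add: s_def u_def flip: power_Suc)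
  qed
  have shift: "(x + z) * (x + z) = z * (x + z) + p" if "x * x = z * x + p" for x z p :: "'k fls alg_closure"
  proof -
    have "(x + z) * (x + z) = (z * x + p) + z * x + (z * x + z * z)"
      by (simp only: distrib_left distrib_right that mult.commute[of x z] add.assoc)
    also have "\<dots> = z * (x + z) + p + (z * x + z * x)" by (simp only: distrib_left add_ac)
    finally show ?thesis by (simp only: double(1) add_0_right)
  qed
  have wM: "w (M - 1) = ac s" by (simp add: w_def w0_def)
  have cK: "ac c * (ac s ^ (M - 1) + ac u) = ac s"
    using arg_cong[OF c, of ac] by (simp only: ac_simps ac_power)
  have fK: "f l = b l ^ M + ac u * b l" if "l < M - 1" for l using fb that .
  have r0: "r 0 * r 0 = ac s * r 0 + q (a (M - 1))" "r 2 * r 2 = ac s * r 2 + q (b (M - 1))"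
    using ra rb by (simp_all add: r_def)
  have "r 1 = r 0 + ac s" "r 3 = r 2 + ac s" by (simp_all add: r_def)
  then have r1: "r 1 * r 1 = ac s * r 1 + q (a (M - 1))" "r 3 * r 3 = ac s * r 3 + q (b (M - 1))"
    by (simp_all only: shift r0)
  note R = deformed_relations[of w "ac s" "ac u" "ac c", OF K2 ab_rel wM w_pow cK f_def fK
      r0(1)[unfolded q_def] r1(1)[unfolded q_def] r0(2)[unfolded q_def] r1(2)[unfolded q_def]]
  have D: "deformed_quat (\<lambda>p. sc (ac p)) xx vv yy fps_X c s u m"
  proof (intro deformed_quat.intro deformed_quat_axioms.intro)
    show "central_hom (\<lambda>p::'k fps. sc (ac p))" by (rule central_hom_sc) simp_all
    show "fps_X dvd c" "fps_X dvd s" "fps_X dvd u"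
      using M by (simp_all add: c_def s_def u_def dvd_power)
  qed (unfold M_def[symmetric], (rule p2 m R | assumption)+)
  have B: "B = (\<lambda>(i, j). xx ^ i * yy ^ j)" by (simp add: B_def)
  show thesis
    by (rule that[folded M_def, OF D indep_B[unfolded B] span_B[unfolded B]])
qed

section \<open>The deformed group algebra\<close>

text \<open>A deformation may carry any product and unit on the given module. Here both are pulled
  back from the ambient ring, which makes the embedding multiplicative.\<close>

lemma (in lin_emb) transported_alg_emb:
  assumes one: "1 \<in> lspan I \<beta>" and mult: "\<And>d d'. d \<in> lspan I \<beta> \<Longrightarrow> d' \<in> lspan I \<beta> \<Longrightarrow> d * d' \<in> lspan I \<beta>"
  obtains m u where "alg_emb \<iota> (N\<lparr>monoid.mult := m, one := u\<rparr>) \<Phi> I \<beta>"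
proof -
  let ?inv = "the_inv_into (carrier N) \<Phi>"
  have inv: "?inv d \<in> carrier N" "\<Phi> (?inv d) = d" if "d \<in> lspan I \<beta>" for d
    using the_inv_into_into[OF emb_inj _ subset_refl] f_the_inv_into_f[OF emb_inj] that
    unfolding emb_image by auto
  have "alg_emb \<iota> (N\<lparr>monoid.mult := \<lambda>x y. ?inv (\<Phi> x * \<Phi> y), one := ?inv 1\<rparr>) \<Phi> I \<beta>"
    by unfold_locales
      (simp_all add: finite_index zero_mem add_mem smult_mem emb_zero emb_add emb_smult emb_inj emb_image
        inv one mult emb_mem)
  then show thesis by (rule that)
qed

lemma (in central_hom) indep_comp:
  assumes "indep I \<beta>" "central_hom (\<lambda>r. \<iota> (\<kappa> r))" "\<And>r. \<kappa> r = 0 \<Longrightarrow> r = 0"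
  shows "central_hom.indep (\<lambda>r. \<iota> (\<kappa> r)) I \<beta>"
proof -
  interpret \<kappa>: central_hom "\<lambda>r. \<iota> (\<kappa> r)" by (fact assms(2))
  have "c i = 0" if "(\<Sum>i\<in>I. \<iota> (\<kappa> (c i)) * \<beta> i) = 0" "i \<in> I" for c i
    using assms(1) that assms(3) unfolding indep_def by (elim allE[of _ "\<lambda>i. \<kappa> (c i)"]) auto
  then show ?thesis unfolding \<kappa>.indep_def by blast
qed

context deformed_quat
begin

text \<open>Indexing by group elements lets the coefficient extension of the group algebra and the
  lattice \<open>L\<close> share one basis, although the x^i y^j do not multiply like the
  group.\<close>

definition basis :: "quaternion_gen word set \<Rightarrow> 'd" where
  "basis = (\<lambda>(i, j). x ^ i * y ^ j) \<circ> quat_index M"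

lemma M_even: "even M"
  using m_pos by (simp add: M_def)

lemma basis_quat_elem: "p \<in> {..<N} \<times> {..<2} \<Longrightarrow> basis (quat_elem M p) = weval gen (nform p)"
  by (cases p) (simp add: basis_def quat_index(3)[OF M_ge M_even] weval_nform del: mem_Sigma_iff)

text \<open>A word and the normal form of its class are equal in the group, hence congruent after
  evaluation; this is how products of basis elements are computed modulo t.\<close>

lemma basis_congr: "congr (weval gen a) (basis (pcls (quat_rels M) a))"
  using weval_congr[OF quat_index(2)[OF M_ge M_even, of a]]
  by (cases "quat_index M (pcls (quat_rels M) a)") (simp add: basis_def weval_nform)

lemma basis_span: "lspan (carrier (quat M)) basis = L"
  unfolding basis_def L_def by (rule lspan_reindex[OF quat_index(1)[OF M_ge M_even]])

lemma basis_one: "basis \<one>\<^bsub>quat M\<^esub> = 1"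
proof -
  have "\<one>\<^bsub>quat M\<^esub> = quat_elem M (0, 0)" by (simp add: presented_group_simps nform_def)
  then show ?thesis using basis_quat_elem[of "(0, 0)"] M_ge by (simp add: nform_def)
qed

lemma basis_mult:
  assumes "g \<in> carrier (quat M)" "h \<in> carrier (quat M)"
  shows "\<exists>l\<in>L. basis g * basis h = basis (g \<otimes>\<^bsub>quat M\<^esub> h) + \<iota> t * l"
proof -
  obtain p q where p: "p \<in> {..<N} \<times> {..<2}" "g = quat_elem M p" and q: "q \<in> {..<N} \<times> {..<2}" "h = quat_elem M q"
    using assms carrier_quat[of M] M_ge by auto
  have "basis g * basis h = weval gen (nform p @ nform q)"
    by (simp only: p(2) q(2) basis_quat_elem[OF p(1)] basis_quat_elem[OF q(1)] weval_append)
  moreover have "g \<otimes>\<^bsub>quat M\<^esub> h = pcls (quat_rels M) (nform p @ nform q)"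
    by (simp add: p(2) q(2) presented_group_simps)
  ultimately show ?thesis using basis_congr[of "nform p @ nform q"] by (simp only: congr_def)
qed

end

theorem mainTheorem1:
  fixes n :: nat and F :: "'k::field set"
  assumes "n \<ge> 3"
    and "subfield F (ring_of_type_algebra :: 'k ring)" and "card F = 2 ^ (n - 2)"
  shows "\<exists>At.
    is_deformation (group_algebra (generalized_quaternion n) :: ('k, _) module) At \<and>
    separable_algebra (ring_of_type_algebra :: 'k fls ring) At \<and>
    algebra_isomorphic (ring_of_type_algebra :: 'k fls alg_closure ring)
      (base_change ring_of_type_algebra (algebra_along to_ac) At)
      (direct_sum_algebra
        (product_algebra {1..2 ^ (n - 2) - 1 :: nat}
          (\<lambda>_. module_mat TYPE('k fls alg_closure) 2 2))
        (product_algebra {1..4::nat} (\<lambda>_. algebra_along (\<lambda>c. c)))) \<and>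
    same_component_dimensions
      (ring_of_type_algebra :: 'k fls alg_closure ring)
      (base_change ring_of_type_algebra (algebra_along to_ac) At)
      (ring_of_type_algebra :: complex ring)
      (group_algebra (generalized_quaternion n))"
proof -
  define m where "m = n - 2"
  have m: "m > 0" and M: "(2::nat) ^ m \<ge> 2" "even ((2::nat) ^ m)" using assms(1) by (cases m; simp add: m_def)+
  let ?G = "quat (2 ^ m)" and ?R = ring_of_type_algebra
  have G: "generalized_quaternion n = ?G" unfolding m_def using assms(1) by (intro generalized_quaternion_eq) simp
  obtain x v y and c s u :: "'k fps"
    where D: "deformed_quat (\<lambda>p. sc (ac p)) x v y fps_X c s u m"
      and ind0: "sc.indep ({..<2 * 2 ^ m} \<times> {..<2}) (\<lambda>(i, j). x ^ i * y ^ j)"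
      and span0: "sc.lspan ({..<2 * 2 ^ m} \<times> {..<2}) (\<lambda>(i, j). x ^ i * y ^ j) = block_algebra (2 ^ m)"
    by (rule deformation_model[OF assms(2) assms(3)[folded m_def] m])
  interpret D: deformed_quat "\<lambda>p. sc (ac p)" x v y fps_X c s u m
    "2 ^ m" "x + v" "sc (ac c) * ((x + v) ^ (2 ^ m - 1) + sc (ac u))"
    by (rule D reflexive)+
  interpret G: fin_monoid ?G by (rule fin_monoid_quat) simp
  let ?I = "carrier ?G" and ?\<beta> = D.basis
  have ind: "sc.indep ?I ?\<beta>" and span: "sc.lspan ?I ?\<beta> = block_algebra (2 ^ m)"
    unfolding D.basis_def sc.lspan_reindex[OF quat_index(1)[OF M]]
    by (rule sc.indep_reindex[OF quat_index(1)[OF M] ind0], rule span0)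
  have h0: "central_hom (\<lambda>r::'k. sc (ac (fps_const r)))"
    by (rule central_hom_sc) (simp_all only: ac_simps(1-3)[symmetric] fps_const_add fps_const_mult fps_const_1_eq_1)
  have h2: "central_hom (\<lambda>c::'k fls. sc (to_ac c))" by (rule central_hom_sc) simp_all
  \<comment> \<open>Independence over the algebraic closure restricts to k, k[[t]] and k((t)),
    because these embed injectively.\<close>
  have ind_ac: "central_hom.indep (\<lambda>r::'k. sc (ac (fps_const r))) ?I ?\<beta>"
    by (rule sc.indep_comp[OF ind h0]) (metis ac_simps(4,5) fps_const_eq_0_iff)
  have ind1: "D.indep ?I ?\<beta>"
    by (rule sc.indep_comp[OF ind D.central_hom_axioms]) (metis ac_simps(4,5))
  have ind2: "central_hom.indep (\<lambda>c::'k fls. sc (to_ac c)) ?I ?\<beta>"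
    by (rule sc.indep_comp[OF ind h2]) simp
  \<comment> \<open>Only a linear embedding: the group algebra does not multiply like the matrices,
    so it enters the base change to k[[t]] as a module.\<close>
  have kG: "lin_emb (\<lambda>r::'k. sc (ac (fps_const r))) (group_algebra ?G)
      (G.extend (\<lambda>r. sc (ac (fps_const r))) ?\<beta>) ?I ?\<beta>"
    by (rule G.group_algebra_lin_emb[OF h0 ind_ac])
  interpret \<Lambda>0: base_change_emb "\<lambda>r::'k. sc (ac (fps_const r))" "group_algebra ?G"
    "G.extend (\<lambda>r. sc (ac (fps_const r))) ?\<beta>" ?I ?\<beta> "\<lambda>p. sc (ac p)" fps_const
    by (intro base_change_emb.intro base_change_emb_axioms.intro kG D.central_hom_axioms ind1) simp_all
  let ?val0 = \<Lambda>0.T.val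
  obtain m' u' where \<Lambda>_emb: "alg_emb (\<lambda>p. sc (ac p)) (\<Lambda>0.ext\<lparr>monoid.mult := m', one := u'\<rparr>) ?val0 ?I ?\<beta>"
    by (rule lin_emb.transported_alg_emb[OF \<Lambda>0.ext_lin_emb, unfolded D.basis_span, OF D.L_one D.L_mult])
  define \<Lambda> where "\<Lambda> = \<Lambda>0.ext\<lparr>monoid.mult := m', one := u'\<rparr>"
  interpret \<Lambda>: reduction "\<lambda>p. sc (ac p)" \<Lambda> ?val0 ?G ?\<beta>
    by (intro reduction.intro reduction_axioms.intro G.fin_monoid_axioms ind1 D.basis_one \<Lambda>_emb[folded \<Lambda>_def])
      (simp only: D.basis_span D.basis_mult)
  interpret At: base_change_alg_emb "\<lambda>p. sc (ac p)" \<Lambda> ?val0 ?I ?\<beta> "\<lambda>c. sc (to_ac c)" fps_to_fls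
    by (intro base_change_alg_emb.intro base_change_emb.intro base_change_emb_axioms.intro h2 ind2
        \<Lambda>.lin_emb_axioms \<Lambda>.alg_emb_axioms) (simp_all add: ac_def fls_times_fps_to_fls)
  let ?At = At.ext
  \<comment> \<open>\<open>At\<close> is used in two ways: as a form of the block algebra, for
    separability, and below as the input of one more base change with the same basis, for the
    splitting over the closure.\<close>
  interpret At_split: split_emb to_ac ?At At.T.val ?I ?\<beta>
    by (intro split_emb.intro split_emb_axioms.intro At.ext_alg_emb ind) simp_all
  interpret AtK: base_change_alg_emb "\<lambda>c. sc (to_ac c)" ?At At.T.val ?I ?\<beta> sc to_ac
    by (intro base_change_alg_emb.intro base_change_emb.intro base_change_emb_axioms.intro ind
        At.ext_lin_emb At.ext_alg_emb sc.central_hom_axioms) simp_all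
  have full: "full_emb AtK.ext AtK.T.val ?I ?\<beta> (2 ^ m)"
    by (intro full_emb.intro full_emb_axioms.intro AtK.ext_alg_emb span) simp
  obtain \<Psi> \<gamma> where complex: "full_emb (group_algebra ?G :: (complex, _) module) \<Psi> ?I \<gamma> (2 ^ m)"
    using complex_full_emb[OF M] by blast
  have "is_deformation (group_algebra ?G :: ('k, _) module) ?At"
    unfolding is_deformation_def Let_def
    using G.assoc_algebra_group_algebra \<Lambda>.assoc_algebra \<Lambda>.quotient_iso
    by (intro conjI exI[of _ m'] exI[of _ u']) (simp_all only: \<Lambda>_def)
  moreover have "separable_algebra ?R ?At" by (rule At_split.separable_if_block[OF span])
  moreover note full_emb.iso_split[OF full] same_component_dimensions_full[OF full complex]
  ultimately show ?thesis unfolding G m_def by blast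
qed

end
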